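(* Let $K$ be a nonzero commutative ring with identity, $x\in K$ invertible, $q=x^2$, and suppose there is $a\in K$ with $a^4=-1$. Let $m\in\mathbb Z$ and $n\ge1$, and set $r=a^2q^m$, $s=a^5x$, $t=a^3x$. Let $b_n^{\mathbb Z[q,q^{-1}]}(q,m)$ be the blob algebra over $\mathbb Z[q,q^{-1}]$ with parameters $q$, $\gamma=q^{m-1}-q^{-m+1}$ and $\delta_e=q^m-q^{-m}$. Then the algebra homomorphism $$\rho_0:b_n^{\mathbb Z[q,q^{-1}]}(q,m)\longrightarrow \mathrm{End}_{\mathbb Z[a,x,x^{-1}]}(V_2^{\otimes 2n}),\qquad \rho_0(e)=a^{-2}M_2^r(U_n),\quad \rho_0(\mathcal U_i)=M_2^s(U_{n-i})\,M_2^t(U_{n+i})\ \ (1\le i\le n-1),$$ is a mirror representation, and it is faithful.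
   Context: Rings. $\mathbb Z[q,q^{-1}]\subseteq\mathbb Z[a,x,x^{-1}]\subseteq K$ denote the subrings of $K$ generated by the indicated elements. $V_2$ is the free module of rank 2 over $\mathbb Z[a,x,x^{-1}]$ with basis labelled $1,2$; the basis of $V_2^{\otimes N}$ is labelled by words of length $N$ in $\{1,2\}$. Blob algebra. An $(N,N)$ TL (Temperley--Lieb) diagram is a rectangular frame with $N$ northern nodes labelled $1,\dots,N$ and $N$ southern nodes labelled $1',\dots,N'$ (left to right), connected in pairs by non-touching lines in the plane interior to the frame, up to having the same pairing of nodes. $(ij)\in D$ means that nodes $i,j$ (primed, unprimed or mixed) are connected in $D$. A line is exposed if it may be deformed to touch the western edge of the frame. A blob diagram is a TL diagram in which any exposed line may be decorated with a blob; $\mathcal D^b(n,n)$ is the set of $(n,n)$ blob diagrams (each line carrying at most one blob). The blob algebra with parameters $q,\gamma,\delta_e$ over a commutative ring is the algebra with basis $\mathcal D^b(n,n)$ and multiplication by stacking (first factor on top), where two blobs on the same line are replaced by one blob and a factor $\delta_e$; a closed loop without a blob is removed with a factor $[2]=q+q^{-1}$; a closed loop with a blob is removed with a factor $\gamma$. $\mathcal U_i$ ($1\le i\le n-1$) is the undecorated diagram joining $i$ to $i+1$, $i'$ to $(i+1)'$ and $j$ to $j'$ for $j\ne i,i+1$; $e$ is the identity diagram with a blob on the leftmost line $(11')$. The algebra is generated by $1,e,\mathcal U_1,\dots,\mathcal U_{n-1}$. Operators. For an invertible $p$, set $$\mathcal U^p=\begin{pmatrix}0&0&0&0\\0&p&1&0\\0&1&p^{-1}&0\\0&0&0&0\end{pmatrix}$$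 with respect to the basis $11,12,21,22$ of $V_2\otimes V_2$. For $1\le k\le 2n-1$, $M_2^p(U_k)\in\mathrm{End}(V_2^{\otimes2n})$ acts trivially on every tensor factor except the $k$-th and $(k+1)$-th, where it acts as $\mathcal U^p$. It is known (Martin--Woodcock) that, with $r=a^2q^m$, $s=a^5x$, $t=a^3x$, the assignments $e\mapsto a^{-2}M_2^r(U_n)$ and $\mathcal U_i\mapsto M_2^s(U_{n-i})\,M_2^t(U_{n+i})$ ($1\le i\le n-1$) define an algebra homomorphism $\rho_0:b_n^{\mathbb Z[q,q^{-1}]}(q,m)\to\mathrm{End}_{\mathbb Z[a,x,x^{-1}]}(V_2^{\otimes 2n})$ (linear over $\mathbb Z[q,q^{-1}]$). Mirror representation. Two matrices $M,N$ of the same shape are mask equivalent if $M_{ij}=0\iff N_{ij}=0$ for all $i,j$; $[M]$ is the mask equivalence class of $M$. For $1\le k\le 2n-1$ let $U_k$ be the $(2n,2n)$ TL diagram joining $k$ to $k+1$, $k'$ to $(k+1)'$, and $j$ to $j'$ otherwise. For a TL diagram $D$ and an invertible $p$ (with square root), $R_p(D)$ is the matrix indexed by words $v,w$ of length $2n$ in $\{1,2\}$ with entries $$R_p(D)_{vw}=\Bigl(\prod_{i<j,\ (ij)\in D} p^{\mathrm{sign}(v_i-v_j)/2}\,\delta'_{v_iv_j}\Bigr)\Bigl(\prod_{(ij')\in D}\delta_{v_iw_j}\Bigr)\Bigl(\prod_{i<j,\ (i'j')\in D} p^{\mathrm{sign}(w_i-w_j)/2}\,\delta'_{w_iw_j}\Bigr),$$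 where $\delta_{ab}=1$ if $a=b$ and $0$ otherwise, $\delta'_{ab}=1-\delta_{ab}$, and a factor containing $\delta'_{aa}$ is read as $0$; the class $[R_p(D)]$ is independent of $p$. A representation $\rho$ of the blob algebra by $2^{2n}\times2^{2n}$ matrices is a mirror representation if $\rho(e)\in[R_p(U_n)]$ and, for each $1\le i\le n-1$, $\rho(\mathcal U_i)=X_iY_i$ with $X_i\in[R_{p'}(U_{n-i})]$ and $Y_i\in[R_{p''}(U_{n+i})]$ for some $p,p',p''$. *)

theory Defs
  imports Main "HOL.Hull" "HOL-Library.FuncSet" "HOL-Library.Disjoint_Sets"
begin

section \<open>Units and generated subrings of a commutative ring\<close>

definition unit_inv :: "'k::comm_ring_1 \<Rightarrow> 'k" where
  "unit_inv u = (THE v. u * v = 1)"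

text \<open>Integer powers; only meaningful for invertible \<open>u\<close> when the exponent is negative.\<close>

definition unit_powi :: "'k::comm_ring_1 \<Rightarrow> int \<Rightarrow> 'k" where
  "unit_powi u k = (if 0 \<le> k then u ^ nat k else unit_inv u ^ nat (- k))"

definition is_subring :: "'k::comm_ring_1 set \<Rightarrow> bool" where
  "is_subring R \<longleftrightarrow> 1 \<in> R \<and> (\<forall>u\<in>R. \<forall>v\<in>R. u - v \<in> R \<and> u * v \<in> R)"

definition generated_subring :: "'k::comm_ring_1 set \<Rightarrow> 'k set" where
  "generated_subring A = is_subring hull A"


section \<open>Temperley--Lieb and blob diagrams\<close>

text \<open>\<open>North i\<close> is the node \<open>i\<close> and \<open>South i\<close> is the node \<open>i'\<close>. A line is the set of its
  two end points.\<close>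

datatype node = North nat | South nat

type_synonym line = "node set"
type_synonym diagram = "line set"

definition nodes :: "nat \<Rightarrow> node set" where
  "nodes N = North ` {1..N} \<union> South ` {1..N}"

text \<open>Position of a node when walking clockwise around the frame, starting and ending
  at the western edge: \<open>1, \<dots>, N, N', \<dots>, 1'\<close>.\<close>

fun pos :: "nat \<Rightarrow> node \<Rightarrow> nat" where
  "pos N (North i) = i"
| "pos N (South i) = 2 * N + 1 - i"

text \<open>A pairing of the nodes is realised by non-touching lines in the interior of the frame
  iff no two of its lines have interlaced end points on the boundary.\<close>

definition noncrossing :: "nat \<Rightarrow> diagram \<Rightarrow> bool" where
  "noncrossing N D \<longleftrightarrow>
     (\<nexists>a b c d. {a, c} \<in> D \<and> {b, d} \<in> D \<and>
        pos N a < pos N b \<and> pos N b < pos N c \<and> pos N c < pos N d)"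

definition TL_diagrams :: "nat \<Rightarrow> diagram set" where
  "TL_diagrams N =
     {D. partition_on (nodes N) D \<and> (\<forall>l\<in>D. card l = 2) \<and> noncrossing N D}"

text \<open>The western edge lies between the last and the first node of the walk, so a line can
  be deformed to touch it iff no line encloses it, i.e. has one end point
  before and one end point after both of its end points.\<close>

definition exposed :: "nat \<Rightarrow> diagram \<Rightarrow> line \<Rightarrow> bool" where
  "exposed N D l \<longleftrightarrow> l \<in> D \<and>
     (\<nexists>c d. {c, d} \<in> D \<and> (\<forall>a\<in>l. pos N c < pos N a \<and> pos N a < pos N d))"

text \<open>A blob diagram is a TL diagram together with its set of decorated lines.\<close>

type_synonym blob_diagram = "diagram \<times> line set"

definition blob_diagrams :: "nat \<Rightarrow> blob_diagram set" where
  "blob_diagrams n =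
     {(D, B). D \<in> TL_diagrams n \<and> (\<forall>l\<in>B. exposed n D l)}"

definition id_diagram :: "nat \<Rightarrow> diagram" where
  "id_diagram N = {{North j, South j} |j. j \<in> {1..N}}"

definition U_diagram :: "nat \<Rightarrow> nat \<Rightarrow> diagram" where
  "U_diagram N i =
     {{North i, North (i + 1)}, {South i, South (i + 1)}} \<union>
     {{North j, South j} |j. j \<in> {1..N} - {i, i + 1}}"


section \<open>Stacking\<close>

text \<open>In a stack the southern nodes of the upper diagram are identified with the northern
  nodes of the lower diagram; they become the middle nodes \<open>Mid i\<close>.\<close>

datatype stack_node = Top nat | Mid nat | Bot nat

fun upper :: "node \<Rightarrow> stack_node" where
  "upper (North i) = Top i"
| "upper (South i) = Mid i"

fun lower :: "node \<Rightarrow> stack_node" where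
  "lower (North i) = Mid i"
| "lower (South i) = Bot i"

fun outer :: "node \<Rightarrow> stack_node" where
  "outer (North i) = Top i"
| "outer (South i) = Bot i"

definition stack_nodes :: "nat \<Rightarrow> stack_node set" where
  "stack_nodes N = Top ` {1..N} \<union> Mid ` {1..N} \<union> Bot ` {1..N}"

definition stack_adj :: "diagram \<Rightarrow> diagram \<Rightarrow> (stack_node \<times> stack_node) set" where
  "stack_adj D1 D2 =
     {(u, v). (\<exists>l\<in>D1. u \<in> upper ` l \<and> v \<in> upper ` l) \<or>
              (\<exists>l\<in>D2. u \<in> lower ` l \<and> v \<in> lower ` l)}"

text \<open>Connected components of the stack: the lines of the product and the closed loops.\<close>

definition components :: "nat \<Rightarrow> diagram \<Rightarrow> diagram \<Rightarrow> stack_node set set" where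
  "components N D1 D2 = stack_nodes N // (stack_adj D1 D2)\<^sup>*"

text \<open>End points of a component on the frame of the product; empty for a closed loop.\<close>

definition ends :: "stack_node set \<Rightarrow> line" where
  "ends C = outer -` C"

definition blob_count :: "line set \<Rightarrow> line set \<Rightarrow> stack_node set \<Rightarrow> nat" where
  "blob_count B1 B2 C =
     card {l\<in>B1. upper ` l \<subseteq> C} + card {l\<in>B2. lower ` l \<subseteq> C}"

fun stack_diagram :: "nat \<Rightarrow> blob_diagram \<Rightarrow> blob_diagram \<Rightarrow> blob_diagram" where
  "stack_diagram N (D1, B1) (D2, B2) =
     ({ends C |C. C \<in> components N D1 D2 \<and> ends C \<noteq> {}},
      {ends C |C. C \<in> components N D1 D2 \<and> ends C \<noteq> {} \<and> 0 < blob_count B1 B2 C})"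

text \<open>Factor of a component carrying \<open>b\<close> blobs. Reducing \<open>b \<ge> 1\<close> blobs to a single one
  contributes \<open>\<delta> ^ (b - 1)\<close>, and truncated subtraction gives no factor for \<open>b = 0\<close>.\<close>

definition component_factor ::
    "'k::comm_ring_1 \<Rightarrow> 'k \<Rightarrow> 'k \<Rightarrow> nat \<Rightarrow> stack_node set \<Rightarrow> 'k" where
  "component_factor q \<gamma> \<delta> b C =
     \<delta> ^ (b - 1) *
     (if ends C \<noteq> {} then 1 else if b = 0 then q + unit_inv q else \<gamma>)"

fun stack_factor ::
    "nat \<Rightarrow> 'k::comm_ring_1 \<Rightarrow> 'k \<Rightarrow> 'k \<Rightarrow> blob_diagram \<Rightarrow> blob_diagram \<Rightarrow> 'k" where
  "stack_factor N q \<gamma> \<delta> (D1, B1) (D2, B2) =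
     (\<Prod>C\<in>components N D1 D2. component_factor q \<gamma> \<delta> (blob_count B1 B2 C) C)"


section \<open>The blob algebra\<close>

text \<open>Elements over the coefficient ring \<open>R\<close> are the \<open>R\<close>-valued coefficient functions on
  the basis of blob diagrams, extended by zero. Addition and scalar multiplication are
  pointwise.\<close>

type_synonym 'k blob_element = "blob_diagram \<Rightarrow> 'k"

definition blob_algebra :: "nat \<Rightarrow> 'k::comm_ring_1 set \<Rightarrow> 'k blob_element set" where
  "blob_algebra n R =
     {f. (\<forall>d\<in>blob_diagrams n. f d \<in> R) \<and> (\<forall>d. d \<notin> blob_diagrams n \<longrightarrow> f d = 0)}"

definition blob_basis :: "blob_diagram \<Rightarrow> 'k::comm_ring_1 blob_element" where
  "blob_basis d = (\<lambda>d'. of_bool (d' = d))"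

definition blob_mult ::
    "nat \<Rightarrow> 'k::comm_ring_1 \<Rightarrow> 'k \<Rightarrow> 'k \<Rightarrow> 'k blob_element \<Rightarrow> 'k blob_element \<Rightarrow> 'k blob_element"
  where
  "blob_mult n q \<gamma> \<delta> f g =
     (\<lambda>d. \<Sum>d1\<in>blob_diagrams n. \<Sum>d2\<in>blob_diagrams n.
        f d1 * g d2 * stack_factor n q \<gamma> \<delta> d1 d2 * blob_basis (stack_diagram n d1 d2) d)"

definition blob_one :: "nat \<Rightarrow> 'k::comm_ring_1 blob_element" where
  "blob_one n = blob_basis (id_diagram n, {})"

definition blob_e :: "nat \<Rightarrow> 'k::comm_ring_1 blob_element" where
  "blob_e n = blob_basis (id_diagram n, {{North 1, South 1}})"

definition blob_U :: "nat \<Rightarrow> nat \<Rightarrow> 'k::comm_ring_1 blob_element" where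
  "blob_U n i = blob_basis (U_diagram n i, {})"


section \<open>Endomorphisms of the tensor power as matrices indexed by words\<close>

type_synonym word = "nat list"
type_synonym 'k wmat = "word \<Rightarrow> word \<Rightarrow> 'k"

definition words :: "nat \<Rightarrow> word set" where
  "words N = {w. length w = N \<and> set w \<subseteq> {1, 2}}"

text \<open>The letters of a word are numbered from 1, list positions from 0.\<close>

definition letter :: "word \<Rightarrow> nat \<Rightarrow> nat" where
  "letter w i = w ! (i - 1)"

text \<open>\<open>matrices N S\<close> is the endomorphism ring of the \<open>N\<close>-th tensor power of the free
  \<open>S\<close>-module of rank 2, written with respect to the basis of words; matrices are extended
  by zero.\<close>

definition matrices :: "nat \<Rightarrow> 'k::comm_ring_1 set \<Rightarrow> 'k wmat set" where
  "matrices N S =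
     {A. (\<forall>v\<in>words N. \<forall>w\<in>words N. A v w \<in> S) \<and>
         (\<forall>v w. \<not> (v \<in> words N \<and> w \<in> words N) \<longrightarrow> A v w = 0)}"

definition mat_mult :: "nat \<Rightarrow> 'k::comm_ring_1 wmat \<Rightarrow> 'k wmat \<Rightarrow> 'k wmat" where
  "mat_mult N A B = (\<lambda>v w. \<Sum>u\<in>words N. A v u * B u w)"

definition mat_one :: "nat \<Rightarrow> 'k::comm_ring_1 wmat" where
  "mat_one N = (\<lambda>v w. of_bool (v \<in> words N \<and> v = w))"

text \<open>The \<open>4 \<times> 4\<close> matrix; rows and columns are labelled by pairs of letters.\<close>

definition U_mat :: "'k::comm_ring_1 \<Rightarrow> nat \<times> nat \<Rightarrow> nat \<times> nat \<Rightarrow> 'k" where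
  "U_mat p b c =
     (if b = (1, 2) \<and> c = (1, 2) then p
      else if b = (1, 2) \<and> c = (2, 1) then 1
      else if b = (2, 1) \<and> c = (1, 2) then 1
      else if b = (2, 1) \<and> c = (2, 1) then unit_inv p
      else 0)"

definition M2 :: "nat \<Rightarrow> 'k::comm_ring_1 \<Rightarrow> nat \<Rightarrow> 'k wmat" where
  "M2 N p k = (\<lambda>v w.
     if v \<in> words N \<and> w \<in> words N \<and> (\<forall>j\<in>{1..N} - {k, k + 1}. letter v j = letter w j)
     then U_mat p (letter v k, letter v (k + 1)) (letter w k, letter w (k + 1))
     else 0)"


section \<open>Mirror representations\<close>

text \<open>The matrix \<open>R\<^sub>p(D)\<close> depends on a square root \<open>h\<close> of \<open>p\<close>, and \<open>R_mat N h D\<close> is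
  \<open>R\<^sub>p(D)\<close> for \<open>p = h\<^sup>2\<close>. The power with exponent \<open>sign / 2\<close> of \<open>p\<close> is \<open>h\<close> to the \<open>sign\<close>.\<close>

definition arc_weight :: "'k::comm_ring_1 \<Rightarrow> nat \<Rightarrow> nat \<Rightarrow> 'k" where
  "arc_weight h b c = unit_powi h (sgn (int b - int c)) * of_bool (b \<noteq> c)"

definition R_mat :: "nat \<Rightarrow> 'k::comm_ring_1 \<Rightarrow> diagram \<Rightarrow> 'k wmat" where
  "R_mat N h D = (\<lambda>v w.
     if v \<in> words N \<and> w \<in> words N then
       (\<Prod>(i, j)\<in>{(i, j). i \<in> {1..N} \<and> j \<in> {1..N} \<and> i < j \<and> {North i, North j} \<in> D}.
          arc_weight h (letter v i) (letter v j)) *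
       (\<Prod>(i, j)\<in>{(i, j). i \<in> {1..N} \<and> j \<in> {1..N} \<and> {North i, South j} \<in> D}.
          of_bool (letter v i = letter w j)) *
       (\<Prod>(i, j)\<in>{(i, j). i \<in> {1..N} \<and> j \<in> {1..N} \<and> i < j \<and> {South i, South j} \<in> D}.
          arc_weight h (letter w i) (letter w j))
     else 0)"

definition mask_equiv :: "nat \<Rightarrow> 'k::comm_ring_1 wmat \<Rightarrow> 'k wmat \<Rightarrow> bool" where
  "mask_equiv N A B \<longleftrightarrow> (\<forall>v\<in>words N. \<forall>w\<in>words N. A v w = 0 \<longleftrightarrow> B v w = 0)"

text \<open>\<open>\<rho>\<close> is a unital \<open>R\<close>-algebra homomorphism from the blob algebra over \<open>R\<close> on \<open>n\<close> strands
  to the matrices over \<open>S\<close> indexed by words of length \<open>2 n\<close>.\<close>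

definition blob_hom ::
    "nat \<Rightarrow> 'k::comm_ring_1 \<Rightarrow> 'k \<Rightarrow> 'k \<Rightarrow> 'k set \<Rightarrow> 'k set \<Rightarrow> ('k blob_element \<Rightarrow> 'k wmat) \<Rightarrow> bool"
  where
  "blob_hom n q \<gamma> \<delta> R S \<rho> \<longleftrightarrow>
     \<rho> \<in> blob_algebra n R \<rightarrow> matrices (2 * n) S \<and>
     (\<forall>f\<in>blob_algebra n R. \<forall>g\<in>blob_algebra n R.
        \<rho> (\<lambda>d. f d + g d) = (\<lambda>v w. \<rho> f v w + \<rho> g v w)) \<and>
     (\<forall>c\<in>R. \<forall>f\<in>blob_algebra n R. \<rho> (\<lambda>d. c * f d) = (\<lambda>v w. c * \<rho> f v w)) \<and>
     (\<forall>f\<in>blob_algebra n R. \<forall>g\<in>blob_algebra n R.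
        \<rho> (blob_mult n q \<gamma> \<delta> f g) = mat_mult (2 * n) (\<rho> f) (\<rho> g)) \<and>
     \<rho> (blob_one n) = mat_one (2 * n)"

definition mirror_representation ::
    "nat \<Rightarrow> 'k::comm_ring_1 \<Rightarrow> 'k \<Rightarrow> 'k \<Rightarrow> 'k set \<Rightarrow> 'k set \<Rightarrow> ('k blob_element \<Rightarrow> 'k wmat) \<Rightarrow> bool"
  where
  "mirror_representation n q \<gamma> \<delta> R S \<rho> \<longleftrightarrow>
     blob_hom n q \<gamma> \<delta> R S \<rho> \<and>
     (\<exists>h. h dvd 1 \<and> mask_equiv (2 * n) (\<rho> (blob_e n)) (R_mat (2 * n) h (U_diagram (2 * n) n))) \<and>
     (\<forall>i. 1 \<le> i \<and> i \<le> n - 1 \<longrightarrow>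
        (\<exists>X\<in>matrices (2 * n) S. \<exists>Y\<in>matrices (2 * n) S.
           \<rho> (blob_U n i) = mat_mult (2 * n) X Y \<and>
           (\<exists>h. h dvd 1 \<and> mask_equiv (2 * n) X (R_mat (2 * n) h (U_diagram (2 * n) (n - i)))) \<and>
           (\<exists>h. h dvd 1 \<and> mask_equiv (2 * n) Y (R_mat (2 * n) h (U_diagram (2 * n) (n + i))))))"

end

theory Submission
  imports Defs
begin

text \<open>Unfold a blob diagram along its western edge: an undecorated line becomes two mirror
  copies of itself, while a decorated line is cut, and each of its ends is joined to its own mirror
  image. Every matrix \<open>\<rho>\<^sub>0 d\<close> of a diagram \<open>d\<close> has units at the entries compatible with the
  unfolded diagram and zeros elsewhere. This holds for the generators, and a diagram is reached from
  the identity by multiplying on the left by generators without ever closing a loop or merging two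
  blobs, so that each nonzero entry of such a product consists of a single term.

  For faithfulness, encode a diagram by the bracket word that opens at the first end of an undecorated
  line and at both ends of a decorated line, and closes at the second end of an undecorated line. The
  entry at which one half reads this word and the other half its opposite is a unit for \<open>d\<close>, and it
  vanishes for every other diagram whose brackets do not open earlier than those of \<open>d\<close>; hence the
  matrices of the diagrams are triangular with units on the diagonal.\<close>

section \<open>Units and subrings\<close>

text \<open>The base ring is arbitrary, so \<open>q + unit_inv q\<close>, \<gamma> and \<delta> may
  be zero or zero divisors, and a sum of two units may vanish. Hence the factorisations admit only
  products in which every component factor is 1 and every nonzero entry is one product of units; the
  parameters of the operators enter as units, and \<open>a ^ 4 = - 1\<close> supplies the inverse
  \<open>- (a ^ 3)\<close> of \<open>a\<close>. The difficulty is to factor every diagram in this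
  way. A cap from i to i + 1 can be split off once there is a line just below it to exchange it
  with. The number of nodes east of the cap that are available for such a line is odd, so some line
  there must leave this region or be decorated; a decorated line serves as well because, once cut,
  it runs off to the western edge. Lengths measured in columns show that the exchange shortens the
  diagram. Brackets recover a diagram because decorated lines are exposed: their ends are the
  unmatched opening brackets, no other line encloses them, and so they pair up consecutively along
  the walk.\<close>

lemma unit_inv_right:
  fixes u :: "'k::comm_ring_1"
  assumes "u dvd 1" shows "u * unit_inv u = 1"
proof -
  from assms obtain v where v: "u * v = 1" by (metis dvdE)
  have "v' = v" if "u * v' = 1" for v'
  proof -
    have "v' = (u * v) * v'" using v by simp
    also have "\<dots> = v * (u * v')" by (simp add: algebra_simps)
    finally show ?thesis using that by simp
  qed
  with v show ?thesis unfolding unit_inv_def by (rule theI)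
qed

lemma unit_inv_eqI:
  fixes u :: "'k::comm_ring_1"
  assumes "u * v = 1" shows "unit_inv u = v"
proof -
  have "u dvd 1" using assms by (metis dvdI)
  then have "u * unit_inv u = 1" by (rule unit_inv_right)
  have "unit_inv u = (u * v) * unit_inv u" using assms by simp
  also have "\<dots> = v * (u * unit_inv u)" by (simp add: algebra_simps)
  finally show ?thesis using \<open>u * unit_inv u = 1\<close> by simp
qed

lemma unit_inv_dvd_one:
  fixes u :: "'k::comm_ring_1"
  assumes "u dvd 1" shows "unit_inv u dvd 1"
  using unit_inv_right[OF assms] by (metis dvdI mult.commute)

lemma unit_mult:
  fixes u :: "'k::comm_ring_1"
  assumes "u dvd 1" "v dvd 1" shows "u * v dvd 1"
  using mult_dvd_mono[OF assms] by simp

lemma unit_power: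
  fixes u :: "'k::comm_ring_1"
  assumes "u dvd 1" shows "u ^ k dvd 1"
  by (induction k) (auto intro: unit_mult assms)

lemma unit_powi_dvd_one:
  fixes u :: "'k::comm_ring_1"
  assumes "u dvd 1" shows "unit_powi u k dvd 1"
  unfolding unit_powi_def by (auto intro: unit_power unit_inv_dvd_one assms)

lemma unit_nonzero:
  fixes u :: "'k::comm_ring_1"
  assumes "u dvd 1" shows "u \<noteq> 0"
  using assms by auto

lemma unit_mult_eq_0D:
  fixes u :: "'k::comm_ring_1"
  assumes "u dvd 1" "c * u = 0" shows "c = 0"
proof -
  have "c * u * unit_inv u = c" using unit_inv_right[OF assms(1)] by (simp add: mult.assoc)
  then show ?thesis using assms(2) by simp
qed

lemma is_subring_generated: "is_subring (generated_subring A)"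
  unfolding generated_subring_def by (rule hull_in) (auto simp: is_subring_def)

lemma generated_subring_superset: "A \<subseteq> generated_subring A"
  unfolding generated_subring_def by (rule hull_subset)

lemma
  assumes "is_subring R"
  shows is_subring_one: "1 \<in> R"
    and is_subring_zero: "0 \<in> R"
    and is_subring_uminus: "u \<in> R \<Longrightarrow> - u \<in> R"
    and is_subring_mult: "u \<in> R \<Longrightarrow> v \<in> R \<Longrightarrow> u * v \<in> R"
    and is_subring_power: "u \<in> R \<Longrightarrow> u ^ k \<in> R"
proof -
  have d: "u - v \<in> R" if "u \<in> R" "v \<in> R" for u v
    using assms that by (simp add: is_subring_def)
  show 1: "1 \<in> R" and m: "u \<in> R \<Longrightarrow> v \<in> R \<Longrightarrow> u * v \<in> R" for u v
    using assms by (auto simp: is_subring_def)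
  show 0: "0 \<in> R" using d[OF 1 1] by simp
  show "u \<in> R \<Longrightarrow> - u \<in> R" using d[OF 0] by fastforce
  show "u \<in> R \<Longrightarrow> u ^ k \<in> R" by (induction k) (auto intro: 1 m)
qed

section \<open>Masks\<close>

text \<open>Units, and not merely nonzero entries, are demanded on the support: in a ring with zero
  divisors a product of nonzero entries may vanish, a product of units cannot.\<close>

definition has_mask :: "nat \<Rightarrow> 'k::comm_ring_1 wmat \<Rightarrow> (word \<Rightarrow> word \<Rightarrow> bool) \<Rightarrow> bool" where
  "has_mask N A c \<longleftrightarrow>
     (\<forall>v\<in>words N. \<forall>w\<in>words N. if c v w then A v w dvd 1 else A v w = 0)"

lemma finite_words: "finite (words N)"
  unfolding words_def using finite_lists_length_eq[of "{1,2::nat}" N]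
  by (simp add: conj_commute)

text \<open>By \<open>uniq\<close> at most one intermediate word contributes to an entry, so the sum
  over words has at most one nonzero term and nothing can cancel.\<close>

lemma has_mask_mult:
  assumes A: "has_mask N A c1" and B: "has_mask N B c2"
    and iff: "\<And>v w. v \<in> words N \<Longrightarrow> w \<in> words N \<Longrightarrow>
                c v w \<longleftrightarrow> (\<exists>u\<in>words N. c1 v u \<and> c2 u w)"
    and uniq: "\<And>v w u u'. v \<in> words N \<Longrightarrow> w \<in> words N \<Longrightarrow> u \<in> words N \<Longrightarrow> u' \<in> words N \<Longrightarrow>
                 c1 v u \<Longrightarrow> c2 u w \<Longrightarrow> c1 v u' \<Longrightarrow> c2 u' w \<Longrightarrow> u = u'"
  shows "has_mask N (mat_mult N A B) c"
  unfolding has_mask_def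
proof (intro ballI)
  fix v w assume v: "v \<in> words N" and w: "w \<in> words N"
  have z: "A v u * B u w = 0" if "u \<in> words N" "\<not> (c1 v u \<and> c2 u w)" for u
    using A B v w that unfolding has_mask_def by (metis mult_zero_left mult_zero_right)
  show "if c v w then mat_mult N A B v w dvd 1 else mat_mult N A B v w = 0"
  proof (cases "c v w")
    case True
    then obtain u where u: "u \<in> words N" "c1 v u" "c2 u w" using iff[OF v w] by blast
    have "mat_mult N A B v w = (\<Sum>u'\<in>{u}. A v u' * B u' w)"
      unfolding mat_mult_def
      by (rule sum.mono_neutral_right) (use u finite_words z uniq[OF v w u(1)] in \<open>blast+\<close>)
    moreover have "A v u * B u w dvd 1"
      using A B v w u unfolding has_mask_def by (metis unit_mult)
    ultimately show ?thesis using True by simp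
  next
    case False
    then have "\<And>u. u \<in> words N \<Longrightarrow> \<not> (c1 v u \<and> c2 u w)" using iff[OF v w] by blast
    then have "mat_mult N A B v w = 0"
      unfolding mat_mult_def using z by (simp add: sum.neutral)
    with False show ?thesis by simp
  qed
qed

lemma has_mask_scale:
  assumes "has_mask N A c" "u dvd 1" shows "has_mask N (\<lambda>v w. u * A v w) c"
  using assms unfolding has_mask_def by (auto intro: unit_mult split: if_splits)

lemma has_mask_mask_equiv:
  assumes "has_mask N A c" "has_mask N B c" shows "mask_equiv N A B"
  using assms unfolding has_mask_def mask_equiv_def by (metis unit_nonzero)

section \<open>Words and their letters\<close>

lemma letter_words:
  assumes "w \<in> words N" "j \<in> {1..N}" shows "letter w j = 1 \<or> letter w j = 2"
proof -
  have "w ! (j - 1) \<in> set w" using assms by (intro nth_mem) (auto simp: words_def)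
  then show ?thesis using assms by (auto simp: words_def letter_def)
qed

lemma words_eqI:
  assumes "v \<in> words N" "w \<in> words N" "\<And>j. j \<in> {1..N} \<Longrightarrow> letter v j = letter w j"
  shows "v = w"
proof (rule nth_equalityI)
  show "length v = length w" using assms by (simp add: words_def)
  fix i assume "i < length v"
  then have "Suc i \<in> {1..N}" using assms by (auto simp: words_def)
  from assms(3)[OF this] show "v ! i = w ! i" by (simp add: letter_def)
qed

lemma words_exists:
  assumes "\<And>j. j \<in> {1..N} \<Longrightarrow> g j \<in> {1,2::nat}"
  shows "\<exists>v\<in>words N. \<forall>j\<in>{1..N}. letter v j = g j"
proof
  have "g ` {1..N} \<subseteq> {1,2}" using assms by blast
  then show "map g [1..<Suc N] \<in> words N"
    by (simp add: words_def atLeastLessThanSuc_atLeastAtMost del: upt_Suc)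
  show "\<forall>j\<in>{1..N}. letter (map g [1..<Suc N]) j = g j"
    by (auto simp: letter_def simp del: upt_Suc)
qed

text \<open>The common mask of \<open>M2\<close> and of \<open>R_mat\<close> for the diagram
  \<open>U_k\<close>: its two arcs demand different letters, its vertical lines equal ones.\<close>

definition flip_mask :: "nat \<Rightarrow> nat \<Rightarrow> word \<Rightarrow> word \<Rightarrow> bool" where
  "flip_mask N k v w \<longleftrightarrow> letter v k \<noteq> letter v (k + 1) \<and> letter w k \<noteq> letter w (k + 1) \<and>
     (\<forall>j\<in>{1..N} - {k, k + 1}. letter v j = letter w j)"

lemma U_mat_mask:
  assumes "p dvd 1" "b1 \<in> {1,2}" "b2 \<in> {1,2}" "c1 \<in> {1,2}" "c2 \<in> {1,2}"
  shows "if b1 \<noteq> b2 \<and> c1 \<noteq> c2 then U_mat p (b1, b2) (c1, c2) dvd 1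
         else U_mat p (b1, b2) (c1, c2) = 0"
  using assms(2-5) unit_inv_dvd_one[OF assms(1)] assms(1)
  by (elim insertE emptyE) (simp_all add: U_mat_def)

lemma has_mask_M2:
  assumes "p dvd 1" "1 \<le> k" "k < N"
  shows "has_mask N (M2 N p k) (flip_mask N k)"
  unfolding has_mask_def
proof (intro ballI)
  fix v w assume vw: "v \<in> words N" "w \<in> words N"
  have "letter v k \<in> {1,2}" "letter v (k+1) \<in> {1,2}" "letter w k \<in> {1,2}" "letter w (k+1) \<in> {1,2}"
    using vw assms letter_words[of _ N] by auto
  from U_mat_mask[OF assms(1) this]
  show "if flip_mask N k v w then M2 N p k v w dvd 1 else M2 N p k v w = 0"
    using vw unfolding M2_def flip_mask_def by presburger
qed

lemma M2_in_matrices: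
  assumes "is_subring S" "p \<in> S" "unit_inv p \<in> S"
  shows "M2 N p k \<in> matrices N S"
  using assms is_subring_zero[OF assms(1)] is_subring_one[OF assms(1)]
  by (auto simp: matrices_def M2_def U_mat_def)

lemma prod_of_bool:
  "finite A \<Longrightarrow> (\<Prod>x\<in>A. of_bool (Q x) :: 'k::comm_ring_1) = of_bool (\<forall>x\<in>A. Q x)"
  by (induction A rule: finite_induct) auto

lemma arc_weight_one: "arc_weight 1 b c = (of_bool (b \<noteq> c) :: 'k::comm_ring_1)"
proof -
  have "unit_inv (1::'k) = 1" by (rule unit_inv_eqI) simp
  then show ?thesis by (simp add: arc_weight_def unit_powi_def)
qed

text \<open>The mirror condition leaves the square root \<open>h\<close> free. With
  \<open>h = 1\<close> every arc weight is 0 or 1, so the matrix is the indicator of its own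
  mask.\<close>

lemma has_mask_R_mat:
  assumes "1 \<le> k" "k < N"
  shows "has_mask N (R_mat N (1::'k::comm_ring_1) (U_diagram N k)) (flip_mask N k)"
proof -
  have n: "{(i, j). i \<in> {1..N} \<and> j \<in> {1..N} \<and> i < j \<and> {North i, North j} \<in> U_diagram N k} = {(k, k+1)}"
    using assms by (auto simp: U_diagram_def doubleton_eq_iff)
  have s: "{(i, j). i \<in> {1..N} \<and> j \<in> {1..N} \<and> i < j \<and> {South i, South j} \<in> U_diagram N k} = {(k, k+1)}"
    using assms by (auto simp: U_diagram_def doubleton_eq_iff)
  have t: "{(i, j). i \<in> {1..N} \<and> j \<in> {1..N} \<and> {North i, South j} \<in> U_diagram N k} =
     (\<lambda>j. (j, j)) ` ({1..N} - {k, k+1})"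
    by (auto simp: U_diagram_def doubleton_eq_iff)
  have i: "inj_on (\<lambda>j. (j, j)) A" for A :: "nat set" by (auto simp: inj_on_def)
  have "R_mat N (1::'k) (U_diagram N k) v w = of_bool (flip_mask N k v w)"
    if "v \<in> words N" "w \<in> words N" for v w
  proof -
    show ?thesis
      unfolding R_mat_def n s t flip_mask_def using that
      by (simp add: prod.reindex[OF i] o_def arc_weight_one prod_of_bool of_bool_conj
          ac_simps del: Diff_iff insert_iff One_nat_def)
  qed
  then show ?thesis by (simp add: has_mask_def)
qed

section \<open>Blob diagrams\<close>

lemma nodes_simps [simp]:
  "North j \<in> nodes N \<longleftrightarrow> 1 \<le> j \<and> j \<le> N" "South j \<in> nodes N \<longleftrightarrow> 1 \<le> j \<and> j \<le> N"
  by (auto simp: nodes_def)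

lemma finite_nodes: "finite (nodes N)"
  by (simp add: nodes_def)

lemma pos_bounds:
  assumes "u \<in> nodes N" shows "1 \<le> pos N u" "pos N u \<le> 2 * N"
proof -
  have "1 \<le> pos N u \<and> pos N u \<le> 2 * N" using assms by (cases u) auto
  then show "1 \<le> pos N u" "pos N u \<le> 2 * N" by auto
qed

lemma pos_eq_iff:
  assumes "u \<in> nodes N" "v \<in> nodes N" shows "pos N u = pos N v \<longleftrightarrow> u = v"
  using assms by (cases u; cases v) auto

lemma pos_surj:
  assumes "1 \<le> p" "p \<le> 2 * N" shows "\<exists>u\<in>nodes N. pos N u = p"
proof (cases "p \<le> N")
  case True
  then show ?thesis using assms by (intro bexI[of _ "North p"]) auto
next
  case False
  then show ?thesis using assms by (intro bexI[of _ "South (2 * N + 1 - p)"]) auto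
qed

lemma TL_line_cases:
  assumes "D \<in> TL_diagrams N" "l \<in> D" obtains u v where "l = {u, v}" "u \<noteq> v"
proof -
  have "card l = 2" using assms by (auto simp: TL_diagrams_def)
  then show ?thesis using that by (auto simp: card_2_iff)
qed

lemma TL_line_nodes:
  assumes "D \<in> TL_diagrams N" "{u, v} \<in> D" shows "u \<in> nodes N" "v \<in> nodes N" "u \<noteq> v"
proof -
  have "{u, v} \<subseteq> nodes N" using assms by (auto simp: TL_diagrams_def partition_on_def)
  then show "u \<in> nodes N" "v \<in> nodes N" by auto
  have "card {u, v} = 2" using assms by (auto simp: TL_diagrams_def)
  then show "u \<noteq> v" by auto
qed

lemma TL_line_ex:
  assumes "D \<in> TL_diagrams N" "u \<in> nodes N" obtains v where "{u, v} \<in> D"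
proof -
  have "u \<in> \<Union>D" using assms by (simp add: TL_diagrams_def partition_on_def)
  then obtain l where l: "l \<in> D" "u \<in> l" by blast
  obtain x y where xy: "l = {x, y}" using TL_line_cases[OF assms(1) l(1)] by blast
  then have "u = x \<or> u = y" using l by blast
  then show ?thesis using that[of x] that[of y] l(1) xy by (auto simp: insert_commute)
qed

lemma TL_block_unique:
  assumes "D \<in> TL_diagrams N" "l \<in> D" "l' \<in> D" "u \<in> l" "u \<in> l'" shows "l = l'"
  using assms unfolding TL_diagrams_def partition_on_def disjoint_def by blast

lemma TL_line_unique:
  assumes "D \<in> TL_diagrams N" "{u, v} \<in> D" "{u, v'} \<in> D" shows "v = v'"
  using TL_block_unique[OF assms, of u] by (auto simp: doubleton_eq_iff)

lemma TL_diagramsI: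
  assumes "\<And>l. l \<in> D \<Longrightarrow> \<exists>u v. l = {u, v} \<and> u \<noteq> v \<and> u \<in> nodes N \<and> v \<in> nodes N"
    and "\<And>u. u \<in> nodes N \<Longrightarrow> \<exists>v. {u, v} \<in> D"
    and "\<And>u v v'. {u, v} \<in> D \<Longrightarrow> {u, v'} \<in> D \<Longrightarrow> v = v'"
    and "noncrossing N D"
  shows "D \<in> TL_diagrams N"
proof -
  have "l = l'" if "l \<in> D" "l' \<in> D" "l \<inter> l' \<noteq> {}" for l l'
  proof -
    obtain u where u: "u \<in> l" "u \<in> l'" using \<open>l \<inter> l' \<noteq> {}\<close> by blast
    obtain v where "l = {u, v}" using assms(1)[OF \<open>l \<in> D\<close>] u by auto
    moreover obtain v' where "l' = {u, v'}" using assms(1)[OF \<open>l' \<in> D\<close>] u by auto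
    ultimately show ?thesis using assms(3) that by metis
  qed
  moreover have "\<Union>D = nodes N"
  proof
    show "\<Union>D \<subseteq> nodes N" using assms(1) by force
    show "nodes N \<subseteq> \<Union>D" using assms(2) by blast
  qed
  moreover have "{} \<notin> D" using assms(1) by blast
  moreover have "card l = 2" if "l \<in> D" for l using assms(1)[OF that] by auto
  ultimately show ?thesis
    using assms(4) by (auto simp: TL_diagrams_def partition_on_def disjoint_def)
qed

text \<open>A partner \<open>d\<close> beyond \<open>c\<close> or before \<open>a\<close> would give
  interlaced end points, and \<open>d\<close> equal to \<open>a\<close> or \<open>c\<close> would
  put two lines at one node.\<close>

lemma TL_nested:
  assumes D: "D \<in> TL_diagrams N" and ac: "{a, c} \<in> D" and bd: "{b, d} \<in> D"
    and ab: "pos N a < pos N b" and bc: "pos N b < pos N c"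
  shows "pos N a < pos N d \<and> pos N d < pos N c"
proof -
  have nc: "noncrossing N D" using D by (simp add: TL_diagrams_def)
  have db: "{d, b} \<in> D" using bd by (simp add: insert_commute)
  have "\<not> pos N c < pos N d" using nc ac bd ab bc unfolding noncrossing_def by blast
  moreover have "\<not> pos N d < pos N a" using nc ac db ab bc unfolding noncrossing_def by blast
  moreover have "d \<noteq> a" using TL_line_unique[OF D ac, of b] db bc by blast
  moreover have "d \<noteq> c"
    using TL_line_unique[OF D, of c a b] ac db ab by (auto simp: insert_commute)
  moreover have "pos N d \<noteq> pos N a" "pos N d \<noteq> pos N c"
    using calculation pos_eq_iff TL_line_nodes[OF D ac] TL_line_nodes[OF D bd] by blast+
  ultimately show ?thesis by linarith
qed

lemma finite_TL: "D \<in> TL_diagrams N \<Longrightarrow> finite D"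
  by (rule finite_subset[of _ "Pow (nodes N)"]) (auto simp: TL_diagrams_def partition_on_def finite_nodes)

lemma blob_diagramsD:
  assumes "(D, B) \<in> blob_diagrams n"
  shows "D \<in> TL_diagrams n" "B \<subseteq> D"
  using assms by (auto simp: blob_diagrams_def exposed_def)

text \<open>By \<open>TL_nested\<close> a line around one end of a decorated line goes around the
  other end too, against exposure.\<close>

lemma blob_not_enclosed:
  assumes "(D, B) \<in> blob_diagrams n" "{u, v} \<in> B" "{c, d} \<in> D" "pos n c < pos n u" "pos n u < pos n d"
  shows False
proof -
  have "pos n c < pos n v \<and> pos n v < pos n d"
    using TL_nested[OF blob_diagramsD(1)[OF assms(1)] assms(3) _ assms(4,5)] blob_diagramsD(2)[OF assms(1)] assms(2)
    by blast
  moreover have "exposed n D {u, v}" using assms by (auto simp: blob_diagrams_def)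
  ultimately show False using assms unfolding exposed_def by (metis insertE singletonD)
qed

lemma blob_diagramsI:
  assumes "D \<in> TL_diagrams n" "B \<subseteq> D"
    "\<And>u v c d. {u, v} \<in> B \<Longrightarrow> {c, d} \<in> D \<Longrightarrow> pos n c < pos n u \<Longrightarrow> pos n u < pos n d \<Longrightarrow>
       pos n c < pos n v \<Longrightarrow> pos n v < pos n d \<Longrightarrow> False"
  shows "(D, B) \<in> blob_diagrams n"
proof -
  have "exposed n D l" if l: "l \<in> B" for l
  proof -
    obtain u v where "l = {u, v}" using TL_line_cases[OF assms(1), of l] l assms(2) by blast
    then show ?thesis using assms l unfolding exposed_def by fastforce
  qed
  then show ?thesis using assms by (auto simp: blob_diagrams_def)
qed

lemma finite_blob_diagrams: "finite (blob_diagrams n)"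
proof -
  have "blob_diagrams n \<subseteq> Pow (Pow (nodes n)) \<times> Pow (Pow (nodes n))"
  proof (rule subrelI)
    fix D B assume d: "(D, B) \<in> blob_diagrams n"
    have "D \<subseteq> Pow (nodes n)"
      using blob_diagramsD(1)[OF d] by (auto simp: TL_diagrams_def partition_on_def)
    with blob_diagramsD(2)[OF d] show "(D, B) \<in> Pow (Pow (nodes n)) \<times> Pow (Pow (nodes n))" by auto
  qed
  then show ?thesis by (rule finite_subset) (simp add: finite_nodes)
qed

section \<open>The diagrams of 1, e and U_i\<close>

lemma id_diagram_line: "{u, v} \<in> id_diagram N \<longleftrightarrow>
   (\<exists>j. 1 \<le> j \<and> j \<le> N \<and> (u = North j \<and> v = South j \<or> u = South j \<and> v = North j))"
  by (auto simp: id_diagram_def doubleton_eq_iff)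

lemma id_diagram_TL: "id_diagram N \<in> TL_diagrams N"
proof (rule TL_diagramsI)
  show "\<exists>u v. l = {u, v} \<and> u \<noteq> v \<and> u \<in> nodes N \<and> v \<in> nodes N" if "l \<in> id_diagram N" for l
  proof -
    obtain j where "l = {North j, South j}" "1 \<le> j" "j \<le> N"
      using \<open>l \<in> id_diagram N\<close> by (auto simp: id_diagram_def)
    then show ?thesis by (intro exI[of _ "North j"] exI[of _ "South j"]) auto
  qed
  show "\<exists>v. {u, v} \<in> id_diagram N" if "u \<in> nodes N" for u
    using that by (cases u) (auto simp: id_diagram_line)
  show "v = v'" if "{u, v} \<in> id_diagram N" "{u, v'} \<in> id_diagram N" for u v v'
    using that by (auto simp: id_diagram_line)
  show "noncrossing N (id_diagram N)"
    unfolding noncrossing_def id_diagram_line by auto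
qed

lemma e_blob_diagram:
  assumes "1 \<le> n" shows "(id_diagram n, {{North 1, South 1}}) \<in> blob_diagrams n"
proof (rule blob_diagramsI[OF id_diagram_TL])
  show "{{North 1, South 1}} \<subseteq> id_diagram n" using assms by (auto simp: id_diagram_line)
  show False if "{u, v} \<in> {{North 1, South 1}}" "{c, d} \<in> id_diagram n" "pos n c < pos n u"
    "pos n u < pos n d" "pos n c < pos n v" "pos n v < pos n d" for u v c d
  proof -
    have "pos n c < 1 \<or> 2 * n < pos n d" using that(1,3-6) by (auto simp: doubleton_eq_iff)
    then show False
      using TL_line_nodes[OF id_diagram_TL that(2)] pos_bounds[of c n] pos_bounds[of d n] by linarith
  qed
qed

lemma U_diagram_line: "{u, v} \<in> U_diagram N i \<longleftrightarrow>
   (u = North i \<and> v = North (i+1)) \<or> (v = North i \<and> u = North (i+1)) \<or>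
   (u = South i \<and> v = South (i+1)) \<or> (v = South i \<and> u = South (i+1)) \<or>
   (\<exists>j. 1 \<le> j \<and> j \<le> N \<and> j \<noteq> i \<and> j \<noteq> i + 1 \<and> (u = North j \<and> v = South j \<or> u = South j \<and> v = North j))"
  by (auto simp: U_diagram_def doubleton_eq_iff)

lemma U_diagram_TL:
  assumes "1 \<le> i" "i < N" shows "U_diagram N i \<in> TL_diagrams N"
proof (rule TL_diagramsI)
  show "\<exists>u v. l = {u, v} \<and> u \<noteq> v \<and> u \<in> nodes N \<and> v \<in> nodes N" if "l \<in> U_diagram N i" for l
  proof -
    consider "l = {North i, North (i+1)}" | "l = {South i, South (i+1)}" |
      j where "l = {North j, South j}" "1 \<le> j" "j \<le> N" using \<open>l \<in> U_diagram N i\<close> by (auto simp: U_diagram_def)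
    then show ?thesis
    proof cases
      case 1 show ?thesis by (rule exI[of _ "North i"], rule exI[of _ "North (i+1)"]) (use 1 assms in auto)
    next
      case 2 show ?thesis by (rule exI[of _ "South i"], rule exI[of _ "South (i+1)"]) (use 2 assms in auto)
    next
      case 3 show ?thesis by (rule exI[of _ "North j"], rule exI[of _ "South j"]) (use 3 assms in auto)
    qed
  qed
  show "\<exists>v. {u, v} \<in> U_diagram N i" if "u \<in> nodes N" for u
    unfolding U_diagram_line using that by (cases u) auto
  show "v = v'" if "{u, v} \<in> U_diagram N i" "{u, v'} \<in> U_diagram N i" for u v v'
    using that unfolding U_diagram_line by auto
  show "noncrossing N (U_diagram N i)"
    unfolding noncrossing_def U_diagram_line using assms by auto
qed

lemma U_blob_diagram:
  assumes "1 \<le> i" "i < n" shows "(U_diagram n i, {}) \<in> blob_diagrams n"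
  using assms by (intro blob_diagramsI) (auto simp: U_diagram_TL)

section \<open>Stacking with a generator\<close>

text \<open>Components are found by guessing a partition: a closed block contains the orbit of each
  of its points, a connected block is contained in it.\<close>

lemma quotient_rtrancl_eqI:
  assumes A: "\<Union>P = A" and ne: "{} \<notin> P"
    and closed: "\<And>C u v. C \<in> P \<Longrightarrow> u \<in> C \<Longrightarrow> (u, v) \<in> r \<Longrightarrow> v \<in> C"
    and conn: "\<And>C u v. C \<in> P \<Longrightarrow> u \<in> C \<Longrightarrow> v \<in> C \<Longrightarrow> (u, v) \<in> r\<^sup>*"
  shows "A // r\<^sup>* = P"
proof -
  have eq: "r\<^sup>* `` {u} = C" if C: "C \<in> P" and u: "u \<in> C" for C u
  proof -
    have "v \<in> C" if "(u, v) \<in> r\<^sup>*" for v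
      using that by (induction rule: rtrancl_induct) (use u closed[OF C] in blast)+
    then show ?thesis using conn[OF C u] by blast
  qed
  show ?thesis
  proof
    show "A // r\<^sup>* \<subseteq> P"
    proof
      fix X assume "X \<in> A // r\<^sup>*"
      then obtain u where "u \<in> A" "X = r\<^sup>* `` {u}" by (rule quotientE)
      moreover obtain C where "C \<in> P" "u \<in> C" using \<open>u \<in> A\<close> A by blast
      ultimately show "X \<in> P" using eq by simp
    qed
    show "P \<subseteq> A // r\<^sup>*"
    proof
      fix C assume C: "C \<in> P"
      then obtain u where u: "u \<in> C" using ne by (metis all_not_in_conv)
      have "u \<in> A" using A C u by blast
      then have "r\<^sup>* `` {u} \<in> A // r\<^sup>*" by (rule quotientI)
      then show "C \<in> A // r\<^sup>*" using eq[OF C u] by simp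
    qed
  qed
qed

text \<open>Adjacency in a stack is symmetric, so it is enough to reach every point of a block from
  one chosen centre.\<close>

lemma components_eqI:
  assumes "\<Union>P = stack_nodes N" "{} \<notin> P"
    and up: "\<And>C l a b. C \<in> P \<Longrightarrow> l \<in> D1 \<Longrightarrow> a \<in> l \<Longrightarrow> b \<in> l \<Longrightarrow> upper a \<in> C \<Longrightarrow> upper b \<in> C"
    and lo: "\<And>C l a b. C \<in> P \<Longrightarrow> l \<in> D2 \<Longrightarrow> a \<in> l \<Longrightarrow> b \<in> l \<Longrightarrow> lower a \<in> C \<Longrightarrow> lower b \<in> C"
    and center: "\<And>C. C \<in> P \<Longrightarrow> \<exists>c. \<forall>x\<in>C. (c, x) \<in> (stack_adj D1 D2)\<^sup>*"
  shows "components N D1 D2 = P"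
  unfolding components_def
proof (rule quotient_rtrancl_eqI[OF assms(1,2)])
  show "v \<in> C" if "C \<in> P" "u \<in> C" "(u, v) \<in> stack_adj D1 D2" for C u v
    using that(3) unfolding stack_adj_def using up[OF that(1)] lo[OF that(1)] that(2) by blast
  have "sym (stack_adj D1 D2)" unfolding sym_def stack_adj_def by blast
  then have "sym ((stack_adj D1 D2)\<^sup>*)" by (rule sym_rtrancl)
  then show "(u, v) \<in> (stack_adj D1 D2)\<^sup>*" if "C \<in> P" "u \<in> C" "v \<in> C" for C u v
    using center[OF that(1)] that(2,3) by (meson rtrancl_trans symD)
qed

lemma stack_adj_upper: "l \<in> D1 \<Longrightarrow> a \<in> l \<Longrightarrow> b \<in> l \<Longrightarrow> (upper a, upper b) \<in> stack_adj D1 D2"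
  and stack_adj_lower: "l \<in> D2 \<Longrightarrow> a \<in> l \<Longrightarrow> b \<in> l \<Longrightarrow> (lower a, lower b) \<in> stack_adj D1 D2"
  unfolding stack_adj_def by blast+

text \<open>The part of the stack attached to a node of the lower diagram when the upper diagram is
  vertical there: a northern node sits in the middle and is prolonged to the top, a southern node is
  already on the frame.\<close>

fun strand :: "node \<Rightarrow> stack_node set" where
  "strand (North j) = {Top j, Mid j}"
| "strand (South j) = {Bot j}"

lemma strand_mem [simp]:
  "Top j \<in> strand u \<longleftrightarrow> u = North j"
  "Mid j \<in> strand u \<longleftrightarrow> u = North j"
  "Bot j \<in> strand u \<longleftrightarrow> u = South j"
  "lower v \<in> strand u \<longleftrightarrow> u = v"
  "outer v \<in> strand u \<longleftrightarrow> u = v"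
  by (cases u; cases v; auto)+

lemma strand_stack_nodes: "u \<in> nodes N \<Longrightarrow> strand u \<subseteq> stack_nodes N"
  by (cases u) (auto simp: stack_nodes_def)

lemma stack_node_strand:
  assumes "x \<in> stack_nodes N" obtains u where "u \<in> nodes N" "x \<in> strand u"
proof (cases x)
  case (Top j) then show ?thesis using assms that[of "North j"] by (auto simp: stack_nodes_def)
next
  case (Mid j) then show ?thesis using assms that[of "North j"] by (auto simp: stack_nodes_def)
next
  case (Bot j) then show ?thesis using assms that[of "South j"] by (auto simp: stack_nodes_def)
qed

lemma strand_connected:
  assumes "x \<in> strand u" "\<And>j. u = North j \<Longrightarrow> {North j, South j} \<in> D1"
  shows "(lower u, x) \<in> (stack_adj D1 D2)\<^sup>*"
proof (cases u)
  case (North j)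
  then have "(upper (South j), upper (North j)) \<in> stack_adj D1 D2"
    using assms(2) by (intro stack_adj_upper) auto
  then show ?thesis using assms(1) North by auto
next
  case (South j) then show ?thesis using assms(1) by auto
qed

lemma Collect_unique:
  assumes "\<And>l. l \<in> B \<Longrightarrow> Q l \<Longrightarrow> l = l0" "Q l0"
  shows "{l \<in> B. Q l} = (if l0 \<in> B then {l0} else {})"
proof (cases "l0 \<in> B")
  case True
  then have "{l \<in> B. Q l} = {l0}" using assms by blast
  then show ?thesis by (simp only: True if_True)
next
  case False
  then have "{l \<in> B. Q l} = {}" using assms by blast
  then show ?thesis by (simp only: False if_False)
qed

text \<open>The component grown from a line of the lower diagram when the upper diagram is vertical
  above its northern ends. By \<open>ends_track\<close> the line is recovered as the set of its
  ends.\<close>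

definition track :: "line \<Rightarrow> stack_node set" where
  "track l = \<Union>(strand ` l)"

lemma track_mem [simp]:
  "Top j \<in> track l \<longleftrightarrow> North j \<in> l"
  "Mid j \<in> track l \<longleftrightarrow> North j \<in> l"
  "Bot j \<in> track l \<longleftrightarrow> South j \<in> l"
  "lower v \<in> track l \<longleftrightarrow> v \<in> l"
  "outer v \<in> track l \<longleftrightarrow> v \<in> l"
  by (auto simp: track_def)

lemma ends_track [simp]: "ends (track l) = l"
  by (auto simp: ends_def)

lemma ends_tracks: "{ends C |C. C \<in> track ` T \<and> Q C} = {l \<in> T. Q (track l)}"
proof
  show "{l \<in> T. Q (track l)} \<subseteq> {ends C |C. C \<in> track ` T \<and> Q C}"
  proof
    fix l assume "l \<in> {l \<in> T. Q (track l)}"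
    then have "l = ends (track l) \<and> track l \<in> track ` T \<and> Q (track l)" by simp
    then show "l \<in> {ends C |C. C \<in> track ` T \<and> Q C}" by blast
  qed
qed auto

lemma ends_insert: "{ends C |C. C \<in> insert E X \<and> Q C} =
    (if Q E then {ends E} else {}) \<union> {ends C |C. C \<in> X \<and> Q C}"
  by auto

lemma track_connected:
  assumes "{u, v} \<in> D2" "x \<in> track {u, v}"
    "\<And>j. North j \<in> {u, v} \<Longrightarrow> {North j, South j} \<in> D1"
  shows "(lower u, x) \<in> (stack_adj D1 D2)\<^sup>*"
proof -
  have "x \<in> strand u \<or> x \<in> strand v" using assms(2) by (auto simp: track_def)
  then show ?thesis
  proof
    assume "x \<in> strand u" then show ?thesis using strand_connected assms(3) by blast
  next
    assume "x \<in> strand v"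
    then have "(lower v, x) \<in> (stack_adj D1 D2)\<^sup>*" using strand_connected assms(3) by blast
    moreover have "(lower u, lower v) \<in> stack_adj D1 D2" using assms(1) by (intro stack_adj_lower) auto
    ultimately show ?thesis by (rule converse_rtrancl_into_rtrancl[rotated])
  qed
qed

lemma lower_track_subset:
  assumes "D \<in> TL_diagrams N" "l \<in> D" "l' \<in> D"
  shows "lower ` l' \<subseteq> track l \<longleftrightarrow> l' = l"
proof
  assume "lower ` l' \<subseteq> track l"
  moreover obtain u v where "l' = {u, v}" by (rule TL_line_cases[OF assms(1,3)])
  ultimately show "l' = l" using TL_block_unique[OF assms(1,3,2), of u] by auto
qed auto

text \<open>No closed loop means neither \<open>q + unit_inv q\<close> nor \<gamma>, and at most one
  blob on each component means \<delta> to the power 0. This singles out the products in which no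
  parameter appears.\<close>

lemma stack_factor_one:
  assumes "\<And>C. C \<in> components N D1 D2 \<Longrightarrow> ends C \<noteq> {} \<and> blob_count B1 B2 C \<le> 1"
  shows "stack_factor N q \<gamma> \<delta> (D1, B1) (D2, B2) = 1"
  using assms by (auto simp: component_factor_def intro!: prod.neutral)

text \<open>Below the identity every component is the track of one line of \<open>D\<close>, and the
  blob of e lands on the line at node 1. That line is undecorated, so no two blobs merge.\<close>

lemma stack_e:
  assumes DB: "(D, B) \<in> blob_diagrams n" and v: "{North 1, v} \<in> D" "{North 1, v} \<notin> B"
  shows "stack_diagram n (id_diagram n, {{North 1, South 1}}) (D, B) = (D, insert {North 1, v} B)"
    and "stack_factor n q \<gamma> \<delta> (id_diagram n, {{North 1, South 1}}) (D, B) = 1"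
proof -
  note D = blob_diagramsD(1)[OF DB]
  have BD: "B \<subseteq> D" by (rule blob_diagramsD(2)[OF DB])
  have line: "\<exists>u v. l = {u, v} \<and> u \<in> nodes n \<and> v \<in> nodes n" if l: "l \<in> D" for l
  proof -
    obtain u v where "l = {u, v}" by (rule TL_line_cases[OF D l])
    then show ?thesis using TL_line_nodes[OF D] l by blast
  qed
  have comp: "components n (id_diagram n) D = track ` D"
  proof (rule components_eqI)
    have "track l \<subseteq> stack_nodes n" if "l \<in> D" for l
      using line[OF that] strand_stack_nodes unfolding track_def by blast
    moreover have "x \<in> \<Union>(track ` D)" if x: "x \<in> stack_nodes n" for x
    proof -
      obtain u where u: "u \<in> nodes n" "x \<in> strand u" by (rule stack_node_strand[OF x])
      obtain w where "{u, w} \<in> D" by (rule TL_line_ex[OF D u(1)])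
      moreover have "x \<in> track {u, w}" using u(2) by (auto simp: track_def)
      ultimately show ?thesis by blast
    qed
    ultimately show "\<Union>(track ` D) = stack_nodes n" by blast
    have "lower u \<in> track {u, w}" for u w by simp
    then show "{} \<notin> track ` D" using line by (metis empty_iff imageE)
    show "upper b \<in> C" if "C \<in> track ` D" "l \<in> id_diagram n" "a \<in> l" "b \<in> l" "upper a \<in> C" for C l a b
      using that by (auto simp: id_diagram_def)
    show "lower b \<in> C" if C: "C \<in> track ` D" and l: "l \<in> D" "a \<in> l" "b \<in> l" "lower a \<in> C" for C l a b
    proof -
      obtain l' where l': "C = track l'" "l' \<in> D" using C by blast
      then have "l = l'" using TL_block_unique[OF D, of l l' a] l by auto
      then show ?thesis using l' l by auto
    qed
    show "\<exists>c. \<forall>x\<in>C. (c, x) \<in> (stack_adj (id_diagram n) D)\<^sup>*" if C: "C \<in> track ` D" for C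
    proof -
      obtain l where l: "l \<in> D" "C = track l" using C by blast
      obtain u w where "l = {u, w}" "u \<in> nodes n" "w \<in> nodes n" using line[OF l(1)] by blast
      then have uw: "C = track {u, w}" "{u, w} \<in> D" "u \<in> nodes n" "w \<in> nodes n"
        using l by auto
      have "(lower u, x) \<in> (stack_adj (id_diagram n) D)\<^sup>*" if "x \<in> C" for x
        by (rule track_connected[OF uw(2)]) (use uw that in \<open>auto simp: id_diagram_line\<close>)
      then show ?thesis by blast
    qed
  qed
  have count: "blob_count {{North 1, South 1}} B (track l) = (if North 1 \<in> l \<or> l \<in> B then 1 else 0)"
    if l: "l \<in> D" for l
  proof -
    have "{l' \<in> {{North 1, South 1}}. upper ` l' \<subseteq> track l} = (if North 1 \<in> l then {{North 1, South 1}} else {})"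
      by auto
    moreover have "{l' \<in> B. lower ` l' \<subseteq> track l} = (if l \<in> B then {l} else {})"
      using lower_track_subset[OF D l] BD by (auto simp del: image_subset_iff)
    moreover have "l \<notin> B" if "North 1 \<in> l"
      using TL_block_unique[OF D l v(1) that] v(2) by auto
    ultimately show ?thesis by (simp add: blob_count_def)
  qed
  have mem: "North 1 \<in> l \<longleftrightarrow> l = {North 1, v}" if "l \<in> D" for l
    using TL_block_unique[OF D that v(1), of "North 1"] by auto
  have ne: "l \<noteq> {}" if "l \<in> D" for l using line[OF that] by auto
  show "stack_factor n q \<gamma> \<delta> (id_diagram n, {{North 1, South 1}}) (D, B) = 1"
    by (rule stack_factor_one) (auto simp: comp count ne simp del: One_nat_def)
  have "{ends C |C. C \<in> track ` D \<and> ends C \<noteq> {}} = D"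
    unfolding ends_tracks using ne by auto
  moreover have "{ends C |C. C \<in> track ` D \<and> ends C \<noteq> {} \<and> 0 < blob_count {{North 1, South 1}} B C}
     = {l \<in> D. North 1 \<in> l \<or> l \<in> B}"
    unfolding ends_tracks using ne count by (auto split: if_splits simp del: One_nat_def)
  moreover have "{l \<in> D. North 1 \<in> l \<or> l \<in> B} = insert {North 1, v} B" using mem v(1) BD by blast
  ultimately show "stack_diagram n (id_diagram n, {{North 1, South 1}}) (D, B) = (D, insert {North 1, v} B)"
    by (simp add: comp del: One_nat_def)
qed

text \<open>The southern arc of U_i joins the lines at i and i + 1 into one line from
  \<open>c\<close> to \<open>z\<close>. The condition on \<open>c\<close> keeps this arc from
  closing a loop, and the missing blob on the line to \<open>z\<close> leaves at most one blob on
  the joined line.\<close>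

lemma stack_U:
  assumes DB: "(D, B) \<in> blob_diagrams n" and i: "1 \<le> i" "i < n"
    and c: "{North i, c} \<in> D" "c \<noteq> North (i + 1)"
    and z: "{North (i + 1), z} \<in> D" "{North (i + 1), z} \<notin> B"
  shows "stack_diagram n (U_diagram n i, {}) (D, B) =
      (insert {North i, North (i + 1)} (insert {z, c} (D - {{North i, c}, {North (i + 1), z}})),
       if {North i, c} \<in> B then insert {z, c} (B - {{North i, c}}) else B)"
    and "stack_factor n q \<gamma> \<delta> (U_diagram n i, {}) (D, B) = 1"
proof -
  note D = blob_diagramsD(1)[OF DB]
  have BD: "B \<subseteq> D" by (rule blob_diagramsD(2)[OF DB])
  have line: "\<exists>u v. l = {u, v} \<and> u \<in> nodes n \<and> v \<in> nodes n" if l: "l \<in> D" for l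
  proof -
    obtain u v where "l = {u, v}" by (rule TL_line_cases[OF D l])
    then show ?thesis using TL_line_nodes[OF D] l by blast
  qed
  have ne: "l \<noteq> {}" if "l \<in> D" for l using line[OF that] by auto
  note cn = TL_line_nodes[OF D c(1)] and zn = TL_line_nodes[OF D z(1)]
  have zi: "z \<noteq> North i"
    using TL_line_unique[OF D c(1), of "North (i+1)"] z(1) c(2) by (auto simp: insert_commute)
  have "c \<noteq> z" using TL_line_unique[OF D, of c "North i" "North (i+1)"] c(1) z(1)
    by (auto simp: insert_commute)
  define T where "T = D - {{North i, c}, {North (i + 1), z}}"
  have T: "l \<in> D" "North i \<notin> l" "North (i + 1) \<notin> l" "c \<notin> l" "z \<notin> l" if "l \<in> T" for l
    using that TL_block_unique[OF D _ c(1), of l] TL_block_unique[OF D _ z(1), of l]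
    unfolding T_def by auto
  \<comment> \<open>\<open>E\<close> is the northern arc of U_i. \<open>F\<close> is the joined
    line: the two middle nodes under the southern arc, prolonged at both ends by the strands of
    \<open>c\<close> and \<open>z\<close>. All other components are tracks.\<close>
  define E where "E = {Top i, Top (i + 1)}"
  define F where "F = {Mid i, Mid (i + 1)} \<union> strand c \<union> strand z"
  define P where "P = insert E (insert F (track ` T))"
  have P_cases: "C = E \<or> C = F \<or> (\<exists>l\<in>T. C = track l)" if "C \<in> P" for C
    using that by (auto simp: P_def)
  have outerF: "outer u \<in> F \<longleftrightarrow> u = c \<or> u = z" for u
    unfolding F_def by (cases u) auto
  have lowerF: "lower u \<in> F \<longleftrightarrow> u \<in> {North i, North (i + 1), c, z}" for u
    unfolding F_def by (cases u) auto
  have endsE: "ends E = {North i, North (i + 1)}"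
  proof -
    have "outer u \<in> E \<longleftrightarrow> u \<in> {North i, North (i + 1)}" for u
      unfolding E_def by (cases u) auto
    then show ?thesis by (auto simp: ends_def)
  qed
  have endsF: "ends F = {z, c}" using outerF by (auto simp: ends_def)
  have lowerE: "lower u \<notin> E" for u unfolding E_def by (cases u) auto
  have up_through: "{North j, South j} \<in> U_diagram n i" if "North j \<in> nodes n" "j \<noteq> i" "j \<noteq> i + 1" for j
    using that by (auto simp: U_diagram_line)
  have comp: "components n (U_diagram n i) D = P"
  proof (rule components_eqI)
    have tr: "track l \<subseteq> stack_nodes n" if "l \<in> T" for l
      using line[OF T(1)[OF that]] strand_stack_nodes unfolding track_def by blast
    have En: "E \<subseteq> stack_nodes n" using i by (auto simp: E_def stack_nodes_def)
    have Fn: "F \<subseteq> stack_nodes n"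
      using i strand_stack_nodes[OF cn(2)] strand_stack_nodes[OF zn(2)] by (auto simp: F_def stack_nodes_def)
    have un: "x \<in> \<Union>P" if x: "x \<in> stack_nodes n" for x
    proof -
      obtain u where u: "u \<in> nodes n" "x \<in> strand u" by (rule stack_node_strand[OF x])
      obtain w where w: "{u, w} \<in> D" by (rule TL_line_ex[OF D u(1)])
      have "{u, w} \<in> T \<or> {u, w} = {North i, c} \<or> {u, w} = {North (i + 1), z}"
        using w unfolding T_def by blast
      then consider "u \<in> {North i, North (i + 1)}" | "u \<in> {c, z}" | "{u, w} \<in> T"
        by blast
      then show ?thesis
      proof cases
        case 1
        then have "x \<in> E \<union> F" using u(2) by (auto simp: E_def F_def)
        then show ?thesis by (auto simp: P_def)
      next
        case 2
        then have "x \<in> F" using u(2) by (auto simp: F_def)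
        then show ?thesis by (auto simp: P_def)
      next
        case 3
        moreover have "x \<in> track {u, w}" using u(2) by (auto simp: track_def)
        ultimately show ?thesis by (auto simp: P_def)
      qed
    qed
    have Cn: "C \<subseteq> stack_nodes n" if "C \<in> P" for C using P_cases[OF that] tr En Fn by auto
    show "\<Union>P = stack_nodes n"
      by (rule subset_antisym[OF Union_least[OF Cn] subsetI[OF un]])
    have "track l \<noteq> {}" if l: "l \<in> T" for l
    proof -
      obtain u where "u \<in> l" using ne[OF T(1)[OF l]] by blast
      then have "lower u \<in> track l" by simp
      then show ?thesis by blast
    qed
    then show "{} \<notin> P" unfolding P_def E_def F_def by auto
    show "upper b \<in> C" if C: "C \<in> P" and l: "l \<in> U_diagram n i" "a \<in> l" "b \<in> l" "upper a \<in> C" for C l a b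
    proof -
      consider "l = {North i, North (i+1)}" | "l = {South i, South (i+1)}" |
        j where "l = {North j, South j}" "j \<noteq> i" "j \<noteq> i + 1"
        using l(1) by (auto simp: U_diagram_def)
      moreover have "Top i \<in> C \<longleftrightarrow> Top (i + 1) \<in> C"
        using P_cases[OF C] cn zn zi c(2) T by (auto simp: E_def F_def)
      moreover have "Mid i \<in> C \<longleftrightarrow> Mid (i + 1) \<in> C"
        using P_cases[OF C] cn zn zi c(2) T by (auto simp: E_def F_def)
      moreover have "Top j \<in> C \<longleftrightarrow> Mid j \<in> C" if "j \<noteq> i" "j \<noteq> i + 1" for j
        using P_cases[OF C] that by (auto simp: E_def F_def)
      ultimately show ?thesis using l(2-4) by cases auto
    qed
    show "lower b \<in> C" if C: "C \<in> P" and l: "l \<in> D" "a \<in> l" "b \<in> l" "lower a \<in> C" for C l a b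
      using P_cases[OF C]
    proof (elim disjE bexE)
      assume "C = E" then show ?thesis using l lowerE by auto
    next
      assume CF: "C = F"
      then have "a \<in> {North i, c} \<or> a \<in> {North (i + 1), z}" using l(4) lowerF by auto
      then have "l = {North i, c} \<or> l = {North (i + 1), z}"
        using TL_block_unique[OF D l(1) c(1) l(2)] TL_block_unique[OF D l(1) z(1) l(2)] by blast
      then show ?thesis using l(3) CF lowerF by auto
    next
      fix l' assume l': "l' \<in> T" "C = track l'"
      then have "l = l'" using TL_block_unique[OF D l(1) T(1)[OF l'(1)] l(2)] l(4) by auto
      then show ?thesis using l(3) l' by auto
    qed
    show "\<exists>x. \<forall>y\<in>C. (x, y) \<in> (stack_adj (U_diagram n i) D)\<^sup>*" if C: "C \<in> P" for C
      using P_cases[OF C]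
    proof (elim disjE bexE)
      assume CE: "C = E"
      have "(upper (North i), upper (North (i+1))) \<in> stack_adj (U_diagram n i) D"
        by (rule stack_adj_upper[of "{North i, North (i+1)}"]) (auto simp: U_diagram_line)
      then have "\<forall>y\<in>C. (Top i, y) \<in> (stack_adj (U_diagram n i) D)\<^sup>*" using CE by (auto simp: E_def)
      then show ?thesis by blast
    next
      assume CF: "C = F"
      let ?r = "stack_adj (U_diagram n i) D"
      have ud: "\<And>j. u = North j \<Longrightarrow> {North j, South j} \<in> U_diagram n i" if u: "u \<in> {c, z}" for u
      proof -
        fix j assume "u = North j"
        moreover have "u \<in> nodes n" "u \<noteq> North i" "u \<noteq> North (i + 1)" using u cn zn zi c(2) by blast+
        ultimately show "{North j, South j} \<in> U_diagram n i" using up_through by blast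
      qed
      have 1: "(upper (South i), upper (South (i+1))) \<in> ?r"
        by (rule stack_adj_upper[of "{South i, South (i+1)}"]) (auto simp: U_diagram_line)
      have 2: "(lower (North i), lower c) \<in> ?r" by (rule stack_adj_lower[OF c(1)]) auto
      have 3: "(lower (North (i+1)), lower z) \<in> ?r" by (rule stack_adj_lower[OF z(1)]) auto
      have m: "(Mid i, Mid (i+1)) \<in> ?r\<^sup>*" using 1 by auto
      have "(Mid i, lower c) \<in> ?r\<^sup>*" using 2 by auto
      moreover have "(Mid i, lower z) \<in> ?r\<^sup>*" using m 3 by auto
      moreover have "(lower c, y) \<in> ?r\<^sup>*" if "y \<in> strand c" for y
        using strand_connected[OF that] ud by blast
      moreover have "(lower z, y) \<in> ?r\<^sup>*" if "y \<in> strand z" for y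
        using strand_connected[OF that] ud by blast
      ultimately have "(Mid i, y) \<in> ?r\<^sup>*" if "y \<in> C" for y
        using that m unfolding CF F_def by (auto intro: rtrancl_trans)
      then show ?thesis by blast
    next
      fix l assume l: "l \<in> T" "C = track l"
      obtain u w where uw: "l = {u, w}" "u \<in> nodes n" "w \<in> nodes n" using line[OF T(1)[OF l(1)]] by blast
      have "(lower u, x) \<in> (stack_adj (U_diagram n i) D)\<^sup>*" if "x \<in> C" for x
      proof (rule track_connected)
        show "{u, w} \<in> D" using T(1)[OF l(1)] uw by simp
        show "x \<in> track {u, w}" using that l uw by simp
        show "{North j, South j} \<in> U_diagram n i" if "North j \<in> {u, w}" for j
          using that T(2,3)[OF l(1)] uw by (intro up_through) auto
      qed
      then show ?thesis by blast
    qed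
  qed
  have countE: "blob_count {} B E = 0"
  proof -
    have "{l \<in> B. lower ` l \<subseteq> E} = {}" using lowerE ne BD by fastforce
    then have "card {l \<in> B. lower ` l \<subseteq> E} = 0" by (simp only: card.empty)
    then show ?thesis by (simp add: blob_count_def)
  qed
  have countF: "blob_count {} B F = (if {North i, c} \<in> B then 1 else 0)"
  proof -
    have "{l \<in> B. lower ` l \<subseteq> F} = (if {North i, c} \<in> B then {{North i, c}} else {})"
    proof -
      have "l = {North i, c}" if l: "l \<in> B" "lower ` l \<subseteq> F" for l
      proof -
        have lD: "l \<in> D" using l BD by blast
        obtain u where u: "u \<in> l" using ne[OF lD] by blast
        then have "u \<in> {North i, c} \<or> u \<in> {North (i + 1), z}" using l(2) lowerF by blast
        then have "l = {North i, c} \<or> l = {North (i + 1), z}"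
          using TL_block_unique[OF D lD c(1) u] TL_block_unique[OF D lD z(1) u] by blast
        then show ?thesis using z(2) l(1) by blast
      qed
      moreover have "lower ` {North i, c} \<subseteq> F" using lowerF by blast
      ultimately show ?thesis by (rule Collect_unique)
    qed
    then show ?thesis by (simp add: blob_count_def)
  qed
  have countT: "blob_count {} B (track l) = (if l \<in> B then 1 else 0)" if l: "l \<in> T" for l
  proof -
    have "{l' \<in> B. lower ` l' \<subseteq> track l} = (if l \<in> B then {l} else {})"
      using lower_track_subset[OF D T(1)[OF l]] BD by (auto simp del: image_subset_iff)
    then show ?thesis by (simp add: blob_count_def)
  qed
  have neT: "l \<noteq> {}" if "l \<in> T" for l using ne T(1)[OF that] by blast
  show "stack_factor n q \<gamma> \<delta> (U_diagram n i, {}) (D, B) = 1"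
    by (rule stack_factor_one) (auto simp: comp P_def countE countF countT neT endsE endsF)
  have 1: "{ends C |C. C \<in> P \<and> ends C \<noteq> {}} = insert {North i, North (i + 1)} (insert {z, c} T)"
    unfolding P_def ends_insert ends_tracks using neT endsE endsF by auto
  have "{ends C |C. C \<in> P \<and> ends C \<noteq> {} \<and> 0 < blob_count {} B C} =
     (if {North i, c} \<in> B then {{z, c}} else {}) \<union> (T \<inter> B)"
    unfolding P_def ends_insert ends_tracks using neT endsE endsF countE countF countT
    by (auto split: if_splits)
  also have "T \<inter> B = B - {{North i, c}}" using BD z(2) by (auto simp: T_def)
  finally have 2: "{ends C |C. C \<in> P \<and> ends C \<noteq> {} \<and> 0 < blob_count {} B C} =
     (if {North i, c} \<in> B then {{z, c}} else {}) \<union> (B - {{North i, c}})" .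
  show "stack_diagram n (U_diagram n i, {}) (D, B) =
      (insert {North i, North (i + 1)} (insert {z, c} (D - {{North i, c}, {North (i + 1), z}})),
       if {North i, c} \<in> B then insert {z, c} (B - {{North i, c}}) else B)"
    using 1 2 by (simp add: comp T_def)
qed

lemma blob_mult_basis:
  assumes "d1 \<in> blob_diagrams n" "d2 \<in> blob_diagrams n"
    "stack_factor n q \<gamma> \<delta> d1 d2 = 1"
  shows "blob_mult n q \<gamma> \<delta> (blob_basis d1) (blob_basis d2) = blob_basis (stack_diagram n d1 d2)"
proof
  fix d
  have "blob_mult n q \<gamma> \<delta> (blob_basis d1) (blob_basis d2) d =
     (\<Sum>d1'\<in>blob_diagrams n. if d1' = d1 then \<Sum>d2'\<in>blob_diagrams n. if d2' = d2 then
        stack_factor n q \<gamma> \<delta> d1' d2' * blob_basis (stack_diagram n d1' d2') d else 0 else 0)"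
    unfolding blob_mult_def by (intro sum.cong refl) (auto simp: blob_basis_def intro!: sum.cong)
  also have "\<dots> = blob_basis (stack_diagram n d1 d2) d"
    using assms by (simp add: finite_blob_diagrams)
  finally show "blob_mult n q \<gamma> \<delta> (blob_basis d1) (blob_basis d2) d = \<dots>" .
qed

section \<open>Spins\<close>

text \<open>Node \<open>j\<close> of the frame of an \<open>n\<close>-strand diagram corresponds to the letters \<open>n + j\<close> and
  \<open>n + 1 - j\<close> of a word of length \<open>2 n\<close>: its copy and its mirror image in the unfolded diagram.\<close>

definition mirror_index :: "nat \<Rightarrow> bool \<Rightarrow> nat \<Rightarrow> nat" where
  "mirror_index n b j = (if b then n + 1 - j else n + j)"

definition half :: "nat \<Rightarrow> word \<Rightarrow> bool \<Rightarrow> nat \<Rightarrow> bool" where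
  "half n v b j \<longleftrightarrow> letter v (mirror_index n b j) = 1"

text \<open>The spin is negated on the southern side, so that an undecorated line always
  demands different spins at its two ends, whatever sides these lie on.\<close>

fun spin :: "nat \<Rightarrow> word \<Rightarrow> word \<Rightarrow> bool \<Rightarrow> node \<Rightarrow> bool" where
  "spin n v w b (North j) = half n v b j"
| "spin n v w b (South j) = (\<not> half n w b j)"

text \<open>The unfolded diagram as a condition on words: an undecorated line is an arc in each
  half, a decorated line is at each of its ends an arc between the halves. Since \<open>x\<close>
  and \<open>y\<close> range over both orders of the end points, the decorated clause, written for
  \<open>x\<close> alone, covers both ends.\<close>

fun compatible :: "nat \<Rightarrow> blob_diagram \<Rightarrow> word \<Rightarrow> word \<Rightarrow> bool" where
  "compatible n (D, B) v w \<longleftrightarrow> (\<forall>x y. {x, y} \<in> D \<longrightarrow>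
     (if {x, y} \<in> B then spin n v w True x \<noteq> spin n v w False x
      else (\<forall>b. spin n v w b x \<noteq> spin n v w b y)))"

lemma mirror_index_bounds: "1 \<le> j \<Longrightarrow> j \<le> n \<Longrightarrow> mirror_index n b j \<in> {1..2 * n}"
  by (auto simp: mirror_index_def)

lemma mirror_index_surj:
  assumes "k \<in> {1..2 * n}" obtains b j where "1 \<le> j" "j \<le> n" "k = mirror_index n b j"
proof (cases "k \<le> n")
  case True
  then show ?thesis using assms that[of "n + 1 - k" True] by (auto simp: mirror_index_def)
next
  case False
  then show ?thesis using assms that[of "k - n" False] by (auto simp: mirror_index_def)
qed

lemma mirror_index_eq_iff:
  "1 \<le> j \<Longrightarrow> j \<le> n \<Longrightarrow> 1 \<le> j' \<Longrightarrow> j' \<le> n \<Longrightarrow>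
     mirror_index n b j = mirror_index n b' j' \<longleftrightarrow> b = b' \<and> j = j'"
  by (auto simp: mirror_index_def)

lemma letter_eq_iff_half:
  assumes "v \<in> words (2 * n)" "w \<in> words (2 * n)" "1 \<le> j" "j \<le> n" "1 \<le> j'" "j' \<le> n"
  shows "letter v (mirror_index n b j) = letter w (mirror_index n b' j') \<longleftrightarrow>
     half n v b j = half n w b' j'"
  using letter_words[OF assms(1) mirror_index_bounds[OF assms(3,4), of b]]
    letter_words[OF assms(2) mirror_index_bounds[OF assms(5,6), of b']]
  unfolding half_def by auto

lemma words_eqI_half:
  assumes "v \<in> words (2 * n)" "w \<in> words (2 * n)"
    "\<And>b j. 1 \<le> j \<Longrightarrow> j \<le> n \<Longrightarrow> half n v b j = half n w b j"
  shows "v = w"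
proof (rule words_eqI[OF assms(1,2)])
  fix k assume k: "k \<in> {1..2 * n}"
  obtain b j where j: "1 \<le> j" "j \<le> n" "k = mirror_index n b j" by (rule mirror_index_surj[OF k])
  then show "letter v k = letter w k"
    using letter_eq_iff_half[OF assms(1,2) j(1,2) j(1,2)] assms(3) by simp
qed

lemma words_exists_half: "\<exists>v\<in>words (2 * n). \<forall>b j. 1 \<le> j \<longrightarrow> j \<le> n \<longrightarrow> half n v b j = g b j"
proof -
  define f where "f k = (if k \<le> n then (if g True (n + 1 - k) then 1 else 2)
                         else (if g False (k - n) then 1 else (2::nat)))" for k
  have "\<exists>v\<in>words (2 * n). \<forall>j\<in>{1..2 * n}. letter v j = f j"
    by (rule words_exists) (auto simp: f_def)
  then obtain v where v: "v \<in> words (2 * n)" "\<forall>j\<in>{1..2 * n}. letter v j = f j"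
    by blast
  have "half n v b j = g b j" if "1 \<le> j" "j \<le> n" for b j
  proof -
    have "letter v (mirror_index n b j) = f (mirror_index n b j)"
      using v(2) mirror_index_bounds[OF that] by blast
    then show ?thesis using that by (cases b) (auto simp: half_def f_def mirror_index_def)
  qed
  with v show ?thesis by blast
qed

section \<open>Compatibility for 1, e and U_i\<close>

lemma compatible_id:
  assumes "v \<in> words (2 * n)" "w \<in> words (2 * n)"
  shows "compatible n (id_diagram n, {}) v w \<longleftrightarrow> v = w"
proof
  assume c: "compatible n (id_diagram n, {}) v w"
  show "v = w"
  proof (rule words_eqI_half[OF assms])
    fix b j assume "1 \<le> j" "j \<le> n"
    then have "{North j, South j} \<in> id_diagram n" by (auto simp: id_diagram_line)
    from c[unfolded compatible.simps, rule_format, OF this]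
    have "spin n v w b (North j) \<noteq> spin n v w b (South j)" by (simp del: spin.simps)
    then show "half n v b j = half n w b j" by simp
  qed
next
  assume "v = w"
  then show "compatible n (id_diagram n, {}) v w" by (auto simp: id_diagram_line)
qed

lemma compatible_e:
  assumes "1 \<le> n"
  shows "compatible n (id_diagram n, {{North 1, South 1}}) v w \<longleftrightarrow>
     half n v True 1 \<noteq> half n v False 1 \<and> half n w True 1 \<noteq> half n w False 1 \<and>
     (\<forall>b j. 2 \<le> j \<longrightarrow> j \<le> n \<longrightarrow> half n v b j = half n w b j)"
    (is "?L \<longleftrightarrow> ?R")
proof
  assume L: ?L
  have "{North j, South j} \<in> id_diagram n" if "1 \<le> j" "j \<le> n" for j
    using that by (auto simp: id_diagram_line)
  note * = L[unfolded compatible.simps, rule_format, OF this]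
  have "half n v b j = half n w b j" if "2 \<le> j" "j \<le> n" for b j
    using *[of j] that by (auto simp: doubleton_eq_iff)
  moreover have "half n v True 1 \<noteq> half n v False 1" using *[of 1] assms by (auto simp: doubleton_eq_iff)
  moreover have "{South 1, North 1} \<in> id_diagram n" using assms by (auto simp: id_diagram_line)
  then have "half n w True 1 \<noteq> half n w False 1"
    using L[unfolded compatible.simps, rule_format, of "South 1" "North 1"] by (auto simp: insert_commute)
  ultimately show ?R by blast
next
  assume R: ?R
  show ?L unfolding compatible.simps
  proof (intro allI impI)
    fix x y assume "{x, y} \<in> id_diagram n"
    then obtain j where j: "1 \<le> j" "j \<le> n" "x = North j \<and> y = South j \<or> x = South j \<and> y = North j"
      by (auto simp: id_diagram_line)
    have m: "{x, y} \<in> {{North 1, South 1}} \<longleftrightarrow> j = 1" using j by (auto simp: doubleton_eq_iff)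
    show "if {x, y} \<in> {{North 1, South 1}} then spin n v w True x \<noteq> spin n v w False x
      else \<forall>b. spin n v w b x \<noteq> spin n v w b y"
      unfolding m using j R by (cases "j = 1") auto
  qed
qed

lemma compatible_U:
  assumes "1 \<le> i" "i < n"
  shows "compatible n (U_diagram n i, {}) v w \<longleftrightarrow>
     (\<forall>b. half n v b i \<noteq> half n v b (i + 1) \<and> half n w b i \<noteq> half n w b (i + 1)) \<and>
     (\<forall>b j. 1 \<le> j \<longrightarrow> j \<le> n \<longrightarrow> j \<noteq> i \<longrightarrow> j \<noteq> i + 1 \<longrightarrow> half n v b j = half n w b j)"
    (is "?L \<longleftrightarrow> ?R")
proof
  assume L: ?L
  have *: "spin n v w b x \<noteq> spin n v w b y" if "{x, y} \<in> U_diagram n i" for x y b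
    using L that by auto
  have "{North i, North (i+1)} \<in> U_diagram n i" "{South i, South (i+1)} \<in> U_diagram n i"
    by (auto simp: U_diagram_line)
  moreover have "{North j, South j} \<in> U_diagram n i" if "1 \<le> j" "j \<le> n" "j \<noteq> i" "j \<noteq> i + 1" for j
    using that by (auto simp: U_diagram_line)
  ultimately show ?R using *[of "North _" "North _"] *[of "South _" "South _"] *[of "North _" "South _"]
    unfolding spin.simps by blast
next
  assume R: ?R
  show ?L unfolding compatible.simps
  proof (intro allI impI)
    fix x y assume "{x, y} \<in> U_diagram n i"
    then have "spin n v w b x \<noteq> spin n v w b y" for b
      unfolding U_diagram_line using R by (elim disjE exE conjE) simp_all
    then show "if {x, y} \<in> {} then spin n v w True x \<noteq> spin n v w False x
      else \<forall>b. spin n v w b x \<noteq> spin n v w b y" by simp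
  qed
qed

text \<open>The letters n and n + 1, on which the middle operator acts, are the two copies of node
  1. Cutting the line from 1 to 1' at the western edge therefore unfolds to the two arcs of the
  diagram \<open>U_n\<close>.\<close>

lemma flip_mask_e:
  assumes n: "1 \<le> n" and v: "v \<in> words (2 * n)" and w: "w \<in> words (2 * n)"
  shows "flip_mask (2 * n) n v w \<longleftrightarrow> compatible n (id_diagram n, {{North 1, South 1}}) v w"
proof -
  have i: "n = mirror_index n True 1" "n + 1 = mirror_index n False 1" using n by (auto simp: mirror_index_def)
  have 1: "letter u n \<noteq> letter u (n + 1) \<longleftrightarrow> half n u True 1 \<noteq> half n u False 1" if "u \<in> words (2 * n)" for u
    using letter_eq_iff_half[OF that that, of 1 1 True False] n i by simp
  have 2: "(\<forall>j\<in>{1..2 * n} - {n, n + 1}. letter v j = letter w j) \<longleftrightarrow>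
    (\<forall>b j. 2 \<le> j \<longrightarrow> j \<le> n \<longrightarrow> half n v b j = half n w b j)" (is "?A \<longleftrightarrow> ?B")
  proof
    assume A: ?A
    show ?B
    proof (intro allI impI)
      fix b j assume j: "2 \<le> j" "j \<le> n"
      then have "mirror_index n b j \<in> {1..2 * n} - {n, n + 1}" by (auto simp: mirror_index_def)
      then have "letter v (mirror_index n b j) = letter w (mirror_index n b j)" using A by blast
      then show "half n v b j = half n w b j" by (simp add: half_def)
    qed
  next
    assume B: ?B
    show ?A
    proof
      fix k assume k: "k \<in> {1..2 * n} - {n, n + 1}"
      then have "k \<in> {1..2 * n}" by blast
      then obtain b j where j: "1 \<le> j" "j \<le> n" "k = mirror_index n b j" by (rule mirror_index_surj)
      have "j \<noteq> 1" using k j by (auto simp: mirror_index_def split: if_splits)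
      then have "half n v b j = half n w b j" using B j by simp
      then show "letter v k = letter w k" using letter_eq_iff_half[OF v w j(1,2) j(1,2)] j(3) by blast
    qed
  qed
  show ?thesis unfolding flip_mask_def compatible_e[OF n] 1[OF v] 1[OF w] 2 by blast
qed

lemma flip_mask_half:
  assumes i: "1 \<le> i" "i < n" and v: "v \<in> words (2 * n)" and w: "w \<in> words (2 * n)"
  shows "flip_mask (2 * n) (if b then n - i else n + i) v w \<longleftrightarrow>
    half n v b i \<noteq> half n v b (i + 1) \<and> half n w b i \<noteq> half n w b (i + 1) \<and>
    (\<forall>j. 1 \<le> j \<longrightarrow> j \<le> n \<longrightarrow> j \<noteq> i \<longrightarrow> j \<noteq> i + 1 \<longrightarrow> half n v b j = half n w b j) \<and>
    (\<forall>j. 1 \<le> j \<longrightarrow> j \<le> n \<longrightarrow> half n v (\<not> b) j = half n w (\<not> b) j)"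
proof -
  let ?k = "if b then n - i else n + i"
  \<comment> \<open>The mirrored half is reversed: there n - i is the copy of i + 1 and n - i + 1
    the copy of i. Hence the equality of sets only.\<close>
  have k: "{?k, ?k + 1} = {mirror_index n b i, mirror_index n b (i + 1)}"
    using i by (auto simp: mirror_index_def)
  have 1: "letter u ?k \<noteq> letter u (?k + 1) \<longleftrightarrow> half n u b i \<noteq> half n u b (i + 1)" if "u \<in> words (2 * n)" for u
  proof -
    have "letter u ?k \<noteq> letter u (?k + 1) \<longleftrightarrow>
       letter u (mirror_index n b i) \<noteq> letter u (mirror_index n b (i + 1))"
      using k by (auto simp: doubleton_eq_iff)
    then show ?thesis using letter_eq_iff_half[OF that that, of i "i + 1" b b] i by simp
  qed
  have 2: "(\<forall>j\<in>{1..2 * n} - {?k, ?k + 1}. letter v j = letter w j) \<longleftrightarrow>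
    (\<forall>b' j. 1 \<le> j \<longrightarrow> j \<le> n \<longrightarrow> \<not> (b' = b \<and> (j = i \<or> j = i + 1)) \<longrightarrow> half n v b' j = half n w b' j)"
    (is "?A \<longleftrightarrow> ?B")
  proof
    assume A: ?A
    show ?B
    proof (intro allI impI)
      fix b' j assume j: "1 \<le> j" "j \<le> n" "\<not> (b' = b \<and> (j = i \<or> j = i + 1))"
      then have "mirror_index n b' j \<in> {1..2 * n} - {?k, ?k + 1}"
        unfolding k using mirror_index_bounds[OF j(1,2)] mirror_index_eq_iff[OF j(1,2)] i by auto
      then have "letter v (mirror_index n b' j) = letter w (mirror_index n b' j)" using A by blast
      then show "half n v b' j = half n w b' j" by (simp add: half_def)
    qed
  next
    assume B: ?B
    show ?A
    proof
      fix k' assume k': "k' \<in> {1..2 * n} - {?k, ?k + 1}"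
      then have "k' \<in> {1..2 * n}" by blast
      then obtain b' j where j: "1 \<le> j" "j \<le> n" "k' = mirror_index n b' j" by (rule mirror_index_surj)
      have "\<not> (b' = b \<and> (j = i \<or> j = i + 1))" using k' j unfolding k by blast
      then have "half n v b' j = half n w b' j" using B j by blast
      then show "letter v k' = letter w k'" using letter_eq_iff_half[OF v w j(1,2) j(1,2)] j(3) by blast
    qed
  qed
  have 3: "(\<forall>b' j. 1 \<le> j \<longrightarrow> j \<le> n \<longrightarrow> \<not> (b' = b \<and> (j = i \<or> j = i + 1)) \<longrightarrow> half n v b' j = half n w b' j) \<longleftrightarrow>
    (\<forall>j. 1 \<le> j \<longrightarrow> j \<le> n \<longrightarrow> j \<noteq> i \<longrightarrow> j \<noteq> i + 1 \<longrightarrow> half n v b j = half n w b j) \<and>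
    (\<forall>j. 1 \<le> j \<longrightarrow> j \<le> n \<longrightarrow> half n v (\<not> b) j = half n w (\<not> b) j)" (is "?B \<longleftrightarrow> ?C \<and> ?C'")
  proof (intro iffI conjI)
    assume B: ?B
    show ?C using B[rule_format, of _ b] by simp
    show ?C' using B[rule_format, of _ "\<not> b"] by simp
  next
    assume C: "?C \<and> ?C'"
    show ?B
    proof (intro allI impI)
      fix b' j assume j: "1 \<le> j" "j \<le> n" "\<not> (b' = b \<and> (j = i \<or> j = i + 1))"
      have "b' = b \<or> b' = (\<not> b)" by blast
      then show "half n v b' j = half n w b' j" using C j by (elim disjE) simp_all
    qed
  qed
  show ?thesis unfolding flip_mask_def 1[OF v] 1[OF w] 2 3 by blast
qed

text \<open>The factors act on different halves, so the intermediate word is forced: it reads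
  \<open>w\<close> on the mirrored half, already changed by the first factor, and \<open>v\<close>
  on the other half.\<close>

lemma has_mask_U_mult:
  assumes i: "1 \<le> i" "i < n"
    and A: "has_mask (2 * n) A (flip_mask (2 * n) (n - i))"
    and B: "has_mask (2 * n) B (flip_mask (2 * n) (n + i))"
  shows "has_mask (2 * n) (mat_mult (2 * n) A B) (compatible n (U_diagram n i, {}))"
proof (rule has_mask_mult[OF A B])
  note T = flip_mask_half[OF i, where b = True, simplified]
    and F = flip_mask_half[OF i, where b = False, simplified]
  fix v w assume v: "v \<in> words (2 * n)" and w: "w \<in> words (2 * n)"
  show "compatible n (U_diagram n i, {}) v w \<longleftrightarrow>
    (\<exists>u\<in>words (2 * n). flip_mask (2 * n) (n - i) v u \<and> flip_mask (2 * n) (n + i) u w)"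
  proof
    assume c: "compatible n (U_diagram n i, {}) v w"
    obtain u where u: "u \<in> words (2 * n)"
      "\<And>b j. 1 \<le> j \<Longrightarrow> j \<le> n \<Longrightarrow> half n u b j = (if b then half n w b j else half n v b j)"
      using words_exists_half[of n "\<lambda>b j. if b then half n w b j else half n v b j"] by auto
    have "flip_mask (2 * n) (n - i) v u" "flip_mask (2 * n) (n + i) u w"
      using c i unfolding T[OF v u(1)] F[OF u(1) w] compatible_U[OF i] by (auto simp: u(2))
    then show "\<exists>u\<in>words (2 * n). flip_mask (2 * n) (n - i) v u \<and> flip_mask (2 * n) (n + i) u w"
      using u(1) by blast
  next
    assume "\<exists>u\<in>words (2 * n). flip_mask (2 * n) (n - i) v u \<and> flip_mask (2 * n) (n + i) u w"
    then obtain u where u: "u \<in> words (2 * n)" "flip_mask (2 * n) (n - i) v u" "flip_mask (2 * n) (n + i) u w"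
      by blast
    note t = u(2)[unfolded T[OF v u(1)]] and f = u(3)[unfolded F[OF u(1) w]]
    have j: "1 \<le> i" "i \<le> n" "1 \<le> i + 1" "i + 1 \<le> n" using i by auto
    have vF: "half n v False j = half n u False j" and uT: "half n u True j = half n w True j"
      if "1 \<le> j" "j \<le> n" for j using t f that by simp_all
    have vT: "half n v True j = half n u True j" and uF: "half n u False j = half n w False j"
      if "1 \<le> j" "j \<le> n" "j \<noteq> i" "j \<noteq> i + 1" for j using t f that by simp_all
    have "half n v b i \<noteq> half n v b (i + 1) \<and> half n w b i \<noteq> half n w b (i + 1)" for b
    proof (cases b)
      case True
      then show ?thesis using t uT[OF j(1,2)] uT[OF j(3,4)] by simp
    next
      case False
      then show ?thesis using f vF[OF j(1,2)] vF[OF j(3,4)] by simp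
    qed
    moreover have "half n v b j = half n w b j" if "1 \<le> j" "j \<le> n" "j \<noteq> i" "j \<noteq> i + 1" for b j
      using vF[OF that(1,2)] uT[OF that(1,2)] vT[OF that] uF[OF that] by (cases b) simp_all
    ultimately show "compatible n (U_diagram n i, {}) v w" unfolding compatible_U[OF i] by blast
  qed
  fix u u' assume u: "u \<in> words (2 * n)" "u' \<in> words (2 * n)"
    "flip_mask (2 * n) (n - i) v u" "flip_mask (2 * n) (n + i) u w"
    "flip_mask (2 * n) (n - i) v u'" "flip_mask (2 * n) (n + i) u' w"
  show "u = u'"
  proof (rule words_eqI_half[OF u(1,2)])
    fix b j assume "1 \<le> j" "j \<le> n"
    then show "half n u b j = half n u' b j"
      using u(3)[unfolded T[OF v u(1)]] u(4)[unfolded F[OF u(1) w]]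
        u(5)[unfolded T[OF v u(2)]] u(6)[unfolded F[OF u(2) w]]
      by (cases b) simp_all
  qed
qed

text \<open>The intermediate word agrees with \<open>v\<close> away from node 1, and at node 1 the
  undecorated line forces it to be opposite to the spin at \<open>y\<close> in each half. The demand
  of e that the halves differ at node 1 thus becomes the same demand at \<open>y\<close>, which is
  what decorating the line means.\<close>

lemma has_mask_e_mult:
  assumes DB: "(D, B) \<in> blob_diagrams n" and y: "{North 1, y} \<in> D" "{North 1, y} \<notin> B" and n: "1 \<le> n"
    and E: "has_mask (2 * n) E (compatible n (id_diagram n, {{North 1, South 1}}))"
    and A: "has_mask (2 * n) A (compatible n (D, B))"
  shows "has_mask (2 * n) (mat_mult (2 * n) E A) (compatible n (D, insert {North 1, y} B))"
proof (rule has_mask_mult[OF E A])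
  note D = blob_diagramsD(1)[OF DB]
  note yn = TL_line_nodes[OF D y(1)]
  have other: "x \<noteq> North 1 \<and> x' \<noteq> North 1 \<and> x \<noteq> y \<and> x' \<noteq> y" if "{x, x'} \<in> D" "{x, x'} \<noteq> {North 1, y}" for x x'
    using TL_block_unique[OF D that(1) y(1)] that(2) by blast
  fix v w assume v: "v \<in> words (2 * n)" and w: "w \<in> words (2 * n)"
  have same: "spin n u w b x = spin n v w b x" 
    if "compatible n (id_diagram n, {{North 1, South 1}}) v u" "x \<in> nodes n" "x \<noteq> North 1" for u b x
    using that unfolding compatible_e[OF n] by (cases x) auto
  show "compatible n (D, insert {North 1, y} B) v w \<longleftrightarrow>
    (\<exists>u\<in>words (2 * n). compatible n (id_diagram n, {{North 1, South 1}}) v u \<and> compatible n (D, B) u w)"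
  proof
    assume c: "compatible n (D, insert {North 1, y} B) v w"
    have c1: "half n v True 1 \<noteq> half n v False 1"
      using c[unfolded compatible.simps, rule_format, OF y(1)] by simp
    have "{y, North 1} \<in> D" using y(1) by (simp add: insert_commute)
    from c[unfolded compatible.simps, rule_format, OF this]
    have cy: "spin n v w True y \<noteq> spin n v w False y" by (simp add: insert_commute)
    obtain u where u: "u \<in> words (2 * n)"
      "\<And>b j. 1 \<le> j \<Longrightarrow> j \<le> n \<Longrightarrow> half n u b j = (if j = 1 then \<not> spin n v w b y else half n v b j)"
      using words_exists_half[of n "\<lambda>b j. if j = 1 then \<not> spin n v w b y else half n v b j"] by auto
    have e: "compatible n (id_diagram n, {{North 1, South 1}}) v u"
      unfolding compatible_e[OF n] using c1 cy n by (auto simp: u(2))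
    have "compatible n (D, B) u w" unfolding compatible.simps
    proof (intro allI impI)
      fix x x' assume x: "{x, x'} \<in> D"
      note xn = TL_line_nodes[OF D x]
      show "if {x, x'} \<in> B then spin n u w True x \<noteq> spin n u w False x
        else \<forall>b. spin n u w b x \<noteq> spin n u w b x'"
      proof (cases "{x, x'} = {North 1, y}")
        case True
        have ne: "spin n u w b (North 1) \<noteq> spin n u w b y" for b
          using same[OF e yn(2)] yn(3) n by (simp add: u(2))
        have "x = North 1 \<and> x' = y \<or> x = y \<and> x' = North 1"
          using True by (simp only: doubleton_eq_iff)
        moreover have "{x, x'} \<notin> B" unfolding True by (rule y(2))
        ultimately show ?thesis using ne ne[symmetric] by (elim disjE) (simp_all only: if_False simp_thms)
      next
        case False
        then show ?thesis
          using c[unfolded compatible.simps, rule_format, OF x] other[OF x False]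
          by (simp only: same[OF e xn(1)] same[OF e xn(2)] insert_iff simp_thms)
      qed
    qed
    with e u(1) show "\<exists>u\<in>words (2 * n). compatible n (id_diagram n, {{North 1, South 1}}) v u \<and> compatible n (D, B) u w"
      by blast
  next
    assume "\<exists>u\<in>words (2 * n). compatible n (id_diagram n, {{North 1, South 1}}) v u \<and> compatible n (D, B) u w"
    then obtain u where u: "u \<in> words (2 * n)" and e: "compatible n (id_diagram n, {{North 1, South 1}}) v u"
      and c: "compatible n (D, B) u w" by blast
    note e' = e[unfolded compatible_e[OF n]]
    have cy: "spin n u w b (North 1) \<noteq> spin n u w b y" for b
      using c[unfolded compatible.simps, rule_format, OF y(1)] y(2) by simp
    show "compatible n (D, insert {North 1, y} B) v w" unfolding compatible.simps
    proof (intro allI impI)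
      fix x x' assume x: "{x, x'} \<in> D"
      note xn = TL_line_nodes[OF D x]
      show "if {x, x'} \<in> insert {North 1, y} B then spin n v w True x \<noteq> spin n v w False x
        else \<forall>b. spin n v w b x \<noteq> spin n v w b x'"
      proof (cases "{x, x'} = {North 1, y}")
        case True
        have "spin n v w True y \<noteq> spin n v w False y"
          using same[OF e yn(2)] yn(3) cy[of True] cy[of False] e' by simp
        moreover have "x = North 1 \<and> x' = y \<or> x = y \<and> x' = North 1"
          using True by (simp only: doubleton_eq_iff)
        moreover have "{x, x'} \<in> insert {North 1, y} B" unfolding True by (rule insertI1)
        ultimately show ?thesis using e' by (elim disjE) simp_all
      next
        case False
        then show ?thesis
          using c[unfolded compatible.simps, rule_format, OF x] other[OF x False]
          by (simp only: same[OF e xn(1)] same[OF e xn(2)] insert_iff simp_thms)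
      qed
    qed
  qed
  fix u u' assume u: "u \<in> words (2 * n)" "u' \<in> words (2 * n)"
    "compatible n (id_diagram n, {{North 1, South 1}}) v u" "compatible n (D, B) u w"
    "compatible n (id_diagram n, {{North 1, South 1}}) v u'" "compatible n (D, B) u' w"
  show "u = u'"
  proof (rule words_eqI_half[OF u(1,2)])
    fix b j assume j: "1 \<le> j" "j \<le> n"
    have "spin n u w b (North 1) \<noteq> spin n u w b y" "spin n u' w b (North 1) \<noteq> spin n u' w b y"
      using u(4,6)[unfolded compatible.simps, rule_format, OF y(1)] y(2) by simp_all
    moreover have "spin n u w b y = spin n u' w b y"
      using same[OF u(3) yn(2)] same[OF u(5) yn(2)] yn(3) by simp
    ultimately have "half n u b 1 = half n u' b 1" by simp
    then show "half n u b j = half n u' b j"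
      using u(3,5) j unfolding compatible_e[OF n] by (cases "j = 1") auto
  qed
qed

text \<open>The intermediate word agrees with \<open>v\<close> away from i and i + 1. At i + 1 the
  undecorated line makes it opposite to the spin at \<open>z\<close>, and the arc of U_i makes i
  opposite to i + 1. So i repeats the spin at \<open>z\<close>, and the condition on the line from i
  to \<open>c\<close>, decorated or not, is the one on the line from \<open>z\<close> to
  \<open>c\<close>.\<close>

lemma has_mask_U_step:
  assumes DB: "(D, B) \<in> blob_diagrams n" and i: "1 \<le> i" "i < n"
    and c: "{North i, c} \<in> D" "c \<noteq> North (i + 1)"
    and z: "{North (i + 1), z} \<in> D" "{North (i + 1), z} \<notin> B"
    and E: "has_mask (2 * n) E (compatible n (U_diagram n i, {}))"
    and A: "has_mask (2 * n) A (compatible n (D, B))"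
  shows "has_mask (2 * n) (mat_mult (2 * n) E A) (compatible n
     (insert {North i, North (i + 1)} (insert {z, c} (D - {{North i, c}, {North (i + 1), z}})),
       if {North i, c} \<in> B then insert {z, c} (B - {{North i, c}}) else B))"
proof (rule has_mask_mult[OF E A])
  note D = blob_diagramsD(1)[OF DB]
  have BD: "B \<subseteq> D" by (rule blob_diagramsD(2)[OF DB])
  define D' where "D' = insert {North i, North (i + 1)} (insert {z, c} (D - {{North i, c}, {North (i + 1), z}}))"
  define B' where "B' = (if {North i, c} \<in> B then insert {z, c} (B - {{North i, c}}) else B)"
  note cn = TL_line_nodes[OF D c(1)] and zn = TL_line_nodes[OF D z(1)]
  have zi: "z \<noteq> North i"
    using TL_line_unique[OF D c(1), of "North (i+1)"] z(1) c(2) by (auto simp: insert_commute)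
  have cz: "c \<noteq> z" using TL_line_unique[OF D, of c "North i" "North (i+1)"] c(1) z(1)
    by (auto simp: insert_commute)
  let ?S = "{North i, North (i + 1), c, z}"
  have other: "x \<notin> ?S \<and> x' \<notin> ?S" if "{x, x'} \<in> D" "{x, x'} \<noteq> {North i, c}" "{x, x'} \<noteq> {North (i + 1), z}" for x x'
    using TL_block_unique[OF D that(1) c(1)] TL_block_unique[OF D that(1) z(1)] that(2,3) by blast
  have B'_other: "{x, x'} \<in> B' \<longleftrightarrow> {x, x'} \<in> B" if "x \<notin> ?S" for x x'
    using that by (auto simp: B'_def doubleton_eq_iff)
  have B'_zc: "{z, c} \<in> B' \<longleftrightarrow> {North i, c} \<in> B"
  proof -
    have "{z, c} \<notin> D" using TL_line_unique[OF D, of z c "North (i+1)"] z(1) c(2) by (auto simp: insert_commute)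
    then show ?thesis using BD by (auto simp: B'_def)
  qed
  have B'_cap: "{North i, North (i + 1)} \<notin> B'"
  proof -
    have "{North i, North (i + 1)} \<notin> D" using TL_line_unique[OF D c(1)] c(2) by blast
    then show ?thesis using BD cn zn zi c(2) by (auto simp: B'_def doubleton_eq_iff)
  qed
  fix v w assume v: "v \<in> words (2 * n)" and w: "w \<in> words (2 * n)"
  have same: "spin n u w b x = spin n v w b x" 
    if "compatible n (U_diagram n i, {}) v u" "x \<in> nodes n" "x \<noteq> North i" "x \<noteq> North (i + 1)" for u b x
    using that unfolding compatible_U[OF i] by (cases x) auto
  show "compatible n (insert {North i, North (i + 1)} (insert {z, c} (D - {{North i, c}, {North (i + 1), z}})),
       if {North i, c} \<in> B then insert {z, c} (B - {{North i, c}}) else B) v w \<longleftrightarrow>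
    (\<exists>u\<in>words (2 * n). compatible n (U_diagram n i, {}) v u \<and> compatible n (D, B) u w)"
    unfolding D'_def[symmetric] B'_def[symmetric]
  proof
    assume k: "compatible n (D', B') v w"
    note k' = k[unfolded compatible.simps, rule_format]
    have cap: "half n v b i \<noteq> half n v b (i + 1)" for b
      using k'[of "North i" "North (i+1)"] B'_cap by (auto simp: D'_def)
    have zc: "if {North i, c} \<in> B then spin n v w True z \<noteq> spin n v w False z \<and> spin n v w True c \<noteq> spin n v w False c
       else \<forall>b. spin n v w b z \<noteq> spin n v w b c"
      using k'[of z c] k'[of c z] B'_zc by (auto simp: D'_def insert_commute)
    obtain u where u: "u \<in> words (2 * n)"
      "\<And>b j. 1 \<le> j \<Longrightarrow> j \<le> n \<Longrightarrow> half n u b j =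
         (if j = i then spin n v w b z else if j = i + 1 then \<not> spin n v w b z else half n v b j)"
      using words_exists_half[of n "\<lambda>b j. if j = i then spin n v w b z else if j = i + 1 then \<not> spin n v w b z else half n v b j"]
      by auto
    have e: "compatible n (U_diagram n i, {}) v u"
      unfolding compatible_U[OF i] using cap i by (auto simp: u(2))
    have sc: "spin n u w b c = spin n v w b c" for b by (rule same[OF e cn(2)]) (use cn c in auto)
    have sz: "spin n u w b z = spin n v w b z" for b by (rule same[OF e zn(2)]) (use zn zi in auto)
    have si: "spin n u w b (North i) = spin n v w b z" for b using i by (simp add: u(2))
    have si1: "spin n u w b (North (i+1)) = (\<not> spin n v w b z)" for b using i by (simp add: u(2))
    have "compatible n (D, B) u w" unfolding compatible.simps
    proof (intro allI impI)
      fix x x' assume x: "{x, x'} \<in> D"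
      note xn = TL_line_nodes[OF D x]
      consider "{x, x'} = {North i, c}" | "{x, x'} = {North (i + 1), z}"
        | "{x, x'} \<noteq> {North i, c}" "{x, x'} \<noteq> {North (i + 1), z}" by blast
      then show "if {x, x'} \<in> B then spin n u w True x \<noteq> spin n u w False x
        else \<forall>b. spin n u w b x \<noteq> spin n u w b x'"
      proof cases
        case 1
        then have "x = North i \<and> x' = c \<or> x = c \<and> x' = North i" by (auto simp: doubleton_eq_iff)
        then show ?thesis
          unfolding 1 using zc by (elim disjE conjE) (simp_all only: sc si split: if_splits, blast+)
      next
        case 2
        then have "x = North (i+1) \<and> x' = z \<or> x = z \<and> x' = North (i+1)" by (auto simp: doubleton_eq_iff)
        then show ?thesis unfolding 2 using z(2) sz si1 by auto
      next
        case 3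
        note o = other[OF x 3]
        have "{x, x'} \<in> D'" using x 3 by (simp add: D'_def)
        from k'[OF this] show ?thesis
          using o B'_other[of x x'] by (simp only: same[OF e xn(1)] same[OF e xn(2)] insert_iff simp_thms de_Morgan_disj)
      qed
    qed
    with e u(1) show "\<exists>u\<in>words (2 * n). compatible n (U_diagram n i, {}) v u \<and> compatible n (D, B) u w"
      by blast
  next
    assume "\<exists>u\<in>words (2 * n). compatible n (U_diagram n i, {}) v u \<and> compatible n (D, B) u w"
    then obtain u where u: "u \<in> words (2 * n)" and e: "compatible n (U_diagram n i, {}) v u"
      and k: "compatible n (D, B) u w" by blast
    note e' = e[unfolded compatible_U[OF i]]
    note k' = k[unfolded compatible.simps, rule_format]
    have sc: "spin n u w b c = spin n v w b c" for b by (rule same[OF e cn(2)]) (use cn c in auto)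
    have sz: "spin n u w b z = spin n v w b z" for b by (rule same[OF e zn(2)]) (use zn zi in auto)
    have si1: "spin n u w b (North (i+1)) \<noteq> spin n v w b z" for b
      using k'[OF z(1)] z(2) sz by simp
    have si: "spin n u w b (North i) = spin n v w b z" for b
      using si1[of b] e' by auto
    have "{c, North i} \<in> D" using c(1) by (simp add: insert_commute)
    note c' = this
    have zc: "if {North i, c} \<in> B then spin n v w True z \<noteq> spin n v w False z \<and> spin n v w True c \<noteq> spin n v w False c
       else \<forall>b. spin n v w b z \<noteq> spin n v w b c"
    proof (cases "{North i, c} \<in> B")
      case True
      moreover have "{c, North i} \<in> B" using True by (simp only: insert_commute)
      ultimately show ?thesis using k'[OF c(1)] k'[OF c'] by (simp only: si sc if_True) blast
    next
      case False
      then show ?thesis using k'[OF c(1)] by (simp only: si sc if_False) blast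
    qed
    show "compatible n (D', B') v w" unfolding compatible.simps
    proof (intro allI impI)
      fix x x' assume x: "{x, x'} \<in> D'"
      then consider "{x, x'} = {North i, North (i + 1)}" | "{x, x'} = {z, c}"
        | "{x, x'} \<in> D" "{x, x'} \<noteq> {North i, c}" "{x, x'} \<noteq> {North (i + 1), z}" by (auto simp: D'_def)
      then show "if {x, x'} \<in> B' then spin n v w True x \<noteq> spin n v w False x
        else \<forall>b. spin n v w b x \<noteq> spin n v w b x'"
      proof cases
        case 1
        then have "x = North i \<and> x' = North (i+1) \<or> x = North (i+1) \<and> x' = North i" by (auto simp: doubleton_eq_iff)
        then show ?thesis unfolding 1 using B'_cap e' by auto
      next
        case 2
        then have "x = z \<and> x' = c \<or> x = c \<and> x' = z" by (auto simp: doubleton_eq_iff)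
        then show ?thesis unfolding 2 B'_zc using zc by (auto split: if_splits)
      next
        case 3
        note o = other[OF 3] and xn = TL_line_nodes[OF D 3(1)]
        from k'[OF 3(1)] show ?thesis
          using o B'_other[of x x'] by (simp only: same[OF e xn(1)] same[OF e xn(2)] insert_iff simp_thms de_Morgan_disj)
      qed
    qed
  qed
  fix u u' assume u: "u \<in> words (2 * n)" "u' \<in> words (2 * n)"
    "compatible n (U_diagram n i, {}) v u" "compatible n (D, B) u w"
    "compatible n (U_diagram n i, {}) v u'" "compatible n (D, B) u' w"
  show "u = u'"
  proof (rule words_eqI_half[OF u(1,2)])
    fix b j assume j: "1 \<le> j" "j \<le> n"
    have "spin n u w b (North (i+1)) \<noteq> spin n u w b z" "spin n u' w b (North (i+1)) \<noteq> spin n u' w b z"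
      using u(4,6)[unfolded compatible.simps, rule_format, OF z(1)] z(2) by simp_all
    moreover have "spin n u w b z = spin n u' w b z"
      using same[OF u(3) zn(2)] same[OF u(5) zn(2)] zn(3) zi by simp
    ultimately have "half n u b (i+1) = half n u' b (i+1)" by simp
    moreover have "half n u b i \<noteq> half n u b (i+1)" "half n u' b i \<noteq> half n u' b (i+1)"
      using u(3,5) unfolding compatible_U[OF i] by blast+
    moreover have "half n u b j = half n u' b j" if "j \<noteq> i" "j \<noteq> i + 1"
      using u(3)[unfolded compatible_U[OF i], THEN conjunct2, rule_format, OF j that]
        u(5)[unfolded compatible_U[OF i], THEN conjunct2, rule_format, OF j that] by simp
    ultimately show "half n u b j = half n u' b j" by metis
  qed
qed

section \<open>Generation by the generators\<close>

text \<open>The inverse of \<open>stack_U\<close>: the cap and the line from \<open>z\<close> to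
  \<open>c\<close> are exchanged for lines from i to \<open>c\<close> and from i + 1 to
  \<open>z\<close>, and a blob moves to the former. By \<open>inner\<close> the nodes between i + 1
  and \<open>z\<close> are joined among themselves without blobs, so the new line to
  \<open>z\<close> crosses nothing and covers no blob; by \<open>C\<close> the node \<open>c\<close>
  lies outside the stretch from i to \<open>z\<close>.\<close>

lemma undo_cap:
  assumes DB: "(D, B) \<in> blob_diagrams n" and i: "1 \<le> i" "i < n"
    and cap: "{North i, North (i + 1)} \<in> D" "{North i, North (i + 1)} \<notin> B"
    and zc: "{z, c} \<in> D" and Z: "i + 1 < pos n z" and C: "pos n c < i \<or> pos n z < pos n c"
    and inner: "\<And>u v. {u, v} \<in> D \<Longrightarrow> i + 1 < pos n u \<Longrightarrow> pos n u < pos n z \<Longrightarrow>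
                  {u, v} \<notin> B \<and> i + 1 < pos n v \<and> pos n v < pos n z"
  defines "D' \<equiv> insert {North i, c} (insert {North (i + 1), z} (D - {{North i, North (i + 1)}, {z, c}}))"
    and "B' \<equiv> if {z, c} \<in> B then insert {North i, c} (B - {{z, c}}) else B"
  shows "(D', B') \<in> blob_diagrams n"
    and "c \<noteq> North (i + 1)" and "{North (i + 1), z} \<notin> B'"
    and "D = insert {North i, North (i + 1)} (insert {z, c} (D' - {{North i, c}, {North (i + 1), z}}))"
    and "B = (if {North i, c} \<in> B' then insert {z, c} (B' - {{North i, c}}) else B')"
    and "{North i, c} \<notin> D" and "{North (i + 1), z} \<notin> D"
    and "{North i, c} \<in> B' \<longleftrightarrow> {z, c} \<in> B"
proof -
  note D = blob_diagramsD(1)[OF DB]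
  have BD: "B \<subseteq> D" by (rule blob_diagramsD(2)[OF DB])
  note zn = TL_line_nodes[OF D zc]
  have iN: "North i \<in> nodes n" "North (i + 1) \<in> nodes n" using i by auto
  have dist: "c \<noteq> North i" "c \<noteq> North (i + 1)" "z \<noteq> North i" "z \<noteq> North (i + 1)" "z \<noteq> c"
    using Z C by auto
  show "c \<noteq> North (i + 1)" by (rule dist)
  let ?S = "{North i, North (i + 1), z, c}"
  have other: "u \<notin> ?S \<and> v \<notin> ?S" if "{u, v} \<in> D" "{u, v} \<noteq> {North i, North (i + 1)}" "{u, v} \<noteq> {z, c}" for u v
    using TL_block_unique[OF D that(1) cap(1)] TL_block_unique[OF D that(1) zc] that(2,3) by blast
  show L1: "{North i, c} \<notin> D" using TL_line_unique[OF D cap(1)] dist by blast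
  show L2: "{North (i + 1), z} \<notin> D"
    using TL_line_unique[OF D, of "North (i+1)" "North i" z] cap(1) dist by (auto simp: insert_commute)
  have D'_line: "{u, v} \<in> D' \<longleftrightarrow> (u = North i \<and> v = c) \<or> (u = c \<and> v = North i) \<or>
      (u = North (i + 1) \<and> v = z) \<or> (u = z \<and> v = North (i + 1)) \<or> ({u, v} \<in> D \<and> u \<notin> ?S \<and> v \<notin> ?S)"
    (is "?l \<longleftrightarrow> ?r") for u v
  proof
    assume ?l
    then consider "{u, v} = {North i, c}" | "{u, v} = {North (i + 1), z}"
      | "{u, v} \<in> D" "{u, v} \<noteq> {North i, North (i + 1)}" "{u, v} \<noteq> {z, c}" unfolding D'_def by blast
    then show ?r
    proof cases
      case 1 then show ?thesis by (simp only: doubleton_eq_iff) blast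
    next
      case 2 then show ?thesis by (simp only: doubleton_eq_iff) blast
    next
      case 3 then show ?thesis using other[OF 3] by blast
    qed
  next
    assume ?r
    then show ?l unfolding D'_def
    proof (elim disjE conjE)
      assume "{u, v} \<in> D" "u \<notin> ?S"
      then show "{u, v} \<in> insert {North i, c} (insert {North (i + 1), z} (D - {{North i, North (i + 1)}, {z, c}}))"
        by blast
    qed (simp_all add: insert_commute)
  qed
  have B'_line: "{u, v} \<in> B' \<longleftrightarrow> ({z, c} \<in> B \<and> (u = North i \<and> v = c \<or> u = c \<and> v = North i)) \<or>
      ({u, v} \<in> B \<and> u \<notin> ?S \<and> v \<notin> ?S)" (is "?l \<longleftrightarrow> ?r") for u v
  proof
    assume ?l
    then consider "{u, v} = {North i, c}" "{z, c} \<in> B"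
      | "{u, v} \<in> B" "{u, v} \<noteq> {z, c}" unfolding B'_def by (metis DiffE insertE insertI1)
    then show ?r
    proof cases
      case 1 then show ?thesis by (simp only: doubleton_eq_iff) blast
    next
      case 2
      then have "{u, v} \<noteq> {North i, North (i + 1)}" using cap(2) by metis
      then show ?thesis using other[of u v] 2 BD by blast
    qed
  next
    assume ?r
    then show ?l unfolding B'_def
    proof (elim disjE conjE)
      assume "{u, v} \<in> B" "u \<notin> ?S"
      then show "{u, v} \<in> (if {z, c} \<in> B then insert {North i, c} (B - {{z, c}}) else B)" by auto
    qed (simp_all add: insert_commute)
  qed
  show "{North (i + 1), z} \<notin> B'" using B'_line[of "North (i+1)" z] dist by blast
  show B1: "{North i, c} \<in> B' \<longleftrightarrow> {z, c} \<in> B" using B'_line[of "North i" c] by blast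
  show "D = insert {North i, North (i + 1)} (insert {z, c} (D' - {{North i, c}, {North (i + 1), z}}))"
    using L1 L2 cap(1) zc unfolding D'_def by blast
  have "{North i, c} \<notin> B" using L1 BD by blast
  then show "B = (if {North i, c} \<in> B' then insert {z, c} (B' - {{North i, c}}) else B')"
    unfolding B1 unfolding B'_def by auto
  have P_ne: "pos n u \<noteq> i \<and> pos n u \<noteq> i + 1 \<and> pos n u \<noteq> pos n z \<and> pos n u \<noteq> pos n c"
    if "{u, v} \<in> D" "u \<notin> ?S" for u v
    using pos_eq_iff[OF TL_line_nodes(1)[OF D that(1)] iN(1)] pos_eq_iff[OF TL_line_nodes(1)[OF D that(1)] iN(2)]
      pos_eq_iff[OF TL_line_nodes(1)[OF D that(1)] zn(1)] pos_eq_iff[OF TL_line_nodes(1)[OF D that(1)] zn(2)]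
      that(2) by auto
  have io: "(i + 1 < pos n u \<and> pos n u < pos n z) = (i + 1 < pos n v \<and> pos n v < pos n z)"
    if "{u, v} \<in> D" for u v
    using inner[OF that] inner[of v u] that by (auto simp: insert_commute)
  have cz: "{c, z} \<in> D" using zc by (simp add: insert_commute)
  have nc: "\<not> (pos n a < pos n b \<and> pos n b < pos n k \<and> pos n k < pos n d)"
    if "{a, k} \<in> D" "{b, d} \<in> D" for a b k d
  proof -
    have "noncrossing n D" using D by (simp add: TL_diagrams_def)
    then show ?thesis using that unfolding noncrossing_def by blast
  qed
  have D': "D' \<in> TL_diagrams n"
  proof (rule TL_diagramsI)
    fix l assume "l \<in> D'"
    then consider "l = {North i, c}" | "l = {North (i + 1), z}" | "l \<in> D" unfolding D'_def by blast
    then show "\<exists>u v. l = {u, v} \<and> u \<noteq> v \<and> u \<in> nodes n \<and> v \<in> nodes n"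
    proof cases
      case 1
      then show ?thesis
        by (intro exI[of _ "North i"] exI[of _ c] conjI) (use dist iN zn in simp_all)
    next
      case 2
      then show ?thesis
        by (intro exI[of _ "North (i + 1)"] exI[of _ z] conjI) (use dist iN zn in simp_all)
    next
      case 3
      obtain u v where uv: "l = {u, v}" by (rule TL_line_cases[OF D 3])
      then have "{u, v} \<in> D" using 3 by simp
      note TL_line_nodes[OF D this]
      then show ?thesis using uv by (intro exI[of _ u] exI[of _ v] conjI)
    qed
  next
    fix u assume u: "u \<in> nodes n"
    obtain v where v: "{u, v} \<in> D" by (rule TL_line_ex[OF D u])
    show "\<exists>v. {u, v} \<in> D'"
    proof (cases "u \<in> ?S")
      case True
      have "{North i, c} \<in> D'" "{c, North i} \<in> D'" "{North (i + 1), z} \<in> D'" "{z, North (i + 1)} \<in> D'"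
        by (simp_all add: D'_line)
      then show ?thesis using True by blast
    next
      case False
      then have "v \<notin> ?S" using other[OF v] by blast
      then have "{u, v} \<in> D'" using D'_line[of u v] v False by blast
      then show ?thesis by blast
    qed
  next
    fix u v v' assume "{u, v} \<in> D'" "{u, v'} \<in> D'"
    then show "v = v'" unfolding D'_line using dist dist[symmetric] TL_line_unique[OF D, of u v v']
      by (elim disjE conjE) simp_all
  next
    \<comment> \<open>No remaining line of \<open>D\<close> leaves the stretch between i + 1 and
      \<open>z\<close>, so none crosses the new line there. Moving an end from \<open>z\<close> to i
      passes over this stretch only, so a remaining line crossing the line from i to
      \<open>c\<close> would cross the old line from \<open>z\<close> to \<open>c\<close>.\<close>
    show "noncrossing n D'" unfolding noncrossing_def
    proof (intro notI, elim exE conjE)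
      fix a b k d
      assume ak: "{a, k} \<in> D'" and bd: "{b, d} \<in> D'"
        and lt: "pos n a < pos n b" "pos n b < pos n k" "pos n k < pos n d"
      show False
        using ak[unfolded D'_line]
      proof (elim disjE)
        assume 1: "a = North i \<and> k = c"
        show False using bd[unfolded D'_line]
        proof (elim disjE)
          assume 2: "{b, d} \<in> D \<and> b \<notin> ?S \<and> d \<notin> ?S"
          then show False using 1 lt nc[OF zc, of b d] io[of b d] P_ne[of b d] C by auto
        qed (use 1 lt C Z in auto)
      next
        assume 1: "a = c \<and> k = North i"
        show False using bd[unfolded D'_line]
        proof (elim disjE)
          assume 2: "{b, d} \<in> D \<and> b \<notin> ?S \<and> d \<notin> ?S"
          then have "{d, b} \<in> D" by (simp add: insert_commute)
          then show False using 1 2 lt nc[OF cz, of b d] io[of b d] P_ne[of d b] C Z by auto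
        qed (use 1 lt C Z in auto)
      next
        assume 1: "a = North (i + 1) \<and> k = z"
        show False using bd[unfolded D'_line]
        proof (elim disjE)
          assume 2: "{b, d} \<in> D \<and> b \<notin> ?S \<and> d \<notin> ?S"
          then show False using 1 lt io[of b d] by auto
        qed (use 1 lt C Z in auto)
      next
        assume 1: "a = z \<and> k = North (i + 1)"
        then show False using lt Z by auto
      next
        assume 1: "{a, k} \<in> D \<and> a \<notin> ?S \<and> k \<notin> ?S"
        then have ka: "{k, a} \<in> D" by (simp add: insert_commute)
        have pk: "pos n k \<noteq> i + 1" "pos n k \<noteq> pos n z" using P_ne[OF ka] 1 by auto
        have ik: "(i + 1 < pos n a \<and> pos n a < pos n z) = (i + 1 < pos n k \<and> pos n k < pos n z)"
          using io 1 by blast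
        show False using bd[unfolded D'_line]
        proof (elim disjE)
          assume 2: "b = North i \<and> d = c"
          then show False using 1 lt nc[of a k z c] zc ik pk C Z by auto
        next
          assume 2: "b = c \<and> d = North i"
          then show False using 1 lt nc[of a k c z] cz Z by auto
        next
          assume 2: "b = North (i + 1) \<and> d = z"
          then show False using lt ik by auto
        next
          assume 2: "b = z \<and> d = North (i + 1)"
          then show False using lt Z by auto
        next
          assume 2: "{b, d} \<in> D \<and> b \<notin> ?S \<and> d \<notin> ?S"
          then show False using 1 lt nc[of a k b d] by auto
        qed
      qed
    qed
  qed
  show "(D', B') \<in> blob_diagrams n"
  proof (rule blob_diagramsI[OF D'])
    show "B' \<subseteq> D'" unfolding B'_def D'_def using BD cap(2) by auto
    fix u v k l assume uv: "{u, v} \<in> B'" and kl: "{k, l} \<in> D'"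
      and lt: "pos n k < pos n u" "pos n u < pos n l" "pos n k < pos n v" "pos n v < pos n l"
    note ne = blob_not_enclosed[OF DB]
    show False using uv[unfolded B'_line]
    proof (elim disjE)
      assume A: "{z, c} \<in> B \<and> (u = North i \<and> v = c \<or> u = c \<and> v = North i)"
      then have lt': "pos n k < i" "i < pos n l" "pos n k < pos n c" "pos n c < pos n l" using lt by auto
      show False using kl[unfolded D'_line]
      proof (elim disjE)
        \<comment> \<open>Here \<open>k\<close> precedes the cap, so \<open>l\<close> cannot lie
          between the cap and \<open>z\<close>. The line therefore goes around \<open>z\<close> as
          well, and so encloses the decorated line from \<open>z\<close> to \<open>c\<close> in
          \<open>D\<close>.\<close>
        assume 2: "{k, l} \<in> D \<and> k \<notin> ?S \<and> l \<notin> ?S"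
        then have "{l, k} \<in> D" by (simp add: insert_commute)
        then have "pos n z < pos n l" using lt' io[of k l] P_ne[of l k] 2 by auto
        then show False using ne[of z c k l] A 2 lt' Z by auto
      qed (use lt' Z in auto)
    next
      assume A: "{u, v} \<in> B \<and> u \<notin> ?S \<and> v \<notin> ?S"
      then have uD: "{u, v} \<in> D" using BD by blast
      have out: "\<not> (i + 1 < pos n u \<and> pos n u < pos n z)" using inner[OF uD] A by blast
      note pu = P_ne[OF uD]
      show False using kl[unfolded D'_line]
      proof (elim disjE)
        assume "k = North i \<and> l = c"
        then show False using ne[of u v z c] zc A lt out pu by auto
      next
        assume "k = c \<and> l = North i"
        then show False using ne[of u v c z] cz A lt Z by auto
      next
        assume "k = North (i + 1) \<and> l = z"
        then show False using lt out by auto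
      next
        assume "k = z \<and> l = North (i + 1)"
        then show False using lt Z by auto
      next
        assume "{k, l} \<in> D \<and> k \<notin> ?S \<and> l \<notin> ?S"
        then show False using ne[of u v k l] A lt by auto
      qed
    qed
  qed
qed

text \<open>If the ends are not neighbours, the line at a + 1 is nested inside. So it stays on the
  northern side, is shorter, and carries no blob because it is enclosed.\<close>

lemma innermost_cap_ex:
  assumes DB: "(D, B) \<in> blob_diagrams n" and ab: "{North a, North b} \<in> D" "{North a, North b} \<notin> B"
  obtains i where "1 \<le> i" "i < n" "{North i, North (i + 1)} \<in> D" "{North i, North (i + 1)} \<notin> B"
proof -
  note D = blob_diagramsD(1)[OF DB]
  have "\<exists>a b. a < b \<and> b = a + 1 \<and> {North a, North b} \<in> D \<and> {North a, North b} \<notin> B"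
    if "a < b" "{North a, North b} \<in> D" "{North a, North b} \<notin> B" for a b
    using that
  proof (induction "b - a" arbitrary: a b rule: less_induct)
    case less
    note nn = TL_line_nodes[OF D less.prems(2)]
    show ?case
    proof (cases "b = a + 1")
      case True then show ?thesis using less.prems by blast
    next
      case False
      then have a1: "a + 1 < b" using less.prems(1) by linarith
      then have "North (a + 1) \<in> nodes n" using nn by auto
      then obtain v where v: "{North (a + 1), v} \<in> D" by (rule TL_line_ex[OF D])
      have "a < pos n v \<and> pos n v < b" using TL_nested[OF D less.prems(2) v] a1 by simp
      then obtain j where j: "v = North j" "a < j" "j < b"
        using TL_line_nodes[OF D v] nn by (cases v) auto
      have "j \<noteq> a + 1" using TL_line_nodes[OF D v] j by auto
      moreover have "{North (a + 1), v} \<notin> B"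
        using blob_not_enclosed[OF DB _ less.prems(2)] a1 by fastforce
      ultimately show ?thesis using less.hyps[of j "a + 1"] j v a1 by auto
    qed
  qed
  note ex = this
  have "a \<noteq> b" using TL_line_nodes[OF D ab(1)] by auto
  then consider "a < b" | "b < a" by linarith
  then have "\<exists>a b. a < b \<and> b = a + 1 \<and> {North a, North b} \<in> D \<and> {North a, North b} \<notin> B"
  proof cases
    case 1 then show ?thesis by (rule ex[OF _ ab])
  next
    case 2
    have "{North b, North a} \<in> D" "{North b, North a} \<notin> B" using ab by (simp_all only: insert_commute not_False_eq_True)
    with 2 show ?thesis by (rule ex)
  qed
  then obtain i where i: "{North i, North (i + 1)} \<in> D" "{North i, North (i + 1)} \<notin> B" by blast
  then show ?thesis using that[of i] TL_line_nodes[OF D i(1)] by auto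
qed

text \<open>On the vertical line through the cap, the next line below it runs to a node \<open>z\<close> in the eastern
  part, where a decorated line counts as two half-lines ending at the western edge.\<close>

lemma next_line_ex:
  assumes DB: "(D, B) \<in> blob_diagrams n" and i: "1 \<le> i" "i < n"
    and cap: "{North i, North (i + 1)} \<in> D" "{North i, North (i + 1)} \<notin> B"
  obtains z c where "{z, c} \<in> D" "i + 1 < pos n z" "pos n z \<le> 2 * n - i"
    "{z, c} \<in> B \<or> pos n c < i \<or> 2 * n - i < pos n c"
    "pos n c < i \<or> pos n z < pos n c"
    "\<forall>u v. {u, v} \<in> D \<longrightarrow> i + 1 < pos n u \<longrightarrow> pos n u < pos n z \<longrightarrow>
       {u, v} \<notin> B \<and> i + 1 < pos n v \<and> pos n v < pos n z"
proof -
  note D = blob_diagramsD(1)[OF DB]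
  have capped: "pos n u \<noteq> i \<and> pos n u \<noteq> i + 1" if "{u, v} \<in> D" "i + 1 < pos n v" for u v
  proof -
    have "v \<noteq> North i" "v \<noteq> North (i + 1)" using that(2) by auto
    then have "u \<noteq> North i" "u \<noteq> North (i + 1)"
      using TL_block_unique[OF D that(1) cap(1)] by auto
    then show ?thesis
      using pos_eq_iff[OF TL_line_nodes(1)[OF D that(1)], of "North i"]
        pos_eq_iff[OF TL_line_nodes(1)[OF D that(1)], of "North (i + 1)"] i by auto
  qed
  \<comment> \<open>Position 2n - i is the southern node i + 1. So \<open>z\<close> is sought
    strictly east of the cap on the north and east of the same vertical line on the south, on a line
    that leaves this region or is decorated.\<close>
  define Q where "Q = (\<lambda>(z, c). {z, c} \<in> D \<and> i + 1 < pos n z \<and> pos n z \<le> 2 * n - i \<and>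
    ({z, c} \<in> B \<or> pos n c < i \<or> 2 * n - i < pos n c))"
  have "\<exists>zc. Q zc"
  proof (rule ccontr)
    assume no: "\<nexists>zc. Q zc"
    \<comment> \<open>Without a candidate the lines would pair the nodes of \<open>E\<close> among
      themselves, but \<open>E\<close> occupies the positions i + 2 to 2n - i, an odd number of
      them.\<close>
    define E where "E = {u \<in> nodes n. i + 1 < pos n u \<and> pos n u \<le> 2 * n - i}"
    have closed: "v \<in> E" if "u \<in> E" "{u, v} \<in> D" for u v
    proof -
      have "\<not> Q (u, v)" using no by blast
      moreover have "{v, u} \<in> D" using that(2) by (simp add: insert_commute)
      ultimately show ?thesis
        using that capped[of v u] TL_line_nodes[OF D that(2)] unfolding Q_def E_def by auto
    qed
    have UE: "\<Union>{l \<in> D. l \<subseteq> E} = E"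
    proof
      show "E \<subseteq> \<Union>{l \<in> D. l \<subseteq> E}"
      proof
        fix u assume u: "u \<in> E"
        then have "u \<in> nodes n" by (simp add: E_def)
        then obtain v where "{u, v} \<in> D" by (rule TL_line_ex[OF D])
        then show "u \<in> \<Union>{l \<in> D. l \<subseteq> E}" using closed u by blast
      qed
    qed blast
    have finE: "finite E" using finite_nodes[of n] by (auto simp: E_def)
    have "2 * card {l \<in> D. l \<subseteq> E} = card (\<Union>{l \<in> D. l \<subseteq> E})"
    proof (rule card_partition)
      show "finite {l \<in> D. l \<subseteq> E}" by (rule finite_subset[of _ "Pow E"]) (use finE in auto)
      show "finite (\<Union>{l \<in> D. l \<subseteq> E})" using UE finE by simp
      show "card l = 2" if "l \<in> {l \<in> D. l \<subseteq> E}" for l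
        using D that by (simp add: TL_diagrams_def)
      show "l \<inter> l' = {}" if "l \<in> {l \<in> D. l \<subseteq> E}" "l' \<in> {l \<in> D. l \<subseteq> E}" "l \<noteq> l'" for l l'
      proof (rule ccontr)
        assume "l \<inter> l' \<noteq> {}"
        then have "\<exists>u. u \<in> l \<and> u \<in> l'" by blast
        then have "l = l'" using TL_block_unique[OF D, of l l'] that(1,2) by auto
        with that(3) show False by simp
      qed
    qed
    then have "2 * card {l \<in> D. l \<subseteq> E} = card E" using UE by simp
    moreover have "card E = card {i + 2..2 * n - i}"
    proof (rule bij_betw_same_card[of "pos n"], rule bij_betw_imageI)
      show "inj_on (pos n) E" using pos_eq_iff by (auto simp: inj_on_def E_def)
      show "pos n ` E = {i + 2..2 * n - i}"
      proof
        show "{i + 2..2 * n - i} \<subseteq> pos n ` E"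
        proof
          fix p assume p: "p \<in> {i + 2..2 * n - i}"
          then have "1 \<le> p" "p \<le> 2 * n" by auto
          then obtain u where "u \<in> nodes n" "pos n u = p" using pos_surj by blast
          then show "p \<in> pos n ` E" using p by (auto simp: E_def)
        qed
      qed (auto simp: E_def)
    qed
    moreover have "card {i + 2..2 * n - i} = 2 * (n - i - 1) + 1" using i by simp
    ultimately have "2 * card {l \<in> D. l \<subseteq> E} = 2 * (n - i - 1) + 1" by linarith
    then show False by presburger
  qed
  \<comment> \<open>The first candidate met on the clockwise walk from the cap belongs to the line
    directly below it.\<close>
  then obtain zc where "Q zc" and minzc: "\<And>zc'. Q zc' \<Longrightarrow> pos n (fst zc) \<le> pos n (fst zc')"
    using ex_has_least_nat[of Q _ "\<lambda>zc. pos n (fst zc)"] by blast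
  moreover obtain z c where "zc = (z, c)" by fastforce
  ultimately have Qz: "Q (z, c)" and min: "\<And>u v. Q (u, v) \<Longrightarrow> pos n z \<le> pos n u" by fastforce+
  have zc: "{z, c} \<in> D" "i + 1 < pos n z" "pos n z \<le> 2 * n - i"
    "{z, c} \<in> B \<or> pos n c < i \<or> 2 * n - i < pos n c"
    using Qz by (auto simp: Q_def)
  have cz: "{c, z} \<in> D" using zc(1) by (simp add: insert_commute)
  have "pos n c \<noteq> pos n z" using pos_eq_iff TL_line_nodes[OF D zc(1)] by blast
  have 5: "pos n c < i \<or> pos n z < pos n c"
  proof (rule ccontr)
    assume "\<not> ?thesis"
    then have "i + 1 < pos n c" "pos n c < pos n z"
      using capped[OF cz zc(2)] \<open>pos n c \<noteq> pos n z\<close> by linarith+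
    moreover from this have "{c, z} \<in> B" using zc(3,4) by (auto simp: insert_commute)
    ultimately show False using min[of c z] cz zc(3) by (auto simp: Q_def)
  qed
  have 6: "{u, v} \<notin> B \<and> i + 1 < pos n v \<and> pos n v < pos n z"
    if uv: "{u, v} \<in> D" and u: "i + 1 < pos n u" "pos n u < pos n z" for u v
  proof -
    have "\<not> Q (u, v)" using min[of u v] u by auto
    then have nB: "{u, v} \<notin> B" and v: "i \<le> pos n v" "pos n v \<le> 2 * n - i"
      using uv u zc(3) by (auto simp: Q_def)
    have vu: "{v, u} \<in> D" using uv by (simp add: insert_commute)
    have v1: "i + 1 < pos n v" using capped[OF vu u(1)] v by linarith
    have "v \<noteq> z"
    proof
      assume vz: "v = z"
      then have "u = c" using TL_line_unique[OF D zc(1)] vu by blast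
      then have "{z, c} \<notin> B" using nB vz by (simp add: insert_commute)
      then show False using zc(3,4) 5 u unfolding \<open>u = c\<close> by linarith
    qed
    then have "pos n v \<noteq> pos n z" using pos_eq_iff TL_line_nodes[OF D uv] TL_line_nodes[OF D zc(1)] by blast
    \<comment> \<open>A line from before \<open>z\<close> to beyond it would enclose the line from
      \<open>z\<close> to \<open>c\<close>. That line would then be undecorated and end inside the
      region, so \<open>z\<close> would not be a candidate.\<close>
    moreover have "\<not> pos n z < pos n v"
    proof
      assume zv: "pos n z < pos n v"
      then have "{z, c} \<notin> B" using blob_not_enclosed[OF DB _ uv u(2)] by blast
      moreover have "pos n u < pos n c \<and> pos n c < pos n v" by (rule TL_nested[OF D uv zc(1) u(2) zv])
      ultimately show False using zc(4) u(1) v(2) by linarith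
    qed
    ultimately show ?thesis using nB v1 by linarith
  qed
  show ?thesis using that[OF zc 5] 6 by blast
qed

section \<open>The cost of a diagram and the induction\<close>

fun col :: "node \<Rightarrow> nat" where
  "col (North j) = j"
| "col (South j) = j"

text \<open>The least number of vertical lines between neighbouring columns that must be crossed. A
  decorated line is drawn from both ends to column 1, with one added for the blob: (col u - 1) +
  (col v - 1) + 1. Removing a blob at node 1 lowers the total by 1, undoing a cap lowers it by 2,
  and the identity has cost 0.\<close>

definition line_cost :: "line set \<Rightarrow> line \<Rightarrow> nat" where
  "line_cost B l = (if l \<in> B then sum col l - 1 else Max (col ` l) - Min (col ` l))"

fun diagram_cost :: "blob_diagram \<Rightarrow> nat" where
  "diagram_cost (D, B) = sum (line_cost B) D"

lemma line_cost_pair: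
  assumes "u \<noteq> v"
  shows "{u, v} \<in> B \<Longrightarrow> line_cost B {u, v} = col u + col v - 1"
    and "{u, v} \<notin> B \<Longrightarrow> line_cost B {u, v} = max (col u) (col v) - min (col u) (col v)"
  using assms by (simp_all add: line_cost_def)

text \<open>Without caps every northern node is joined to a southern one. Planarity makes this map
  increasing, and the only increasing map of {1..n} to itself is the identity.\<close>

lemma no_caps_id:
  assumes D: "D \<in> TL_diagrams n" and nocap: "\<And>a b. {North a, North b} \<notin> D"
  shows "D = id_diagram n"
proof -
  have "\<exists>k. {North j, South k} \<in> D" if j: "j \<in> {1..n}" for j
  proof -
    have "North j \<in> nodes n" using j by auto
    then obtain v where v: "{North j, v} \<in> D" by (rule TL_line_ex[OF D])
    then show ?thesis using nocap by (cases v) auto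
  qed
  then obtain f where f: "\<And>j. j \<in> {1..n} \<Longrightarrow> {North j, South (f j)} \<in> D" by metis
  have fr: "f j \<in> {1..n}" if "j \<in> {1..n}" for j
    using TL_line_nodes[OF D f[OF that]] by auto
  have mono: "f i < f j" if "i < j" "i \<in> {1..n}" "j \<in> {1..n}" for i j
  proof -
    have "pos n (North i) < pos n (North j)" "pos n (North j) < pos n (South (f i))"
      using that fr[of i] by auto
    from TL_nested[OF D f[OF that(2)] f[OF that(3)] this] show ?thesis
      using fr[of i] fr[of j] that by auto
  qed
  have "inj_on f {1..n}"
    by (rule linorder_inj_onI) (use mono in \<open>force+\<close>)
  then have surj: "f ` {1..n} = {1..n}"
    using fr by (intro endo_inj_surj) auto
  have fid: "f j = j" if "j \<in> {1..n}" for j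
    using that
  proof (induction j rule: less_induct)
    case (less j)
    then obtain k where k: "k \<in> {1..n}" "f k = j" using surj by (metis imageE)
    have "\<not> k < j" using less k by force
    moreover have "\<not> j < k"
    proof
      assume "j < k"
      then have "f j < j" using mono[of j k] k less.prems by auto
      moreover from this have "f (f j) = f j" using less fr by blast
      moreover have "f (f j) < f j" using mono[of "f j" j] fr less.prems calculation(1) by blast
      ultimately show False by simp
    qed
    ultimately show ?case using k by (simp add: not_less_iff_gr_or_eq)
  qed
  have sub: "{North j, South j} \<in> D" if "1 \<le> j" "j \<le> n" for j
    using f[of j] fid[of j] that by auto
  show ?thesis
  proof
    show "id_diagram n \<subseteq> D" using sub by (auto simp: id_diagram_def)
    show "D \<subseteq> id_diagram n"
    proof
      fix l assume l: "l \<in> D"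
      obtain u v where uv: "l = {u, v}" by (rule TL_line_cases[OF D l])
      have un: "u \<in> nodes n" using TL_line_nodes[OF D] l uv by blast
      define j where "j = col u"
      have j: "1 \<le> j" "j \<le> n" "u = North j \<or> u = South j" using un by (cases u; simp add: j_def)+
      have "l = {North j, South j}"
        by (rule TL_block_unique[OF D l sub[OF j(1,2)], of u]) (use uv j(3) in auto)
      then show "l \<in> id_diagram n" using j by (auto simp: id_diagram_def)
    qed
  qed
qed

text \<open>With no undecorated cap left, the undecorated line at node 1 runs to the south and
  encloses all other northern nodes. It thereby excludes decorated caps, and once the diagram is the
  identity it excludes every other blob.\<close>

lemma reduced_is_id:
  assumes DB: "(D, B) \<in> blob_diagrams n" and n: "1 \<le> n"
    and v: "{North 1, v} \<in> D" "{North 1, v} \<notin> B"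
    and caps: "\<And>a b. {North a, North b} \<in> D \<Longrightarrow> {North a, North b} \<in> B"
  shows "D = id_diagram n \<and> B = {}"
proof -
  note D = blob_diagramsD(1)[OF DB]
  have BD: "B \<subseteq> D" by (rule blob_diagramsD(2)[OF DB])
  obtain k where k: "v = South k" using v caps by (cases v) auto
  have kn: "k \<le> n" using TL_line_nodes[OF D v(1)] k by auto
  have "{North a, North b} \<notin> D" for a b
  proof
    assume ab: "{North a, North b} \<in> D"
    then have B: "{North a, North b} \<in> B" by (rule caps)
    then have "a \<noteq> 1" using TL_line_unique[OF D ab, of v] v by auto
    moreover have "1 \<le> a" "a \<le> n" using TL_line_nodes[OF D ab] by auto
    ultimately have "pos n (North 1) < pos n (North a)" "pos n (North a) < pos n v"
      using k kn by simp_all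
    then show False by (rule blob_not_enclosed[OF DB B v(1)])
  qed
  then have id: "D = id_diagram n" by (rule no_caps_id[OF D])
  have "l \<notin> B" for l
  proof
    assume l: "l \<in> B"
    then obtain j where j: "l = {North j, South j}" "1 \<le> j" "j \<le> n" using BD id by (auto simp: id_diagram_def)
    have "{North 1, South 1} \<in> D" using id n by (auto simp: id_diagram_line)
    then have "v = South 1" using TL_line_unique[OF D v(1)] by blast
    then have "j \<noteq> 1" using l j(1) v(2) by auto
    then show False
      using blob_not_enclosed[OF DB, of "North j" "South j" "North 1" "South 1"] l j \<open>{North 1, South 1} \<in> D\<close> by auto
  qed
  then show ?thesis using id by blast
qed

text \<open>A diagram is dismantled from the top by removing a blob at node 1 or an innermost
  undecorated cap; \<open>reduced_is_id\<close> shows that only the identity resists both. The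
  hypotheses offered in the cases \<open>e\<close> and \<open>U\<close> are those of
  \<open>stack_e\<close> and \<open>stack_U\<close>.\<close>

lemma blob_diagram_induct [consumes 2, case_names id e U]:
  assumes "(D, B) \<in> blob_diagrams n" "1 \<le> n"
    and id: "Q (id_diagram n) {}"
    and e: "\<And>D B v. (D, B) \<in> blob_diagrams n \<Longrightarrow> {North 1, v} \<in> D \<Longrightarrow> {North 1, v} \<notin> B \<Longrightarrow>
       Q D B \<Longrightarrow> Q D (insert {North 1, v} B)"
    and U: "\<And>D B i c z. (D, B) \<in> blob_diagrams n \<Longrightarrow> 1 \<le> i \<Longrightarrow> i < n \<Longrightarrow> {North i, c} \<in> D \<Longrightarrow> c \<noteq> North (i + 1) \<Longrightarrow>
       {North (i + 1), z} \<in> D \<Longrightarrow> {North (i + 1), z} \<notin> B \<Longrightarrow> Q D B \<Longrightarrow>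
       Q (insert {North i, North (i + 1)} (insert {z, c} (D - {{North i, c}, {North (i + 1), z}})))
         (if {North i, c} \<in> B then insert {z, c} (B - {{North i, c}}) else B)"
  shows "Q D B"
  using assms(1)
proof (induction "diagram_cost (D, B)" arbitrary: D B rule: less_induct)
  case less
  note DB = less.prems
  note D = blob_diagramsD(1)[OF DB]
  note BD = blob_diagramsD(2)[OF DB]
  note finD = finite_TL[OF D]
  have "North 1 \<in> nodes n" using \<open>1 \<le> n\<close> by auto
  then obtain v where v: "{North 1, v} \<in> D" by (rule TL_line_ex[OF D])
  consider "{North 1, v} \<in> B" | a b where "{North a, North b} \<in> D" "{North a, North b} \<notin> B"
    | "{North 1, v} \<notin> B" "\<And>a b. {North a, North b} \<in> D \<Longrightarrow> {North a, North b} \<in> B" by blast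
  then show ?case
  proof cases
    case 1
    define B' where "B' = B - {{North 1, v}}"
    have DB': "(D, B') \<in> blob_diagrams n" using DB by (auto simp: B'_def blob_diagrams_def)
    note vn = TL_line_nodes[OF D v]
    have "1 \<le> col v" using vn by (cases v) auto
    then have lt: "line_cost B' {North 1, v} < line_cost B {North 1, v}"
      using line_cost_pair[OF vn(3)] 1 by (simp add: B'_def)
    have "diagram_cost (D, B') < diagram_cost (D, B)"
      unfolding diagram_cost.simps
    proof (rule sum_strict_mono_ex1[OF finD])
      show "\<forall>l\<in>D. line_cost B' l \<le> line_cost B l"
      proof
        fix l assume "l \<in> D"
        show "line_cost B' l \<le> line_cost B l"
          using lt by (cases "l = {North 1, v}") (auto simp: line_cost_def B'_def)
      qed
      show "\<exists>l\<in>D. line_cost B' l < line_cost B l" using lt v by blast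
    qed
    then have "Q D B'" using less.hyps DB' by blast
    then have "Q D (insert {North 1, v} B')" using e[OF DB' v] by (simp add: B'_def)
    moreover have "insert {North 1, v} B' = B" using 1 by (auto simp: B'_def)
    ultimately show ?thesis by simp
  next
    case 2
    obtain i where i: "1 \<le> i" "i < n" and cap: "{North i, North (i + 1)} \<in> D" "{North i, North (i + 1)} \<notin> B"
      by (rule innermost_cap_ex[OF DB 2])
    obtain z c where zc: "{z, c} \<in> D" and Z: "i + 1 < pos n z" "pos n z \<le> 2 * n - i"
      and CB: "{z, c} \<in> B \<or> pos n c < i \<or> 2 * n - i < pos n c"
      and C: "pos n c < i \<or> pos n z < pos n c"
      and inner: "\<forall>u v. {u, v} \<in> D \<longrightarrow> i + 1 < pos n u \<longrightarrow> pos n u < pos n z \<longrightarrow>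
         {u, v} \<notin> B \<and> i + 1 < pos n v \<and> pos n v < pos n z"
      by (rule next_line_ex[OF DB i cap])
    define T where "T = D - {{North i, North (i + 1)}, {z, c}}"
    define D' where "D' = insert {North i, c} (insert {North (i + 1), z} T)"
    define B' where "B' = (if {z, c} \<in> B then insert {North i, c} (B - {{z, c}}) else B)"
    note uc = undo_cap[OF DB i cap zc Z(1) C inner[rule_format], folded T_def, folded D'_def B'_def]
    note zn = TL_line_nodes[OF D zc]
    have dist: "c \<noteq> North i" "z \<noteq> North (i + 1)" "z \<noteq> North i" using Z C by auto
    have T: "line_cost B' l = line_cost B l" if "l \<in> T" for l
    proof -
      have "l \<noteq> {z, c}" "l \<noteq> {North i, c}" using that uc(6) by (auto simp: T_def)
      then have "l \<in> B' \<longleftrightarrow> l \<in> B" by (auto simp: B'_def)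
      then show ?thesis by (simp add: line_cost_def)
    qed
    have finT: "finite T" using finD by (simp add: T_def)
    have TD: "D = insert {North i, North (i + 1)} (insert {z, c} T)"
      using cap(1) zc by (auto simp: T_def)
    have "{North i, North (i + 1)} \<noteq> {z, c}" using dist by (auto simp: doubleton_eq_iff)
    then have "{North i, North (i + 1)} \<notin> insert {z, c} T" "{z, c} \<notin> T" by (simp_all add: T_def)
    then have "diagram_cost (D, B) = line_cost B {North i, North (i + 1)} + (line_cost B {z, c} + sum (line_cost B) T)"
      unfolding diagram_cost.simps by (subst TD) (simp add: finT)
    moreover have "{North i, c} \<notin> insert {North (i + 1), z} T" "{North (i + 1), z} \<notin> T"
      using uc(6,7) dist zn by (auto simp: T_def doubleton_eq_iff)
    then have "diagram_cost (D', B') = line_cost B' {North i, c} + (line_cost B' {North (i + 1), z} + sum (line_cost B) T)"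
      unfolding diagram_cost.simps D'_def using finT T by simp
    moreover have "line_cost B {North i, North (i + 1)} = 1" using line_cost_pair(2)[OF _ cap(2)] by simp
    moreover have "i + 1 \<le> col z" using Z zn by (cases z) auto
    moreover have "line_cost B' {North (i + 1), z} = col z - (i + 1)"
      using line_cost_pair(2)[OF dist(2)[symmetric] uc(3)] \<open>i + 1 \<le> col z\<close> by simp
    \<comment> \<open>Moving an end from \<open>z\<close> to column i saves \<open>col z\<close> - i
      on the line to \<open>c\<close>. The other new line costs one less than that, and the cap of
      cost 1 is gone.\<close>
    moreover have "line_cost B' {North i, c} + col z < i + 1 + line_cost B {z, c} + 1"
    proof (cases "{z, c} \<in> B")
      case True
      then show ?thesis
        using line_cost_pair(1)[OF zn(3) True] line_cost_pair(1)[OF dist(1)[symmetric], of B'] uc(8) i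
          \<open>i + 1 \<le> col z\<close> by simp
    next
      case False
      \<comment> \<open>An undecorated candidate ends west of the vertical line through the cap:
        northern nodes before i, or southern nodes up to i, since a position beyond 2n - i means a
        southern node at most i.\<close>
      then have "col c \<le> i" using CB zn i by (cases c) auto
      then show ?thesis
        using line_cost_pair(2)[OF zn(3) False] line_cost_pair(2)[OF dist(1)[symmetric], of B'] uc(8) False
          \<open>i + 1 \<le> col z\<close> by simp
    qed
    ultimately have "diagram_cost (D', B') < diagram_cost (D, B)" by linarith
    then have "Q D' B'" using less.hyps uc(1) by blast
    then show ?thesis using U[OF uc(1) i _ uc(2) _ uc(3)] uc(4,5) by (simp add: D'_def)
  next
    case 3
    then show ?thesis using reduced_is_id[OF DB \<open>1 \<le> n\<close> v 3] id by simp
  qed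
qed

section \<open>Linear independence\<close>

text \<open>\<open>True\<close> is an opening bracket in the clockwise walk. Undecorated lines give
  the matched pairs, ends of decorated lines the unmatched openings, and no closing bracket stays
  unmatched.\<close>

definition code :: "nat \<Rightarrow> blob_diagram \<Rightarrow> node \<Rightarrow> bool" where
  "code n d u \<longleftrightarrow> (\<exists>v. {u, v} \<in> fst d \<and> ({u, v} \<in> snd d \<or> pos n u < pos n v))"

lemma code_line:
  assumes "D \<in> TL_diagrams n" "{u, v} \<in> D"
  shows "code n (D, B) u \<longleftrightarrow> {u, v} \<in> B \<or> pos n u < pos n v"
proof
  assume "code n (D, B) u"
  then obtain v' where v': "{u, v'} \<in> D" "{u, v'} \<in> B \<or> pos n u < pos n v'" by (auto simp: code_def)
  then show "{u, v} \<in> B \<or> pos n u < pos n v" using TL_line_unique[OF assms v'(1)] by simp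
next
  assume "{u, v} \<in> B \<or> pos n u < pos n v"
  then show "code n (D, B) u" using assms(2) unfolding code_def fst_conv snd_conv by blast
qed

lemma TL_line_ordered:
  assumes D: "D \<in> TL_diagrams n" and l: "l \<in> D"
  obtains u v where "l = {u, v}" "pos n u < pos n v"
proof -
  obtain u v where uv: "l = {u, v}" by (rule TL_line_cases[OF D l])
  then have "{u, v} \<in> D" using l by simp
  then have "pos n u \<noteq> pos n v" using pos_eq_iff TL_line_nodes[OF D] by blast
  then consider "pos n u < pos n v" | "pos n v < pos n u" by linarith
  then show ?thesis
  proof cases
    case 1 then show ?thesis by (rule that[OF uv])
  next
    case 2
    have "l = {v, u}" using uv by (simp only: insert_commute)
    then show ?thesis using 2 by (rule that)
  qed
qed

text \<open>The weights are positive and strictly decreasing along the walk, since positions run up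
  to 2n. So both an additional opening bracket and an earlier one raise the potential.\<close>

definition potential :: "nat \<Rightarrow> (node \<Rightarrow> bool) \<Rightarrow> nat" where
  "potential n g = (\<Sum>u\<in>nodes n. if g u then 2 * n + 1 - pos n u else 0)"

lemma potential_lines:
  assumes D: "D \<in> TL_diagrams n"
  shows "potential n g = (\<Sum>l\<in>D. \<Sum>u\<in>l. if g u then 2 * n + 1 - pos n u else 0)"
proof -
  have "nodes n = \<Union>D" using D by (simp add: TL_diagrams_def partition_on_def)
  moreover have "\<forall>l\<in>D. finite l" using D by (auto simp: TL_diagrams_def intro: card_ge_0_finite)
  moreover have "\<forall>l\<in>D. \<forall>l'\<in>D. l \<noteq> l' \<longrightarrow> l \<inter> l' = {}"
    using D by (auto simp: TL_diagrams_def partition_on_def disjoint_def)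
  ultimately show ?thesis unfolding potential_def by (simp add: sum.Union_disjoint)
qed

text \<open>A line of \<open>(D, B)\<close> carries at most as many opening brackets of \<open>g\<close> as of the code, and the code
  opens an undecorated line at its first end, which has the larger weight.\<close>

lemma potential_less_code:
  assumes DB: "(D, B) \<in> blob_diagrams n"
    and g: "\<And>u v. {u, v} \<in> D \<Longrightarrow> {u, v} \<notin> B \<Longrightarrow> g u \<noteq> g v"
    and ne: "u \<in> nodes n" "g u \<noteq> code n (D, B) u"
  shows "potential n g < potential n (code n (D, B))"
proof -
  note D = blob_diagramsD(1)[OF DB]
  let ?w = "\<lambda>g u. if g u then 2 * n + 1 - pos n u else (0::nat)"
  have line: "(\<Sum>u\<in>l. ?w g u) \<le> (\<Sum>u\<in>l. ?w (code n (D, B)) u) \<and>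
    ((\<exists>u\<in>l. g u \<noteq> code n (D, B) u) \<longrightarrow> (\<Sum>u\<in>l. ?w g u) < (\<Sum>u\<in>l. ?w (code n (D, B)) u))"
    if l: "l \<in> D" for l
  proof -
    obtain x y where xy: "l = {x, y}" "pos n x < pos n y" by (rule TL_line_ordered[OF D l])
    have xyD: "{x, y} \<in> D" "{y, x} \<in> D" using l xy(1) by (simp_all add: insert_commute)
    note xn = TL_line_nodes[OF D xyD(1)]
    have b: "pos n y \<le> 2 * n" using pos_bounds[OF xn(2)] by simp
    have S: "(\<Sum>u\<in>l. ?w h u) = ?w h x + ?w h y" for h using xy(1) xn(3) by simp
    have cx: "code n (D, B) x" using code_line[OF D xyD(1)] xy(2) by blast
    have cy: "code n (D, B) y \<longleftrightarrow> {x, y} \<in> B"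
      using code_line[OF D xyD(2), of B] xy(2) by (simp add: insert_commute)
    have ex: "(\<exists>u\<in>l. g u \<noteq> code n (D, B) u) \<longleftrightarrow> \<not> g x \<or> g y \<noteq> ({x, y} \<in> B)"
      using xy(1) cx cy by auto
    show ?thesis
    proof (cases "{x, y} \<in> B")
      case True
      then show ?thesis unfolding S ex using cx cy b xy(2) by auto
    next
      case False
      then have "g x \<noteq> g y" using g xyD(1) by blast
      then show ?thesis unfolding S ex using cx cy b xy(2) False by auto
    qed
  qed
  obtain v where "{u, v} \<in> D" by (rule TL_line_ex[OF D ne(1)])
  then have "\<exists>l\<in>D. (\<Sum>u\<in>l. ?w g u) < (\<Sum>u\<in>l. ?w (code n (D, B)) u)"
    using line ne(2) by blast
  moreover have "finite D" by (rule finite_TL[OF D])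
  ultimately show ?thesis
    unfolding potential_lines[OF D] using line by (intro sum_strict_mono_ex1) auto
qed

text \<open>Matched brackets are recovered from the inside out. By induction on the length of the
  line, the nodes between \<open>u\<close> and \<open>v\<close> are already joined to each other in
  \<open>D'\<close>, so the closing bracket at \<open>v\<close> can find its partner neither among
  them nor, as the opening at \<open>u\<close> is still free, further back.\<close>

lemma code_undecorated:
  assumes DB: "(D, B) \<in> blob_diagrams n" and DB': "(D', B') \<in> blob_diagrams n"
    and eq: "\<And>u. u \<in> nodes n \<Longrightarrow> code n (D, B) u = code n (D', B') u"
    and uv: "{u, v} \<in> D" "{u, v} \<notin> B" "pos n u < pos n v"
  shows "{u, v} \<in> D' \<and> {u, v} \<notin> B'"
  using uv
proof (induction "pos n v - pos n u" arbitrary: u v rule: less_induct)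
  case less
  note D = blob_diagramsD(1)[OF DB] and D' = blob_diagramsD(1)[OF DB']
  note uv = less.prems
  note un = TL_line_nodes[OF D uv(1)]
  have inside: "\<exists>t. {s, t} \<in> D' \<and> pos n u < pos n t \<and> pos n t < pos n v"
    if s: "s \<in> nodes n" "pos n u < pos n s" "pos n s < pos n v" for s
  proof -
    obtain t where st: "{s, t} \<in> D" by (rule TL_line_ex[OF D s(1)])
    then have ts: "{t, s} \<in> D" by (simp add: insert_commute)
    have t: "pos n u < pos n t" "pos n t < pos n v" using TL_nested[OF D uv(1) st s(2,3)] by auto
    have nB: "{s, t} \<notin> B" "{t, s} \<notin> B"
      using blob_not_enclosed[OF DB _ uv(1)] s t by blast+
    have "pos n s \<noteq> pos n t" using pos_eq_iff TL_line_nodes[OF D st] by blast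
    then consider "pos n s < pos n t" | "pos n t < pos n s" by linarith
    then have "{s, t} \<in> D'"
    proof cases
      case 1
      then have "pos n t - pos n s < pos n v - pos n u" using s t by linarith
      from less.hyps[OF this st nB(1) 1] show ?thesis by blast
    next
      case 2
      then have "pos n s - pos n t < pos n v - pos n u" using s t by linarith
      from less.hyps[OF this ts nB(2) 2] show ?thesis by (simp add: insert_commute)
    qed
    then show ?thesis using t by blast
  qed
  have vu: "{v, u} \<in> D" "{v, u} \<notin> B" using uv by (simp_all add: insert_commute)
  have cu: "code n (D', B') u" using code_line[OF D uv(1)] uv(3) eq[OF un(1)] by blast
  have cv: "\<not> code n (D', B') v" using code_line[OF D vu(1)] uv(3) vu(2) eq[OF un(2)] by auto
  obtain y where vy: "{v, y} \<in> D'" by (rule TL_line_ex[OF D' un(2)])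
  then have yv: "{y, v} \<in> D'" by (simp add: insert_commute)
  note yn = TL_line_nodes[OF D' vy]
  have y: "{v, y} \<notin> B'" "pos n y < pos n v"
    using cv code_line[OF D' vy] pos_eq_iff[OF yn(1,2)] yn(3) by auto
  show ?case
  proof (cases "y = u")
    case True then show ?thesis using vy y by (simp add: insert_commute)
  next
    case False
    then have "pos n y \<noteq> pos n u" using pos_eq_iff[OF yn(2) un(1)] by blast
    then consider "pos n u < pos n y" | "pos n y < pos n u" by linarith
    then show ?thesis
    proof cases
      case 1
      obtain t where "{y, t} \<in> D'" "pos n t < pos n v" using inside[OF yn(2) 1 y(2)] by blast
      then show ?thesis using TL_line_unique[OF D' yv, of t] by auto
    next
      \<comment> \<open>The line from \<open>y\<close> to \<open>v\<close> encloses
        \<open>u\<close>, which is therefore undecorated in \<open>D'\<close> and, being an opening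
        bracket, must close at some \<open>x\<close> between \<open>u\<close> and \<open>v\<close>.
        But \<open>x\<close> is already joined to a node in between.\<close>
      case 2
      obtain x where ux: "{u, x} \<in> D'" by (rule TL_line_ex[OF D' un(1)])
      have x: "pos n x < pos n v" using TL_nested[OF D' yv ux 2 uv(3)] by blast
      have "{u, x} \<notin> B'" using blob_not_enclosed[OF DB' _ yv 2 uv(3)] by blast
      then have "pos n u < pos n x" using cu code_line[OF D' ux] by blast
      then obtain t where t: "{x, t} \<in> D'" "pos n u < pos n t"
        using inside[OF TL_line_nodes(2)[OF D' ux] _ x] by blast
      have "{x, u} \<in> D'" using ux by (simp add: insert_commute)
      then show ?thesis using TL_line_unique[OF D' _ t(1), of u] t(2) by auto
    qed
  qed
qed

text \<open>The unmatched openings are the same nodes in both diagrams. Exposed lines do not enclose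
  one another, so these nodes are paired consecutively along the walk; the induction follows the
  first ends in this order.\<close>

lemma code_decorated:
  assumes DB: "(D, B) \<in> blob_diagrams n" and DB': "(D', B') \<in> blob_diagrams n"
    and eq: "\<And>u. u \<in> nodes n \<Longrightarrow> code n (D, B) u = code n (D', B') u"
    and uv: "{u, v} \<in> B" "pos n u < pos n v"
  shows "{u, v} \<in> B'"
  using uv
proof (induction "pos n u" arbitrary: u v rule: less_induct)
  case less
  note D = blob_diagramsD(1)[OF DB] and D' = blob_diagramsD(1)[OF DB']
  note BD = blob_diagramsD(2)[OF DB] and BD' = blob_diagramsD(2)[OF DB']
  \<comment> \<open>Otherwise \<open>x\<close> lies on an undecorated line of the second diagram,
    which \<open>code_undecorated\<close> carries back to the first, where the line at
    \<open>x\<close> is decorated.\<close>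
  have transfer: "\<exists>y. {x, y} \<in> B2"
    if DB1: "(D1, B1) \<in> blob_diagrams n" and DB2: "(D2, B2) \<in> blob_diagrams n"
      and eq: "\<And>u. u \<in> nodes n \<Longrightarrow> code n (D2, B2) u = code n (D1, B1) u"
      and x: "{x, x'} \<in> B1" for D1 B1 D2 B2 x x'
  proof -
    note D1 = blob_diagramsD(1)[OF DB1] and D2 = blob_diagramsD(1)[OF DB2]
    have xD: "{x, x'} \<in> D1" using blob_diagramsD(2)[OF DB1] x by blast
    note xn = TL_line_nodes[OF D1 xD]
    obtain y where xy: "{x, y} \<in> D2" by (rule TL_line_ex[OF D2 xn(1)])
    have "{x, y} \<in> B2"
    proof (rule ccontr)
      assume nB: "{x, y} \<notin> B2"
      obtain s t where st: "{x, y} = {s, t}" "pos n s < pos n t" by (rule TL_line_ordered[OF D2 xy])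
      have "{s, t} \<in> D1 \<and> {s, t} \<notin> B1"
        by (rule code_undecorated[OF DB2 DB1 eq]) (use xy nB st in auto)
      then have "{x, y} \<in> D1" "{x, y} \<notin> B1" unfolding st(1) by blast+
      then show False using TL_line_unique[OF D1 xD] x by blast
    qed
    then show ?thesis by blast
  qed
  have uD: "{u, v} \<in> D" using less.prems BD by blast
  note un = TL_line_nodes[OF D uD]
  obtain u2 where u2: "{u, u2} \<in> B'"
    using transfer[OF DB DB' eq[symmetric] less.prems(1)] by blast
  have u2D: "{u, u2} \<in> D'" using u2 BD' by blast
  note u2n = TL_line_nodes[OF D' u2D]
  have u2u: "{u2, u} \<in> B'" "{u2, u} \<in> D'" using u2 u2D by (simp_all add: insert_commute)
  obtain t where t: "{u2, t} \<in> B" using transfer[OF DB' DB eq u2u(1)] by blast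
  have tu2: "{t, u2} \<in> B" using t by (simp add: insert_commute)
  have tD: "{u2, t} \<in> D" using t BD by blast
  have vu: "{v, u} \<in> B" using less.prems by (simp add: insert_commute)
  have ne: "pos n u2 \<noteq> pos n u" using pos_eq_iff[OF u2n(2,1)] u2n(3) by blast
  show ?case
  proof (cases "pos n u2 < pos n u")
    \<comment> \<open>The line of \<open>B\<close> at \<open>u2\<close> starts before
      \<open>u\<close>, so by induction it is also in \<open>B'\<close> and must be the line from
      \<open>u2\<close> to \<open>u\<close>. Then \<open>u\<close> is its second end, not its
      first.\<close>
    case True
    have "pos n t \<noteq> pos n u2" using pos_eq_iff TL_line_nodes[OF D tD] by blast
    then consider "pos n u2 < pos n t" | "pos n t < pos n u2" by linarith
    then have "{u2, t} \<in> B'"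
    proof cases
      case 1 then show ?thesis using less.hyps[OF True t] by blast
    next
      case 2
      then have "pos n t < pos n u" using True by linarith
      from less.hyps[OF this tu2 2] show ?thesis by (simp add: insert_commute)
    qed
    then have "t = u" using TL_line_unique[OF D' _ u2u(2)] BD' by blast
    then have "v = u2" using TL_line_unique[OF D uD] tu2 BD by blast
    then show ?thesis using less.prems(2) True by simp
  next
    case False
    then have lt: "pos n u < pos n u2" using ne by linarith
    show ?thesis
    proof (rule linorder_cases[of "pos n u2" "pos n v"])
      assume "pos n u2 < pos n v"
      then show ?thesis using blob_not_enclosed[OF DB t uD lt] by blast
    next
      assume "pos n u2 = pos n v"
      then have "u2 = v" using pos_eq_iff[OF u2n(2) un(2)] by blast
      then show ?thesis using u2 by simp
    next
      assume "pos n v < pos n u2"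
      moreover obtain y where "{v, y} \<in> B'" using transfer[OF DB DB' eq[symmetric] vu] by blast
      ultimately show ?thesis using blob_not_enclosed[OF DB' _ u2D less.prems(2)] by blast
    qed
  qed
qed

lemma code_inj:
  assumes DB: "(D, B) \<in> blob_diagrams n" and DB': "(D', B') \<in> blob_diagrams n"
    and eq: "\<And>u. u \<in> nodes n \<Longrightarrow> code n (D, B) u = code n (D', B') u"
  shows "D = D' \<and> B = B'"
proof -
  have sub: "D1 \<subseteq> D2 \<and> B1 \<subseteq> B2"
    if DB1: "(D1, B1) \<in> blob_diagrams n" and DB2: "(D2, B2) \<in> blob_diagrams n"
      and eq: "\<And>u. u \<in> nodes n \<Longrightarrow> code n (D1, B1) u = code n (D2, B2) u" for D1 B1 D2 B2
  proof -
    note D1 = blob_diagramsD(1)[OF DB1]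
    have "(l \<in> B1 \<longrightarrow> l \<in> B2) \<and> l \<in> D2" if l: "l \<in> D1" for l
    proof -
      obtain u v where uv: "l = {u, v}" "pos n u < pos n v" by (rule TL_line_ordered[OF D1 l])
      show ?thesis
      proof (cases "l \<in> B1")
        case True
        then have "l \<in> B2" using code_decorated[OF DB1 DB2 eq] uv by blast
        then show ?thesis using blob_diagramsD(2)[OF DB2] by blast
      next
        case False
        then have "l \<in> D2" using code_undecorated[OF DB1 DB2 eq] uv l by blast
        then show ?thesis using False by blast
      qed
    qed
    then show ?thesis using blob_diagramsD(2)[OF DB1] by blast
  qed
  show ?thesis using sub[OF DB DB' eq] sub[OF DB' DB eq[symmetric]] by blast
qed

text \<open>In a vanishing combination the diagram of largest potential among those with nonzero
  coefficient is isolated: at the entry given by its code all other terms are 0, and a unit times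
  its own coefficient remains.\<close>

lemma masks_independent:
  assumes M: "\<And>d. d \<in> blob_diagrams n \<Longrightarrow> has_mask (2 * n) (M d) (compatible n d)"
    and zero: "\<And>v w. v \<in> words (2 * n) \<Longrightarrow> w \<in> words (2 * n) \<Longrightarrow>
                 (\<Sum>d\<in>blob_diagrams n. f d * M d v w) = 0"
    and d0: "d0 \<in> blob_diagrams n"
  shows "f d0 = 0"
proof (rule ccontr)
  assume "f d0 \<noteq> 0"
  define X where "X = {d \<in> blob_diagrams n. f d \<noteq> 0}"
  have finX: "finite X" using finite_blob_diagrams[of n] by (simp add: X_def)
  have "d0 \<in> X" using d0 \<open>f d0 \<noteq> 0\<close> by (simp add: X_def)
  then have "Max ((\<lambda>d. potential n (code n d)) ` X) \<in> (\<lambda>d. potential n (code n d)) ` X"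
    using finX by (intro Max_in) blast+
  then obtain d where d: "d \<in> X" "Max ((\<lambda>d. potential n (code n d)) ` X) = potential n (code n d)"
    by blast
  have max: "potential n (code n d') \<le> potential n (code n d)" if "d' \<in> X" for d'
    unfolding d(2)[symmetric] using finX that by (intro Max_ge) auto
  obtain D B where DB: "d = (D, B)" by fastforce
  have dB: "(D, B) \<in> blob_diagrams n" using d(1) DB by (simp add: X_def)
  note D = blob_diagramsD(1)[OF dB]
  \<comment> \<open>The words are chosen so that the spin is the code in the half
    \<open>True\<close> and its negation in the half \<open>False\<close>; the reversed condition on
    \<open>w\<close> cancels the sign that \<open>spin\<close> puts on southern nodes. Opposite
    halves satisfy every decorated line, and the code alternates on undecorated ones.\<close>
  obtain v where v: "v \<in> words (2 * n)"
    "\<forall>b j. 1 \<le> j \<longrightarrow> j \<le> n \<longrightarrow> half n v b j = (code n d (North j) = b)"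
    using words_exists_half[of n "\<lambda>b j. code n d (North j) = b"] by blast
  obtain w where w: "w \<in> words (2 * n)"
    "\<forall>b j. 1 \<le> j \<longrightarrow> j \<le> n \<longrightarrow> half n w b j = (code n d (South j) \<noteq> b)"
    using words_exists_half[of n "\<lambda>b j. code n d (South j) \<noteq> b"] by blast
  have spin: "spin n v w b u = (code n d u = b)" if "u \<in> nodes n" for b u
    using that v(2) w(2) by (cases u) auto
  have comp: "compatible n d v w"
    unfolding DB compatible.simps
  proof (intro allI impI)
    fix x y assume xy: "{x, y} \<in> D"
    note xn = TL_line_nodes[OF D xy]
    have yx: "{y, x} \<in> D" using xy by (simp add: insert_commute)
    have "pos n x \<noteq> pos n y" using pos_eq_iff[OF xn(1,2)] xn(3) by blast
    then have "code n d x \<noteq> code n d y" if "{x, y} \<notin> B"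
      using code_line[OF D xy, of B] code_line[OF D yx, of B] that
      unfolding DB by (auto simp: insert_commute)
    then show "if {x, y} \<in> B then spin n v w True x \<noteq> spin n v w False x
      else \<forall>b. spin n v w b x \<noteq> spin n v w b y"
      using spin[OF xn(1)] spin[OF xn(2)] by auto
  qed
  have other: "f d' * M d' v w = 0" if d': "d' \<in> blob_diagrams n" "d' \<noteq> d" for d'
  proof (cases "d' \<in> X \<and> compatible n d' v w")
    case False
    then show ?thesis
    proof (cases "d' \<in> X")
      case True
      then have "M d' v w = 0" using False M[OF d'(1)] v(1) w(1) unfolding has_mask_def by auto
      then show ?thesis by simp
    next
      case False
      then show ?thesis using d'(1) by (simp add: X_def)
    qed
  next
    \<comment> \<open>Compatibility in a single half already says that the code of \<open>d\<close>
      alternates on the undecorated lines of \<open>d'\<close>. By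
      \<open>potential_less_code\<close> and maximality the codes agree, so \<open>d'\<close> is
      \<open>d\<close>.\<close>
    case True
    obtain D' B' where DB': "d' = (D', B')" by fastforce
    have dB': "(D', B') \<in> blob_diagrams n" using d'(1) DB' by simp
    note D' = blob_diagramsD(1)[OF dB']
    have g: "code n d x \<noteq> code n d y" if "{x, y} \<in> D'" "{x, y} \<notin> B'" for x y
    proof -
      have "spin n v w True x \<noteq> spin n v w True y"
        using True that unfolding DB' compatible.simps by (metis (full_types))
      then show ?thesis using spin TL_line_nodes[OF D' that(1)] by simp
    qed
    have "code n d u = code n (D', B') u" if u: "u \<in> nodes n" for u
    proof (rule ccontr)
      assume "code n d u \<noteq> code n (D', B') u"
      from potential_less_code[where g = "code n d", OF dB' g u this]
      have "potential n (code n d) < potential n (code n d')" using DB' by simp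
      then show False using max[of d'] True by simp
    qed
    then have "d = d'" using code_inj[OF dB dB'] DB DB' by simp
    then show ?thesis using d'(2) by simp
  qed
  have "(\<Sum>d'\<in>blob_diagrams n. f d' * M d' v w) = (\<Sum>d'\<in>{d}. f d' * M d' v w)"
    by (rule sum.mono_neutral_right) (use finite_blob_diagrams d(1) other in \<open>auto simp: X_def\<close>)
  then have "f d * M d v w = 0" using zero[OF v(1) w(1)] by simp
  moreover have "M d v w dvd 1"
    using M[of d] comp d(1) v(1) w(1) unfolding has_mask_def X_def by auto
  ultimately have "f d = 0" using unit_mult_eq_0D by blast
  then show False using d(1) by (simp add: X_def)
qed

section \<open>The homomorphism\<close>

lemma blob_basis_in_algebra:
  assumes "is_subring R" "d \<in> blob_diagrams n"
  shows "blob_basis d \<in> blob_algebra n R"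
  using assms is_subring_zero[OF assms(1)] is_subring_one[OF assms(1)]
  by (auto simp: blob_algebra_def blob_basis_def)

lemma has_mask_cong:
  assumes "has_mask N A c"
    "\<And>v w. v \<in> words N \<Longrightarrow> w \<in> words N \<Longrightarrow> c v w \<longleftrightarrow> c' v w"
  shows "has_mask N A c'"
  using assms unfolding has_mask_def by simp

text \<open>Every step of the induction is a product of basis elements with factor 1, so \<rho>
  turns it into a product of matrices, to which the mask computations apply.\<close>

lemma blob_hom_mask:
  assumes hom: "blob_hom n q \<gamma> \<delta> R S \<rho>" and R: "is_subring R" and n: "1 \<le> n"
    and E: "has_mask (2 * n) (\<rho> (blob_e n)) (compatible n (id_diagram n, {{North 1, South 1}}))"
    and U: "\<And>i. 1 \<le> i \<Longrightarrow> i < n \<Longrightarrow>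
              has_mask (2 * n) (\<rho> (blob_U n i)) (compatible n (U_diagram n i, {}))"
    and DB: "(D, B) \<in> blob_diagrams n"
  shows "has_mask (2 * n) (\<rho> (blob_basis (D, B))) (compatible n (D, B))"
proof -
  have mult: "\<rho> (blob_basis (stack_diagram n d1 d2)) =
      mat_mult (2 * n) (\<rho> (blob_basis d1)) (\<rho> (blob_basis d2))"
    if "d1 \<in> blob_diagrams n" "d2 \<in> blob_diagrams n" "stack_factor n q \<gamma> \<delta> d1 d2 = 1" for d1 d2
    using hom blob_mult_basis[OF that] blob_basis_in_algebra[OF R that(1)] blob_basis_in_algebra[OF R that(2)]
    unfolding blob_hom_def by metis
  show ?thesis using DB n
  proof (induction rule: blob_diagram_induct)
    case id
    have "\<rho> (blob_basis (id_diagram n, {})) = mat_one (2 * n)"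
      using hom by (simp add: blob_hom_def blob_one_def)
    then show ?case by (simp add: has_mask_def compatible_id mat_one_def del: compatible.simps)
  next
    case (e D B v)
    have "\<rho> (blob_basis (D, insert {North 1, v} B)) = mat_mult (2 * n) (\<rho> (blob_e n)) (\<rho> (blob_basis (D, B)))"
      using mult[OF e_blob_diagram[OF n] e(1) stack_e(2)[OF e(1-3)]]
      unfolding stack_e(1)[OF e(1-3)] blob_e_def .
    then show ?case using has_mask_e_mult[OF e(1-3) n E e(4)] by (simp only:)
  next
    case (U D B i c z)
    show ?case
      using mult[OF U_blob_diagram[OF U(2,3)] U(1) stack_U(2)[OF U(1-7)]]
        has_mask_U_step[OF U(1-7) assms(5)[OF U(2,3)] U(8)]
      unfolding stack_U(1)[OF U(1-7)] blob_U_def by (simp only:)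
  qed
qed

text \<open>Linearity is available for two summands at a time, so \<open>f\<close> is built up one
  diagram at a time; every partial sum keeps its coefficients in \<open>R\<close>.\<close>

lemma blob_hom_expand:
  assumes hom: "blob_hom n q \<gamma> \<delta> R S \<rho>" and R: "is_subring R" and f: "f \<in> blob_algebra n R"
  shows "\<rho> f v w = (\<Sum>d\<in>blob_diagrams n. f d * \<rho> (blob_basis d) v w)"
proof -
  note in_alg = blob_basis_in_algebra[OF R]
  have add: "\<rho> (\<lambda>d. g d + h d) = (\<lambda>v w. \<rho> g v w + \<rho> h v w)"
    if "g \<in> blob_algebra n R" "h \<in> blob_algebra n R" for g h
    using hom that unfolding blob_hom_def by blast
  have scale: "\<rho> (\<lambda>d. c * g d) = (\<lambda>v w. c * \<rho> g v w)" if "c \<in> R" "g \<in> blob_algebra n R" for c g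
    using hom that unfolding blob_hom_def by blast
  have "\<rho> (\<lambda>d. if d \<in> A then f d else 0) v w = (\<Sum>d\<in>A. f d * \<rho> (blob_basis d) v w)"
    if "finite A" "A \<subseteq> blob_diagrams n" for A
    using that
  proof (induction A rule: finite_induct)
    case empty
    have "\<rho> (\<lambda>d. 0 * f d) = (\<lambda>v w. 0 * \<rho> f v w)" by (rule scale[OF is_subring_zero[OF R] f])
    then show ?case by simp
  next
    case (insert a A)
    then have a: "a \<in> blob_diagrams n" and fa: "f a \<in> R" using f by (auto simp: blob_algebra_def)
    have "(\<lambda>d. if d \<in> A then f d else 0) \<in> blob_algebra n R"
      using f is_subring_zero[OF R] by (auto simp: blob_algebra_def)
    moreover have "(\<lambda>d. f a * blob_basis a d) \<in> blob_algebra n R"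
      using in_alg[OF a] fa is_subring_mult[OF R] by (auto simp: blob_algebra_def)
    moreover have "(\<lambda>d. if d \<in> insert a A then f d else 0) =
        (\<lambda>d. f a * blob_basis a d + (if d \<in> A then f d else 0))"
      using insert.hyps(2) by (auto simp: blob_basis_def)
    ultimately have "\<rho> (\<lambda>d. if d \<in> insert a A then f d else 0) v w =
        f a * \<rho> (blob_basis a) v w + \<rho> (\<lambda>d. if d \<in> A then f d else 0) v w"
      by (simp only: add scale[OF fa in_alg[OF a]])
    then show ?case using insert by simp
  qed
  from this[OF finite_blob_diagrams subset_refl]
  have "\<rho> (\<lambda>d. if d \<in> blob_diagrams n then f d else 0) v w =
      (\<Sum>d\<in>blob_diagrams n. f d * \<rho> (blob_basis d) v w)" .
  moreover have "(\<lambda>d. if d \<in> blob_diagrams n then f d else 0) = f"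
    using f by (auto simp: blob_algebra_def)
  ultimately show ?thesis by simp
qed

lemma blob_hom_inj:
  assumes hom: "blob_hom n q \<gamma> \<delta> R S \<rho>" and R: "is_subring R"
    and M: "\<And>d. d \<in> blob_diagrams n \<Longrightarrow> has_mask (2 * n) (\<rho> (blob_basis d)) (compatible n d)"
  shows "inj_on \<rho> (blob_algebra n R)"
proof (rule inj_onI)
  fix f g assume fg: "f \<in> blob_algebra n R" "g \<in> blob_algebra n R" "\<rho> f = \<rho> g"
  have "(\<Sum>d\<in>blob_diagrams n. (f d - g d) * \<rho> (blob_basis d) v w) = \<rho> f v w - \<rho> g v w" for v w
    unfolding blob_hom_expand[OF hom R fg(1)] blob_hom_expand[OF hom R fg(2)]
    by (simp add: left_diff_distrib sum_subtractf)
  then have zero: "(\<Sum>d\<in>blob_diagrams n. (f d - g d) * \<rho> (blob_basis d) v w) = 0" for v w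
    using fg(3) by simp
  have "f d - g d = 0" if "d \<in> blob_diagrams n" for d
    by (rule masks_independent[where f = "\<lambda>d. f d - g d" and M = "\<lambda>d. \<rho> (blob_basis d)", OF M zero that])
  moreover have "f d = 0" "g d = 0" if "d \<notin> blob_diagrams n" for d
    using fg(1,2) that unfolding blob_algebra_def by blast+
  ultimately show "f = g" by (metis ext right_minus_eq)
qed

theorem mainTheorem7:
  fixes x a q r s t \<gamma> \<delta> :: "'k::comm_ring_1"
    and R S :: "'k set"
    and m :: int and n :: nat
    and \<rho>\<^sub>0 :: "'k blob_element \<Rightarrow> 'k wmat"
  assumes "x dvd 1"
    and "a ^ 4 = - 1"
    and "1 \<le> n"
    and "q = x ^ 2"
    and "r = a ^ 2 * unit_powi q m"
    and "s = a ^ 5 * x"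
    and "t = a ^ 3 * x"
    and "\<gamma> = unit_powi q (m - 1) - unit_powi q (- m + 1)"
    and "\<delta> = unit_powi q m - unit_powi q (- m)"
    and "R = generated_subring {q, unit_inv q}"
    and "S = generated_subring {a, x, unit_inv x}"
    and "blob_hom n q \<gamma> \<delta> R S \<rho>\<^sub>0"
    and "\<rho>\<^sub>0 (blob_e n) = (\<lambda>v w. unit_powi a (- 2) * M2 (2 * n) r n v w)"
    and "\<And>i. 1 \<le> i \<Longrightarrow> i \<le> n - 1 \<Longrightarrow>
           \<rho>\<^sub>0 (blob_U n i) = mat_mult (2 * n) (M2 (2 * n) s (n - i)) (M2 (2 * n) t (n + i))"
  shows "mirror_representation n q \<gamma> \<delta> R S \<rho>\<^sub>0 \<and> inj_on \<rho>\<^sub>0 (blob_algebra n R)"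
proof -
  note n = \<open>1 \<le> n\<close> and hom = \<open>blob_hom n q \<gamma> \<delta> R S \<rho>\<^sub>0\<close>
  have R: "is_subring R" and S: "is_subring S" using assms(10,11) by (simp_all add: is_subring_generated)
  have aS: "a \<in> S" "x \<in> S" "unit_inv x \<in> S"
    using generated_subring_superset[of "{a, x, unit_inv x}"] assms(11) by auto
  \<comment> \<open>Here the inverse of \<open>a\<close> is seen to lie in the subring generated by
    \<open>a\<close>.\<close>
  have a: "a * - (a ^ 3) = 1" using assms(2) by (simp add: numeral_eq_Suc)
  then have au: "a dvd 1" by (metis dvdI)
  \<comment> \<open>The matrix \<open>U_mat\<close> contains \<open>unit_inv p\<close>. For the
    factors to be matrices over \<open>S\<close>, the inverses of \<open>s\<close> and
    \<open>t\<close> must be polynomials in \<open>a\<close> times \<open>unit_inv x\<close>;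
    \<open>k\<close> will be 5 and 3.\<close>
  have inv: "unit_inv (a ^ k * x) \<in> S" for k
  proof -
    have "(a ^ k * x) * ((- (a ^ 3)) ^ k * unit_inv x) = (a * - (a ^ 3)) ^ k * (x * unit_inv x)"
      unfolding power_mult_distrib by (simp only: ac_simps)
    then have "unit_inv (a ^ k * x) = (- (a ^ 3)) ^ k * unit_inv x"
      using unit_inv_right[OF assms(1)] a by (intro unit_inv_eqI) simp
    then show ?thesis using aS S by (auto intro!: is_subring_mult is_subring_power is_subring_uminus)
  qed
  have su: "s dvd 1" and tu: "t dvd 1" and ru: "r dvd 1"
    unfolding assms(4-7) by (intro unit_mult unit_power unit_powi_dvd_one au assms(1))+
  have sS: "s \<in> S" "unit_inv s \<in> S" and tS: "t \<in> S" "unit_inv t \<in> S"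
    unfolding assms(6,7) using inv aS S by (auto intro!: is_subring_mult is_subring_power)
  have e: "has_mask (2 * n) (\<rho>\<^sub>0 (blob_e n)) (flip_mask (2 * n) n)"
    unfolding assms(13) using n
    by (intro has_mask_scale has_mask_M2 ru unit_powi_dvd_one au) auto
  have X: "has_mask (2 * n) (M2 (2 * n) s (n - i)) (flip_mask (2 * n) (n - i))"
    and Y: "has_mask (2 * n) (M2 (2 * n) t (n + i)) (flip_mask (2 * n) (n + i))"
    if "1 \<le> i" "i < n" for i
    using that by (auto intro!: has_mask_M2 su tu)
  have one: "(1::'k) dvd 1" by simp
  have "\<exists>X\<in>matrices (2 * n) S. \<exists>Y\<in>matrices (2 * n) S.
      \<rho>\<^sub>0 (blob_U n i) = mat_mult (2 * n) X Y \<and>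
      (\<exists>h. h dvd 1 \<and> mask_equiv (2 * n) X (R_mat (2 * n) h (U_diagram (2 * n) (n - i)))) \<and>
      (\<exists>h. h dvd 1 \<and> mask_equiv (2 * n) Y (R_mat (2 * n) h (U_diagram (2 * n) (n + i))))"
    if i: "1 \<le> i \<and> i \<le> n - 1" for i
  proof (intro bexI conjI exI)
    have i': "1 \<le> i" "i < n" using i n by auto
    show "\<rho>\<^sub>0 (blob_U n i) = mat_mult (2 * n) (M2 (2 * n) s (n - i)) (M2 (2 * n) t (n + i))"
      using assms(14) i by blast
    show "mask_equiv (2 * n) (M2 (2 * n) s (n - i)) (R_mat (2 * n) 1 (U_diagram (2 * n) (n - i)))"
      by (rule has_mask_mask_equiv[OF X[OF i'] has_mask_R_mat]) (use i' in auto)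
    show "mask_equiv (2 * n) (M2 (2 * n) t (n + i)) (R_mat (2 * n) 1 (U_diagram (2 * n) (n + i)))"
      by (rule has_mask_mask_equiv[OF Y[OF i'] has_mask_R_mat]) (use i' in auto)
  qed (use one M2_in_matrices[OF S sS] M2_in_matrices[OF S tS] in auto)
  moreover have "mask_equiv (2 * n) (\<rho>\<^sub>0 (blob_e n)) (R_mat (2 * n) 1 (U_diagram (2 * n) n))"
    by (rule has_mask_mask_equiv[OF e has_mask_R_mat]) (use n in auto)
  ultimately have "mirror_representation n q \<gamma> \<delta> R S \<rho>\<^sub>0"
    unfolding mirror_representation_def using hom one by blast
  moreover have "has_mask (2 * n) (\<rho>\<^sub>0 (blob_basis d)) (compatible n d)" if d: "d \<in> blob_diagrams n" for d
  proof -
    have E: "has_mask (2 * n) (\<rho>\<^sub>0 (blob_e n)) (compatible n (id_diagram n, {{North 1, South 1}}))"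
      by (rule has_mask_cong[OF e flip_mask_e[OF n]])
    have U: "has_mask (2 * n) (\<rho>\<^sub>0 (blob_U n i)) (compatible n (U_diagram n i, {}))" if "1 \<le> i" "i < n" for i
      using has_mask_U_mult[OF that X[OF that] Y[OF that]] assms(14)[of i] that by simp
    obtain D B where "d = (D, B)" by fastforce
    then show ?thesis using blob_hom_mask[OF hom R n E U, of D B] d by blast
  qed
  ultimately show ?thesis using blob_hom_inj[OF hom R] by blast
qed

end
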